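(* Let $A$ and $H$ be cocommutative Hopf algebras over a field $k$ (with antipodes $S_A$ and $S_H$) such that $(A,\triangleleft,\triangleright)$ is an $H$-bimodule Hopf algebra. Let $R:A\to A$ be a linear map and let $B$ be a Rota-Baxter operator on $H$. Define a linear map $\overline{B}:A\natural H\to A\natural H$ on the L-R smash product by $$\overline{B}(a\natural h)=B(h_1)\triangleright R(a)\triangleleft B(h_2)\natural B(h_3),\qquad a\in A,\ h\in H.$$ Then $\overline{B}$ is a Rota-Baxter operator on $A\natural H$ if and only if $R$ is a Rota-Baxter operator on $A$ and, for all $a,b\in A$ and $g,h\in H$, $$R\Big(\big((a_1R(a_2))\triangleleft h_1\big)\, b\, \big(h_2\triangleright S_A(R(a_3))\big)\Big)=\big(S_H(B(h))\triangleright R(a)\big)R(b),$$ $$R\Big(g_{1}B(g_2)\triangleright b\triangleleft S_H(B(g_3))\Big)=R(b)\triangleleft S_H(B(g)).$$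
   Context: Sweedler notation $\Delta(x)=x_1\otimes x_2$ (summation omitted) is used, with iterated coproducts written $x_1\otimes x_2\otimes x_3$, etc. A Rota-Baxter operator on a cocommutative Hopf algebra $(H,S)$ is a coalgebra map $B:H\to H$ such that $B(x)B(y)=B\big(x_1B(x_2)\,y\,S(B(x_3))\big)$ for all $x,y\in H$. For Hopf algebras $A,H$, $A$ is an $H$-bimodule Hopf algebra if $A$ is an $H$-bimodule with left action $\triangleright:H\otimes A\to A$ and right action $\triangleleft:A\otimes H\to A$ (so $(h\triangleright a)\triangleleft g=h\triangleright(a\triangleleft g)$) such that $h\triangleright(ab)=(h_1\triangleright a)(h_2\triangleright b)$, $h\triangleright 1_A=\varepsilon(h)1_A$, $(ab)\triangleleft h=(a\triangleleft h_1)(b\triangleleft h_2)$, $1_A\triangleleft h=\varepsilon(h)1_A$, $\Delta(h\triangleright a)=h_1\triangleright a_1\otimes h_2\triangleright a_2$, $\Delta(a\triangleleft h)=a_1\triangleleft h_1\otimes a_2\triangleleft h_2$, $\varepsilon(h\triangleright a)=\varepsilon(a\triangleleft h)=\varepsilon(a)\varepsilon(h)$, and $S_A$ is $H$-bilinear. The L-R smash product $A\natural H$ is $A\otimes H$ (elements written $a\natural h$) with multiplication $(a\natural h)(b\natural g)=(a\triangleleft g_2)(h_1\triangleright b)\natural h_2g_1$, unit $1_A\natural 1_H$, comultiplication $\Delta(a\natural h)=(a_1\natural h_1)\otimes(a_2\natural h_2)$, counit $\varepsilon(a\natural h)=\varepsilon_A(a)\varepsilon_H(h)$ and antipode $S(a\natural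 h)=S_H(h_3)\triangleright S_A(a)\triangleleft S_H(h_2)\natural S_H(h_1)$; for cocommutative $H$ this is a Hopf algebra (cocommutative when $A$ and $H$ are). *)

theory Defs
  imports Main "HOL-Library.Function_Algebras"
begin

text \<open>Hopf algebras over a field 'k, given on a carrier set inside a type 'x whose
addition/zero/negation come from the class ab_group_add.  Tensors in V (x) W are
represented by finite lists of pairs; two lists represent the same tensor iff all
bilinear k-valued forms agree on them (valid over a field).\<close>

record ('k, 'x) hopf_alg =
  carr :: "'x set"
  smul :: "'k \<Rightarrow> 'x \<Rightarrow> 'x"
  mult :: "'x \<Rightarrow> 'x \<Rightarrow> 'x"
  one_h :: "'x"
  comult :: "'x \<Rightarrow> ('x \<times> 'x) list"
  counit :: "'x \<Rightarrow> 'k"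
  antipode :: "'x \<Rightarrow> 'x"

definition sw2 :: "('x \<Rightarrow> ('x \<times> 'x) list) \<Rightarrow> ('x \<Rightarrow> 'x \<Rightarrow> 'v::comm_monoid_add) \<Rightarrow> 'x \<Rightarrow> 'v" where
  "sw2 D f x = sum_list (map (\<lambda>(x1, x2). f x1 x2) (D x))"

definition sw3 :: "('x \<Rightarrow> ('x \<times> 'x) list) \<Rightarrow> ('x \<Rightarrow> 'x \<Rightarrow> 'x \<Rightarrow> 'v::comm_monoid_add) \<Rightarrow> 'x \<Rightarrow> 'v" where
  "sw3 D f x = sum_list (map (\<lambda>(u, x3). sum_list (map (\<lambda>(x1, x2). f x1 x2 x3) (D u))) (D x))"

definition vspace :: "('k::field, 'x::ab_group_add, 'z) hopf_alg_scheme \<Rightarrow> bool" where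
  "vspace V \<longleftrightarrow>
     0 \<in> carr V \<and> (\<forall>x\<in>carr V. \<forall>y\<in>carr V. x + y \<in> carr V) \<and> (\<forall>x\<in>carr V. - x \<in> carr V) \<and>
     (\<forall>c. \<forall>x\<in>carr V. smul V c x \<in> carr V) \<and>
     (\<forall>c. \<forall>x\<in>carr V. \<forall>y\<in>carr V. smul V c (x + y) = smul V c x + smul V c y) \<and>
     (\<forall>c d. \<forall>x\<in>carr V. smul V (c + d) x = smul V c x + smul V d x) \<and>
     (\<forall>c d. \<forall>x\<in>carr V. smul V c (smul V d x) = smul V (c * d) x) \<and>
     (\<forall>x\<in>carr V. smul V 1 x = x)"

definition lin_map :: "('k::field, 'x::ab_group_add, 'z) hopf_alg_scheme \<Rightarrow> ('k, 'y::ab_group_add, 'w) hopf_alg_scheme \<Rightarrow> ('x \<Rightarrow> 'y) \<Rightarrow> bool" where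
  "lin_map V W f \<longleftrightarrow> (\<forall>x\<in>carr V. f x \<in> carr W) \<and>
     (\<forall>x\<in>carr V. \<forall>y\<in>carr V. f (x + y) = f x + f y) \<and>
     (\<forall>c. \<forall>x\<in>carr V. f (smul V c x) = smul W c (f x))"

definition lin_form :: "('k::field, 'x::ab_group_add, 'z) hopf_alg_scheme \<Rightarrow> ('x \<Rightarrow> 'k) \<Rightarrow> bool" where
  "lin_form V f \<longleftrightarrow> (\<forall>x\<in>carr V. \<forall>y\<in>carr V. f (x + y) = f x + f y) \<and>
     (\<forall>c. \<forall>x\<in>carr V. f (smul V c x) = c * f x)"

definition bilin_form :: "('k::field, 'x::ab_group_add, 'z) hopf_alg_scheme \<Rightarrow> ('k, 'y::ab_group_add, 'w) hopf_alg_scheme \<Rightarrow> ('x \<Rightarrow> 'y \<Rightarrow> 'k) \<Rightarrow> bool" where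
  "bilin_form V W f \<longleftrightarrow> (\<forall>x\<in>carr V. lin_form W (f x)) \<and> (\<forall>y\<in>carr W. lin_form V (\<lambda>x. f x y))"

definition trilin_form :: "('k::field, 'x::ab_group_add, 'z) hopf_alg_scheme \<Rightarrow> ('x \<Rightarrow> 'x \<Rightarrow> 'x \<Rightarrow> 'k) \<Rightarrow> bool" where
  "trilin_form V f \<longleftrightarrow> (\<forall>x\<in>carr V. \<forall>y\<in>carr V. lin_form V (f x y)) \<and>
     (\<forall>x\<in>carr V. \<forall>z\<in>carr V. lin_form V (\<lambda>y. f x y z)) \<and>
     (\<forall>y\<in>carr V. \<forall>z\<in>carr V. lin_form V (\<lambda>x. f x y z))"

definition tens_list :: "('k, 'x, 'z) hopf_alg_scheme \<Rightarrow> ('k, 'y, 'w) hopf_alg_scheme \<Rightarrow> ('x \<times> 'y) list \<Rightarrow> bool" where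
  "tens_list V W l \<longleftrightarrow> set l \<subseteq> carr V \<times> carr W"

definition teq :: "('k::field, 'x::ab_group_add, 'z) hopf_alg_scheme \<Rightarrow> ('k, 'y::ab_group_add, 'w) hopf_alg_scheme \<Rightarrow> ('x \<times> 'y) list \<Rightarrow> ('x \<times> 'y) list \<Rightarrow> bool" where
  "teq V W l1 l2 \<longleftrightarrow> tens_list V W l1 \<and> tens_list V W l2 \<and>
     (\<forall>f. bilin_form V W f \<longrightarrow>
        sum_list (map (\<lambda>(x, y). f x y) l1) = sum_list (map (\<lambda>(x, y). f x y) l2))"

definition hopf_algebra :: "('k::field, 'x::ab_group_add, 'z) hopf_alg_scheme \<Rightarrow> bool" where
  "hopf_algebra H \<longleftrightarrow> vspace H \<and>
     \<comment> \<open>associative unital algebra\<close>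
     (\<forall>x\<in>carr H. \<forall>y\<in>carr H. mult H x y \<in> carr H) \<and>
     (\<forall>x\<in>carr H. \<forall>y\<in>carr H. \<forall>z\<in>carr H. mult H (x + y) z = mult H x z + mult H y z) \<and>
     (\<forall>x\<in>carr H. \<forall>y\<in>carr H. \<forall>z\<in>carr H. mult H x (y + z) = mult H x y + mult H x z) \<and>
     (\<forall>c. \<forall>x\<in>carr H. \<forall>y\<in>carr H. mult H (smul H c x) y = smul H c (mult H x y)) \<and>
     (\<forall>c. \<forall>x\<in>carr H. \<forall>y\<in>carr H. mult H x (smul H c y) = smul H c (mult H x y)) \<and>
     (\<forall>x\<in>carr H. \<forall>y\<in>carr H. \<forall>z\<in>carr H. mult H (mult H x y) z = mult H x (mult H y z)) \<and>
     one_h H \<in> carr H \<and>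
     (\<forall>x\<in>carr H. mult H (one_h H) x = x \<and> mult H x (one_h H) = x) \<and>
     \<comment> \<open>coassociative counital coalgebra\<close>
     (\<forall>x\<in>carr H. tens_list H H (comult H x)) \<and>
     (\<forall>x\<in>carr H. \<forall>y\<in>carr H. teq H H (comult H (x + y)) (comult H x @ comult H y)) \<and>
     (\<forall>c. \<forall>x\<in>carr H. teq H H (comult H (smul H c x)) (map (\<lambda>(a, b). (smul H c a, b)) (comult H x))) \<and>
     (\<forall>x\<in>carr H. \<forall>f. trilin_form H f \<longrightarrow>
        sw3 (comult H) f x =
        sum_list (map (\<lambda>(x1, u). sum_list (map (\<lambda>(x2, x3). f x1 x2 x3) (comult H u))) (comult H x))) \<and>
     lin_form H (counit H) \<and>
     (\<forall>x\<in>carr H. sw2 (comult H) (\<lambda>a b. smul H (counit H a) b) x = x) \<and>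
     (\<forall>x\<in>carr H. sw2 (comult H) (\<lambda>a b. smul H (counit H b) a) x = x) \<and>
     \<comment> \<open>bialgebra compatibility\<close>
     (\<forall>x\<in>carr H. \<forall>y\<in>carr H. teq H H (comult H (mult H x y))
        [(mult H a c, mult H b d). (a, b) \<leftarrow> comult H x, (c, d) \<leftarrow> comult H y]) \<and>
     teq H H (comult H (one_h H)) [(one_h H, one_h H)] \<and>
     (\<forall>x\<in>carr H. \<forall>y\<in>carr H. counit H (mult H x y) = counit H x * counit H y) \<and>
     counit H (one_h H) = 1 \<and>
     \<comment> \<open>antipode\<close>
     lin_map H H (antipode H) \<and>
     (\<forall>x\<in>carr H. sw2 (comult H) (\<lambda>a b. mult H (antipode H a) b) x = smul H (counit H x) (one_h H)) \<and>
     (\<forall>x\<in>carr H. sw2 (comult H) (\<lambda>a b. mult H a (antipode H b)) x = smul H (counit H x) (one_h H))"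

definition cocomm :: "('k::field, 'x::ab_group_add, 'z) hopf_alg_scheme \<Rightarrow> bool" where
  "cocomm H \<longleftrightarrow> (\<forall>x\<in>carr H. teq H H (comult H x) (map (\<lambda>(a, b). (b, a)) (comult H x)))"

definition coalg_map :: "('k::field, 'x::ab_group_add, 'z) hopf_alg_scheme \<Rightarrow> ('x \<Rightarrow> 'x) \<Rightarrow> bool" where
  "coalg_map H f \<longleftrightarrow> lin_map H H f \<and>
     (\<forall>x\<in>carr H. teq H H (comult H (f x)) (map (\<lambda>(a, b). (f a, f b)) (comult H x))) \<and>
     (\<forall>x\<in>carr H. counit H (f x) = counit H x)"

definition rb_op :: "('k::field, 'x::ab_group_add, 'z) hopf_alg_scheme \<Rightarrow> ('x \<Rightarrow> 'x) \<Rightarrow> bool" where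
  "rb_op H B \<longleftrightarrow> coalg_map H B \<and>
     (\<forall>x\<in>carr H. \<forall>y\<in>carr H. mult H (B x) (B y) =
        B (sw3 (comult H) (\<lambda>x1 x2 x3. mult H (mult H (mult H x1 (B x2)) y) (antipode H (B x3))) x))"

definition bimod_hopf ::
  "('k::field, 'a::ab_group_add, 'z) hopf_alg_scheme \<Rightarrow> ('k, 'h::ab_group_add, 'w) hopf_alg_scheme \<Rightarrow>
   ('h \<Rightarrow> 'a \<Rightarrow> 'a) \<Rightarrow> ('a \<Rightarrow> 'h \<Rightarrow> 'a) \<Rightarrow> bool" where
  "bimod_hopf A H la ra \<longleftrightarrow>
     (\<forall>h\<in>carr H. \<forall>a\<in>carr A. la h a \<in> carr A \<and> ra a h \<in> carr A) \<and>
     \<comment> \<open>bilinearity of the actions\<close>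
     (\<forall>h\<in>carr H. \<forall>g\<in>carr H. \<forall>a\<in>carr A. la (h + g) a = la h a + la g a \<and> ra a (h + g) = ra a h + ra a g) \<and>
     (\<forall>h\<in>carr H. \<forall>a\<in>carr A. \<forall>b\<in>carr A. la h (a + b) = la h a + la h b \<and> ra (a + b) h = ra a h + ra b h) \<and>
     (\<forall>c. \<forall>h\<in>carr H. \<forall>a\<in>carr A. la (smul H c h) a = smul A c (la h a) \<and> la h (smul A c a) = smul A c (la h a) \<and>
        ra a (smul H c h) = smul A c (ra a h) \<and> ra (smul A c a) h = smul A c (ra a h)) \<and>
     \<comment> \<open>bimodule\<close>
     (\<forall>h\<in>carr H. \<forall>g\<in>carr H. \<forall>a\<in>carr A. la (mult H h g) a = la h (la g a) \<and> ra a (mult H h g) = ra (ra a h) g) \<and>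
     (\<forall>a\<in>carr A. la (one_h H) a = a \<and> ra a (one_h H) = a) \<and>
     (\<forall>h\<in>carr H. \<forall>g\<in>carr H. \<forall>a\<in>carr A. ra (la h a) g = la h (ra a g)) \<and>
     \<comment> \<open>module algebra conditions\<close>
     (\<forall>h\<in>carr H. \<forall>a\<in>carr A. \<forall>b\<in>carr A.
        la h (mult A a b) = sw2 (comult H) (\<lambda>h1 h2. mult A (la h1 a) (la h2 b)) h \<and>
        ra (mult A a b) h = sw2 (comult H) (\<lambda>h1 h2. mult A (ra a h1) (ra b h2)) h) \<and>
     (\<forall>h\<in>carr H. la h (one_h A) = smul A (counit H h) (one_h A) \<and> ra (one_h A) h = smul A (counit H h) (one_h A)) \<and>
     \<comment> \<open>module coalgebra conditions\<close>
     (\<forall>h\<in>carr H. \<forall>a\<in>carr A.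
        teq A A (comult A (la h a)) [(la h1 a1, la h2 a2). (h1, h2) \<leftarrow> comult H h, (a1, a2) \<leftarrow> comult A a] \<and>
        teq A A (comult A (ra a h)) [(ra a1 h1, ra a2 h2). (h1, h2) \<leftarrow> comult H h, (a1, a2) \<leftarrow> comult A a]) \<and>
     (\<forall>h\<in>carr H. \<forall>a\<in>carr A. counit A (la h a) = counit A a * counit H h \<and> counit A (ra a h) = counit A a * counit H h) \<and>
     \<comment> \<open>S_A is H-bilinear\<close>
     (\<forall>h\<in>carr H. \<forall>a\<in>carr A. antipode A (la h a) = la h (antipode A a) \<and> antipode A (ra a h) = ra (antipode A a) h)"

text \<open>Elements of A (x) H are represented canonically by their evaluation on
bilinear k-valued forms on A x H (an injective embedding of A (x) H into the dual of
the space of bilinear forms); the vector space operations are pointwise.\<close>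

type_synonym ('k, 'a, 'h) tensor = "('a \<Rightarrow> 'h \<Rightarrow> 'k) \<Rightarrow> 'k"

definition tens :: "('k::field, 'a::ab_group_add, 'z) hopf_alg_scheme \<Rightarrow> ('k, 'h::ab_group_add, 'w) hopf_alg_scheme \<Rightarrow>
   'a \<Rightarrow> 'h \<Rightarrow> ('k, 'a, 'h) tensor" where
  "tens A H a h = (\<lambda>f. if bilin_form A H f then f a h else 0)"

definition tens_of_list :: "('k::field, 'a::ab_group_add, 'z) hopf_alg_scheme \<Rightarrow> ('k, 'h::ab_group_add, 'w) hopf_alg_scheme \<Rightarrow>
   ('a \<times> 'h) list \<Rightarrow> ('k, 'a, 'h) tensor" where
  "tens_of_list A H l = sum_list (map (\<lambda>(a, h). tens A H a h) l)"

definition tensor_carr :: "('k::field, 'a::ab_group_add, 'z) hopf_alg_scheme \<Rightarrow> ('k, 'h::ab_group_add, 'w) hopf_alg_scheme \<Rightarrow>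
   ('k, 'a, 'h) tensor set" where
  "tensor_carr A H = {tens_of_list A H l | l. tens_list A H l}"

definition srep :: "('k::field, 'a::ab_group_add, 'z) hopf_alg_scheme \<Rightarrow> ('k, 'h::ab_group_add, 'w) hopf_alg_scheme \<Rightarrow>
   ('k, 'a, 'h) tensor \<Rightarrow> ('a \<times> 'h) list" where
  "srep A H t = (SOME l. tens_list A H l \<and> t = tens_of_list A H l)"

definition smash ::
  "('k::field, 'a::ab_group_add, 'z) hopf_alg_scheme \<Rightarrow> ('k, 'h::ab_group_add, 'w) hopf_alg_scheme \<Rightarrow>
   ('h \<Rightarrow> 'a \<Rightarrow> 'a) \<Rightarrow> ('a \<Rightarrow> 'h \<Rightarrow> 'a) \<Rightarrow> ('k, ('k, 'a, 'h) tensor) hopf_alg" where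
  "smash A H la ra =
   \<lparr> carr = tensor_carr A H,
     smul = (\<lambda>c t f. c * t f),
     mult = (\<lambda>t s. sum_list (map (\<lambda>(a, h). sum_list (map (\<lambda>(b, g).
              sw2 (comult H) (\<lambda>h1 h2. sw2 (comult H) (\<lambda>g1 g2.
                 tens A H (mult A (ra a g2) (la h1 b)) (mult H h2 g1)) g) h) (srep A H s))) (srep A H t))),
     one_h = tens A H (one_h A) (one_h H),
     comult = (\<lambda>t. [(tens A H a1 h1, tens A H a2 h2). (a, h) \<leftarrow> srep A H t, (a1, a2) \<leftarrow> comult A a, (h1, h2) \<leftarrow> comult H h]),
     counit = (\<lambda>t. t (\<lambda>a h. counit A a * counit H h)),
     antipode = (\<lambda>t. sum_list (map (\<lambda>(a, h).
              sw3 (comult H) (\<lambda>h1 h2 h3. tens A H (la (antipode H h3) (ra (antipode A a) (antipode H h2))) (antipode H h1)) h)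
              (srep A H t))) \<rparr>"

definition Bbar ::
  "('k::field, 'a::ab_group_add, 'z) hopf_alg_scheme \<Rightarrow> ('k, 'h::ab_group_add, 'w) hopf_alg_scheme \<Rightarrow>
   ('h \<Rightarrow> 'a \<Rightarrow> 'a) \<Rightarrow> ('a \<Rightarrow> 'h \<Rightarrow> 'a) \<Rightarrow> ('a \<Rightarrow> 'a) \<Rightarrow> ('h \<Rightarrow> 'h) \<Rightarrow> ('k, 'a, 'h) tensor \<Rightarrow> ('k, 'a, 'h) tensor" where
  "Bbar A H la ra R B t = sum_list (map (\<lambda>(a, h).
      sw3 (comult H) (\<lambda>h1 h2 h3. tens A H (la (B h1) (ra (R a) (B h2))) (B h3)) h) (srep A H t))"

end

theory Submission
  imports Defs
begin

text \<open>
  Cocommutative Hopf algebras are the group objects of the category of cocommutative coalgebras.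
  Hence for a cocommutative coalgebra \<open>C\<close> the coalgebra maps \<open>C \<rightarrow> A\<close> and \<open>C \<rightarrow> H\<close> (generalized points)
  form groups under convolution, the second acting on the first from both sides by commuting automorphisms,
  and the points of the smash product are the pairs \<open>(f, p)\<close> with \<open>(f, p)(g, q) = ((f \<lhd> q)(p \<rhd> g), pq)\<close>.
  A Sweedler identity holds iff it holds at all points, as one sees at the universal point, so the
  theorem becomes a statement on groups. Put \<open>\<beta> = B p\<close> and \<open>\<gamma> = B q\<close>. Since \<open>B\<close> is a Rota-Baxter operator,
  the second components agree in the identity for \<open>B\<close>-bar, and the first components agree iff
  \<open>(\<gamma>\<inverse> \<rhd> R f)(R g \<lhd> \<beta>\<inverse>) = R ((f \<lhd> \<beta>q\<beta>\<inverse>) (p\<beta> \<rhd> R f \<lhd> \<beta>q\<beta>\<inverse>) (p\<beta> \<rhd> g \<lhd> \<beta>\<inverse>) (p\<beta>q \<rhd> (R f)\<inverse>))\<close>.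
  The cases \<open>p = q = 1\<close>, \<open>p = 1\<close>, and \<open>f = q = 1\<close> are the three conditions on \<open>R\<close>. Conversely, write
  \<open>f = p\<beta> \<rhd> f' \<lhd> \<beta>\<inverse>\<close>; by the last condition \<open>R f = R f' \<lhd> \<beta>\<inverse>\<close>, the argument of \<open>R\<close> on the right is \<open>p\<beta> \<rhd> c \<lhd> \<beta>\<inverse>\<close>
  with \<open>c = ((f' R f') \<lhd> q) g (q \<rhd> (R f')\<inverse>)\<close>, and both conditions together give the identity.
\<close>

section \<open>Vector spaces, linear and bilinear maps\<close>

text \<open>Tensors are compared by scalar bilinear forms only, and the coalgebra axioms are stated
  through such forms, while convolution, actions and products take values in vector spaces. Over a
  field the linear forms separate vectors, and this lifts every axiom to vector-valued maps; hence
  the appeal to Zorn's lemma. The base \<open>C\<close> of the points has to vary: for an identity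
  with arguments in U and V the universal pair of points consists of the projections of U \<otimes>
  V. With E the smash product, the bases A \<otimes> A, H \<otimes> A, E \<otimes> A and E \<otimes>
  E occur. All come from \<open>smash\<close>, whose coalgebra structure does not involve the
  actions. E itself is never treated as a Hopf algebra: passing between elements and points takes a
  cocommutative coalgebra with a bilinear product and a linear antipode. For A and H the points form
  groups only once the antipode is known to be a coalgebra map, which is a theorem and not an axiom.
  \<open>R\<close> is at first merely linear, so it need not send points to points; if
  \<open>B\<close>-bar is a coalgebra map, then so is \<open>R\<close>, as it is recovered from
  \<open>B\<close>-bar on the elements a \<otimes> 1.\<close>

lemma vspaceD:
  assumes "vspace V"
  shows "0 \<in> carr V" "\<And>x y. x \<in> carr V \<Longrightarrow> y \<in> carr V \<Longrightarrow> x + y \<in> carr V"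
    "\<And>x. x \<in> carr V \<Longrightarrow> - x \<in> carr V" "\<And>c x. x \<in> carr V \<Longrightarrow> smul V c x \<in> carr V"
    "\<And>c x y. x \<in> carr V \<Longrightarrow> y \<in> carr V \<Longrightarrow> smul V c (x + y) = smul V c x + smul V c y"
    "\<And>c d x. x \<in> carr V \<Longrightarrow> smul V (c + d) x = smul V c x + smul V d x"
    "\<And>c d x. x \<in> carr V \<Longrightarrow> smul V c (smul V d x) = smul V (c * d) x"
    "\<And>x. x \<in> carr V \<Longrightarrow> smul V 1 x = x"
  using assms unfolding vspace_def by blast+

lemma vspace_diff: "vspace V \<Longrightarrow> x \<in> carr V \<Longrightarrow> y \<in> carr V \<Longrightarrow> x - y \<in> carr V"
  using vspaceD(2)[of V x "- y"] vspaceD(3)[of V y] by simp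

lemma smul_0_left: "vspace V \<Longrightarrow> x \<in> carr V \<Longrightarrow> smul V 0 x = 0"
  using vspaceD(6)[of V x 0 0] by simp

lemma smul_0_right: "vspace V \<Longrightarrow> smul V c 0 = 0"
  using vspaceD(5)[of V 0 0 c] vspaceD(1)[of V] by simp

lemma smul_minus_left: "vspace V \<Longrightarrow> x \<in> carr V \<Longrightarrow> smul V (- c) x = - smul V c x"
  using vspaceD(6)[of V x c "- c"] smul_0_left[of V x]
  by (metis add.right_inverse minus_unique)

lemma smul_minus_right: "vspace V \<Longrightarrow> x \<in> carr V \<Longrightarrow> smul V c (- x) = - smul V c x"
  using vspaceD(5)[of V x "- x" c] smul_0_right[of V c] vspaceD(3)[of V x]
  by (metis add.right_inverse minus_unique)

definition subsp :: "('k::field, 'x::ab_group_add) hopf_alg \<Rightarrow> 'x set \<Rightarrow> bool" where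
  "subsp V M \<longleftrightarrow> M \<subseteq> carr V \<and> 0 \<in> M \<and> (\<forall>x\<in>M. \<forall>y\<in>M. x + y \<in> M) \<and> (\<forall>c. \<forall>x\<in>M. smul V c x \<in> M)"

text \<open>A maximal subspace avoiding \<^term>\<open>w\<close> is a hyperplane complementary to the line through \<^term>\<open>w\<close>.\<close>

lemma linear_form_separates:
  fixes V :: "('k::field, 'x::ab_group_add) hopf_alg"
  assumes V: "vspace V" and w: "w \<in> carr V" "w \<noteq> 0"
  shows "\<exists>f. lin_form V f \<and> f w \<noteq> 0"
proof -
  let ?A = "{M. subsp V M \<and> w \<notin> M}"
  have z: "{0} \<in> ?A" using w V by (auto simp: subsp_def smul_0_right vspaceD)
  have "\<exists>M\<in>?A. \<forall>X\<in>?A. M \<subseteq> X \<longrightarrow> X = M"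
  proof (rule subset_Zorn_nonempty)
    show "?A \<noteq> {}" using z by blast
  next
    fix K assume K: "K \<noteq> {}" "subset.chain ?A K"
    have sub: "\<And>M. M \<in> K \<Longrightarrow> subsp V M \<and> w \<notin> M" using K(2) by (auto simp: subset.chain_def)
    have cmp: "\<And>M N. M \<in> K \<Longrightarrow> N \<in> K \<Longrightarrow> M \<subseteq> N \<or> N \<subseteq> M"
      using K(2) by (auto simp: subset.chain_def)
    have add: "x + y \<in> \<Union>K" if xy: "x \<in> \<Union>K" "y \<in> \<Union>K" for x y
    proof -
      obtain M N where mn: "M \<in> K" "N \<in> K" "x \<in> M" "y \<in> N" using xy by blast
      then consider "x \<in> N" | "y \<in> M" using cmp[of M N] by blast
      then show ?thesis
      proof cases
        case 1 then show ?thesis using mn sub[OF mn(2)] unfolding subsp_def by blast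
      next
        case 2 then show ?thesis using mn sub[OF mn(1)] unfolding subsp_def by blast
      qed
    qed
    have "\<Union>K \<subseteq> carr V" "0 \<in> \<Union>K" "\<And>c x. x \<in> \<Union>K \<Longrightarrow> smul V c x \<in> \<Union>K"
      using sub K(1) unfolding subsp_def by blast+
    then have "subsp V (\<Union>K)"
      unfolding subsp_def using add by blast
    then show "\<Union>K \<in> ?A" using sub by blast
  qed
  then obtain M where M: "subsp V M" "w \<notin> M" and mx: "\<And>X. subsp V X \<Longrightarrow> w \<notin> X \<Longrightarrow> M \<subseteq> X \<Longrightarrow> X = M"
    by blast
  have Mc: "\<And>x. x \<in> M \<Longrightarrow> x \<in> carr V" and M0: "0 \<in> M"
    and Ma: "\<And>x y. x \<in> M \<Longrightarrow> y \<in> M \<Longrightarrow> x + y \<in> M" and Ms: "\<And>c x. x \<in> M \<Longrightarrow> smul V c x \<in> M"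
    using M(1) by (auto simp: subsp_def)
  have Mm: "x \<in> M \<Longrightarrow> - x \<in> M" for x
    using Ms[of x "- 1"] smul_minus_left[OF V Mc, of x 1] vspaceD(8)[OF V Mc, of x] by simp
  \<comment> \<open>The subspace M + kx is strictly larger than M if x is outside M, so by
    maximality it contains w. In w = m + cx the coefficient c is nonzero because w is outside M, and
    the equation can be solved for x.\<close>
  have ex: "\<exists>c. x - smul V c w \<in> M" if x: "x \<in> carr V" for x
  proof (cases "x \<in> M")
    case True then show ?thesis using smul_0_left[OF V w(1)] by (intro exI[of _ 0]) simp
  next
    case False
    let ?X = "{m + smul V c x | m c. m \<in> M}"
    have "subsp V ?X"
      unfolding subsp_def
    proof (intro conjI ballI allI)
      show "?X \<subseteq> carr V" using Mc x V by (auto intro!: vspaceD)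
      show "0 \<in> ?X" using M0 smul_0_left[OF V x] by (auto intro!: exI[of _ 0])
    next
      fix p q assume "p \<in> ?X" "q \<in> ?X"
      then obtain m c n d where "p = m + smul V c x" "q = n + smul V d x" "m \<in> M" "n \<in> M" by blast
      then have "p + q = (m + n) + smul V (c + d) x" "m + n \<in> M"
        using Ma by (auto simp: vspaceD(6)[OF V x] algebra_simps)
      then show "p + q \<in> ?X" by blast
    next
      fix c p assume "p \<in> ?X"
      then obtain m d where "p = m + smul V d x" "m \<in> M" by blast
      then have "smul V c p = smul V c m + smul V (c * d) x" "smul V c m \<in> M"
        using Ms Mc x V by (auto simp: vspaceD)
      then show "smul V c p \<in> ?X" by blast
    qed
    moreover have "m \<in> ?X" if "m \<in> M" for m
    proof -
      have "m = m + smul V 0 x" using smul_0_left[OF V x] by simp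
      then show ?thesis using that by blast
    qed
    then have "M \<subseteq> ?X" by blast
    moreover have "x = 0 + smul V 1 x" using vspaceD(8)[OF V x] by simp
    then have "x \<in> ?X" using M0 by blast
    ultimately have "w \<in> ?X" using mx[of ?X] False by blast
    then obtain m c where mc: "w = m + smul V c x" "m \<in> M" by auto
    have c: "c \<noteq> 0"
    proof
      assume "c = 0"
      then have "w = m" using mc(1) smul_0_left[OF V x] by simp
      then show False using M(2) mc(2) by blast
    qed
    have "smul V (inverse c) w = smul V (inverse c) m + smul V (inverse c) (smul V c x)"
      unfolding mc(1) by (rule vspaceD(5)[OF V Mc[OF mc(2)] vspaceD(4)[OF V x]])
    also have "smul V (inverse c) (smul V c x) = x"
      unfolding vspaceD(7)[OF V x] using c vspaceD(8)[OF V x] by simp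
    finally have "x - smul V (inverse c) w = - smul V (inverse c) m" by simp
    then show ?thesis using Mm Ms mc(2) by metis
  qed
  \<comment> \<open>Two different coefficients would put a nonzero multiple of w, and hence w, into
    M.\<close>
  have uni: "c = d" if "x \<in> carr V" "x - smul V c w \<in> M" "x - smul V d w \<in> M" for x c d
  proof (rule ccontr)
    assume "c \<noteq> d"
    have "smul V (d - c) w = smul V d w - smul V c w"
      using vspaceD(6)[OF V w(1), of d "- c"] smul_minus_left[OF V w(1)] by simp
    also have "\<dots> = (x - smul V c w) + - (x - smul V d w)" by simp
    finally have "smul V (d - c) w \<in> M" using Ma Mm that by metis
    then have "smul V (inverse (d - c)) (smul V (d - c) w) \<in> M" by (rule Ms)
    then show False unfolding vspaceD(7)[OF V w(1)] using M(2) \<open>c \<noteq> d\<close> vspaceD(8)[OF V w(1)] by simp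
  qed
  \<comment> \<open>The coordinate along w modulo M, normalized to 1 at w; its linearity follows
    from uniqueness.\<close>
  define f where "f x = (THE c. x - smul V c w \<in> M)" for x
  have fI: "f x = c" if "x \<in> carr V" "x - smul V c w \<in> M" for x c
    unfolding f_def using that uni by blast
  have fx: "x - smul V (f x) w \<in> M" if "x \<in> carr V" for x
    using ex[OF that] fI[OF that] by blast
  have "lin_form V f" unfolding lin_form_def
  proof (intro conjI ballI allI)
    fix x y assume xy: "x \<in> carr V" "y \<in> carr V"
    show "f (x + y) = f x + f y"
    proof (rule fI)
      have "x + y - smul V (f x + f y) w = (x - smul V (f x) w) + (y - smul V (f y) w)"
        by (simp add: vspaceD(6)[OF V w(1)])
      then show "x + y - smul V (f x + f y) w \<in> M" using Ma fx xy by metis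
    qed (use xy V in \<open>auto intro: vspaceD\<close>)
  next
    fix c x assume x: "x \<in> carr V"
    show "f (smul V c x) = c * f x"
    proof (rule fI)
      have "smul V c (x - smul V (f x) w) = smul V c (x + - smul V (f x) w)" by simp
      also have "\<dots> = smul V c x - smul V (c * f x) w"
        using x w V by (subst vspaceD(5)) (auto simp: vspaceD smul_minus_right)
      finally show "smul V c x - smul V (c * f x) w \<in> M" using Ms fx[OF x] by metis
    qed (use x V in \<open>auto intro: vspaceD\<close>)
  qed
  moreover have "f w = 1"
    by (rule fI) (use w V M0 in \<open>auto simp: vspaceD\<close>)
  ultimately show ?thesis by force
qed

lemma sum_list_map_concat: "sum_list (map f (concat (map g l))) = (\<Sum>x\<leftarrow>l. sum_list (map f (g x)))"
  by (induction l) auto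

section \<open>Linear and bilinear maps; forms are the maps into the field, packaged as a
  space\<close>

definition field_space :: "('k::field, 'k) hopf_alg" where
  "field_space = \<lparr> carr = UNIV, smul = (*), mult = (*), one_h = 1, comult = (\<lambda>_. []), counit = id, antipode = id \<rparr>"

lemma field_space_simps [simp]: "carr field_space = UNIV" "smul field_space = (*)"
  by (auto simp: field_space_def)

lemma vspace_field_space [simp]: "vspace field_space"
  by (auto simp: vspace_def algebra_simps)

lemma lin_form_iff: "lin_form V f \<longleftrightarrow> lin_map V field_space f"
  by (simp add: lin_form_def lin_map_def)

definition bilin :: "('k::field, 'u::ab_group_add) hopf_alg \<Rightarrow> ('k, 'v::ab_group_add) hopf_alg \<Rightarrow>
    ('k, 'w::ab_group_add) hopf_alg \<Rightarrow> ('u \<Rightarrow> 'v \<Rightarrow> 'w) \<Rightarrow> bool" where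
  "bilin U V W L \<longleftrightarrow> (\<forall>u\<in>carr U. lin_map V W (L u)) \<and> (\<forall>v\<in>carr V. lin_map U W (\<lambda>u. L u v))"

lemma bilin_form_iff: "bilin_form U V f \<longleftrightarrow> bilin U V field_space f"
  by (simp add: bilin_form_def bilin_def lin_form_iff)

lemma lin_mapD:
  assumes "lin_map V W f"
  shows "\<And>x. x \<in> carr V \<Longrightarrow> f x \<in> carr W"
    "\<And>x y. x \<in> carr V \<Longrightarrow> y \<in> carr V \<Longrightarrow> f (x + y) = f x + f y"
    "\<And>c x. x \<in> carr V \<Longrightarrow> f (smul V c x) = smul W c (f x)"
  using assms by (auto simp: lin_map_def)

lemma lin_map_0: "lin_map V W f \<Longrightarrow> vspace V \<Longrightarrow> f 0 = 0"
  using lin_mapD(2)[of V W f 0 0] vspaceD(1)[of V] by simp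

lemma lin_map_minus: "lin_map V W f \<Longrightarrow> vspace V \<Longrightarrow> x \<in> carr V \<Longrightarrow> f (- x) = - f x"
  using lin_mapD(2)[of V W f x "- x"] lin_map_0[of V W f] vspaceD(3)[of V x]
  by (metis add.right_inverse minus_unique)

lemma lin_map_cong:
  assumes "lin_map V W f" "vspace V" "\<And>x. x \<in> carr V \<Longrightarrow> g x = f x"
  shows "lin_map V W g"
  using assms(1) vspaceD(2,4)[OF assms(2)] by (simp add: lin_map_def assms(3))

lemma lin_map_comp: "lin_map V W g \<Longrightarrow> lin_map U V f \<Longrightarrow> lin_map U W (\<lambda>x. g (f x))"
  by (simp add: lin_map_def)

lemma lin_map_id: "lin_map X X (\<lambda>x. x)"
  by (simp add: lin_map_def)

lemma bilinD:
  assumes "bilin U V W L"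
  shows "\<And>u v. u \<in> carr U \<Longrightarrow> v \<in> carr V \<Longrightarrow> L u v \<in> carr W"
    "\<And>u. u \<in> carr U \<Longrightarrow> lin_map V W (L u)" "\<And>v. v \<in> carr V \<Longrightarrow> lin_map U W (\<lambda>u. L u v)"
  using assms by (auto simp: bilin_def lin_map_def)

lemma bilinI:
  "(\<And>u. u \<in> carr U \<Longrightarrow> lin_map V W (L u)) \<Longrightarrow> (\<And>v. v \<in> carr V \<Longrightarrow> lin_map U W (\<lambda>u. L u v)) \<Longrightarrow> bilin U V W L"
  by (simp add: bilin_def)

lemma bilin_comp:
  assumes L: "bilin U V W L" and f: "lin_map U' U f" and g: "lin_map V' V g"
  shows "bilin U' V' W (\<lambda>x y. L (f x) (g y))"
proof (rule bilinI)
  fix x assume "x \<in> carr U'"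
  then show "lin_map V' W (\<lambda>y. L (f x) (g y))"
    by (rule lin_map_comp[OF bilinD(2)[OF L lin_mapD(1)[OF f]] g])
next
  fix y assume "y \<in> carr V'"
  then show "lin_map U' W (\<lambda>x. L (f x) (g y))"
    by (rule lin_map_comp[OF bilinD(3)[OF L lin_mapD(1)[OF g]] f])
qed

lemma bilin_lin_comp:
  assumes T: "lin_map W X T" and L: "bilin U V W L"
  shows "bilin U V X (\<lambda>x y. T (L x y))"
  by (rule bilinI) (erule lin_map_comp[OF T bilinD(2)[OF L]], erule lin_map_comp[OF T bilinD(3)[OF L]])

lemma bilin_flip: "bilin U V W L \<Longrightarrow> bilin V U W (\<lambda>x y. L y x)"
  by (auto simp: bilin_def)

lemma sum_list_carr: "vspace W \<Longrightarrow> (\<And>x. x \<in> set l \<Longrightarrow> f x \<in> carr W) \<Longrightarrow> sum_list (map f l) \<in> carr W"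
  by (induction l) (auto intro: vspaceD)

lemma lin_map_sum_list:
  assumes "lin_map V W T" "vspace V" "\<And>x. x \<in> set l \<Longrightarrow> f x \<in> carr V"
  shows "T (sum_list (map f l)) = sum_list (map (\<lambda>x. T (f x)) l)"
  using assms(3) by (induction l) (auto simp: lin_map_0[OF assms(1,2)] lin_mapD(2)[OF assms(1)] sum_list_carr[OF assms(2)])

lemma sum_list_lin_map:
  assumes "vspace W" "vspace V" "\<And>x. x \<in> set l \<Longrightarrow> lin_map V W (\<lambda>z. f x z)"
  shows "lin_map V W (\<lambda>z. sum_list (map (\<lambda>x. f x z) l))"
  using assms(3)
proof (induction l)
  case Nil then show ?case using assms by (auto simp: lin_map_def vspaceD smul_0_right)
next
  case (Cons a l)
  have "lin_map V W (f a)" "lin_map V W (\<lambda>z. sum_list (map (\<lambda>x. f x z) l))" using Cons by auto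
  then show ?case using assms(1) by (auto simp: lin_map_def vspaceD)
qed

text \<open>The bridge from scalar axioms to vector-valued identities: a nonzero difference would be
  detected by some linear form.\<close>

lemma vspace_eqI:
  fixes W :: "('k::field, 'x::ab_group_add) hopf_alg"
  assumes W: "vspace W" and c: "s \<in> carr W" "s' \<in> carr W"
    and eq: "\<And>f. lin_map W field_space f \<Longrightarrow> f s = f s'"
  shows "s = s'"
proof (rule ccontr)
  assume "s \<noteq> s'"
  then obtain f where f: "lin_map W field_space f" "f (s - s') \<noteq> 0"
    using linear_form_separates[OF W vspace_diff[OF W c]] by (auto simp: lin_form_iff)
  have "f (s - s') = f s - f s'"
    using lin_mapD(2)[OF f(1) c(1), of "- s'"] lin_map_minus[OF f(1) W c(2)] vspaceD(3)[OF W c(2)] by simp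
  then show False using f(2) eq[OF f(1)] by simp
qed

text \<open>Takes the place of the universal property of the tensor product. Composing
  \<open>L\<close> with a linear form on \<open>W\<close> gives a bilinear form, on which the two
  lists agree by definition of \<open>teq\<close>; then \<open>vspace_eqI\<close> applies.\<close>

lemma teq_bilin:
  fixes W :: "('k::field, 'x::ab_group_add) hopf_alg"
  assumes t: "teq U V l l'" and L: "bilin U V W L" and W: "vspace W"
  shows "sum_list (map (\<lambda>(x, y). L x y) l) = sum_list (map (\<lambda>(x, y). L x y) l')" (is "?s = ?s'")
proof (rule vspace_eqI[OF W])
  have in1: "(case x of (x, y) \<Rightarrow> L x y) \<in> carr W" if "x \<in> set l" for x
    using t bilinD(1)[OF L] that by (auto simp: teq_def tens_list_def)
  have in2: "(case x of (x, y) \<Rightarrow> L x y) \<in> carr W" if "x \<in> set l'" for x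
    using t bilinD(1)[OF L] that by (auto simp: teq_def tens_list_def)
  show "?s \<in> carr W" by (rule sum_list_carr[OF W in1])
  show "?s' \<in> carr W" by (rule sum_list_carr[OF W in2])
  fix f assume f: "lin_map W field_space f"
  have "bilin_form U V (\<lambda>x y. f (L x y))"
    using bilin_lin_comp[OF f L] by (simp add: bilin_form_iff)
  then have "(\<Sum>(x, y)\<leftarrow>l. f (L x y)) = (\<Sum>(x, y)\<leftarrow>l'. f (L x y))"
    using t unfolding teq_def by blast
  moreover have "f ?s = (\<Sum>(x, y)\<leftarrow>l. f (L x y))"
    using lin_map_sum_list[OF f W in1, of l "\<lambda>x. x"] by (simp add: case_prod_beta')
  moreover have "f ?s' = (\<Sum>(x, y)\<leftarrow>l'. f (L x y))"
    using lin_map_sum_list[OF f W in2, of l' "\<lambda>x. x"] by (simp add: case_prod_beta')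
  ultimately show "f ?s = f ?s'" by simp
qed

section \<open>Cocommutative coalgebras\<close>

abbreviation sw where "sw C \<equiv> sw2 (comult C)"

text \<open>The coalgebra clauses of \<open>hopf_algebra\<close> together with
  \<open>cocomm\<close>. The bases of generalized points are tensor products, for which only this
  much structure is established.\<close>

definition ccoalg :: "('k::field, 'x::ab_group_add) hopf_alg \<Rightarrow> bool" where
  "ccoalg C \<longleftrightarrow> vspace C \<and>
     (\<forall>x\<in>carr C. tens_list C C (comult C x)) \<and>
     (\<forall>x\<in>carr C. \<forall>y\<in>carr C. teq C C (comult C (x + y)) (comult C x @ comult C y)) \<and>
     (\<forall>c. \<forall>x\<in>carr C. teq C C (comult C (smul C c x)) (map (\<lambda>(a, b). (smul C c a, b)) (comult C x))) \<and>
     (\<forall>x\<in>carr C. \<forall>f. trilin_form C f \<longrightarrow>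
        sw3 (comult C) f x =
        sum_list (map (\<lambda>(x1, u). sum_list (map (\<lambda>(x2, x3). f x1 x2 x3) (comult C u))) (comult C x))) \<and>
     lin_form C (counit C) \<and>
     (\<forall>x\<in>carr C. sw C (\<lambda>a b. smul C (counit C a) b) x = x) \<and>
     (\<forall>x\<in>carr C. sw C (\<lambda>a b. smul C (counit C b) a) x = x) \<and>
     cocomm C"

lemma hopf_ccoalg: "hopf_algebra H \<Longrightarrow> cocomm H \<Longrightarrow> ccoalg H"
  unfolding hopf_algebra_def ccoalg_def by (elim conjE, intro conjI)

lemma ccoalg_vspace [simp]: "ccoalg C \<Longrightarrow> vspace C"
  by (simp add: ccoalg_def)

lemma comult_mem: "ccoalg C \<Longrightarrow> x \<in> carr C \<Longrightarrow> (a, b) \<in> set (comult C x) \<Longrightarrow> a \<in> carr C \<and> b \<in> carr C"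
  unfolding ccoalg_def tens_list_def by blast

lemma sw2_cong:
  assumes "ccoalg C" "x \<in> carr C" "\<And>a b. a \<in> carr C \<Longrightarrow> b \<in> carr C \<Longrightarrow> F a b = G a b"
  shows "sw C F x = sw C G x"
  unfolding sw2_def using comult_mem[OF assms(1,2)] assms(3)
  by (intro arg_cong[where f = sum_list] map_cong) auto

lemma sw2_carr:
  assumes "ccoalg C" "x \<in> carr C" "vspace W" "\<And>a b. a \<in> carr C \<Longrightarrow> b \<in> carr C \<Longrightarrow> F a b \<in> carr W"
  shows "sw C F x \<in> carr W"
  unfolding sw2_def by (rule sum_list_carr[OF assms(3)]) (use comult_mem[OF assms(1,2)] assms(4) in auto)

lemma lin_sw2:
  assumes "lin_map V W T" "vspace V" "ccoalg C" "x \<in> carr C" "\<And>a b. a \<in> carr C \<Longrightarrow> b \<in> carr C \<Longrightarrow> F a b \<in> carr V"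
  shows "T (sw C F x) = sw C (\<lambda>a b. T (F a b)) x"
  unfolding sw2_def
  by (subst lin_map_sum_list[OF assms(1,2)]) (use comult_mem[OF assms(3,4)] assms(5) in \<open>auto simp: case_prod_beta'\<close>)

lemma sw2_lin_param:
  assumes "ccoalg C" "x \<in> carr C" "vspace V" "vspace W"
    "\<And>a b. a \<in> carr C \<Longrightarrow> b \<in> carr C \<Longrightarrow> lin_map V W (\<lambda>z. F z a b)"
  shows "lin_map V W (\<lambda>z. sw C (F z) x)"
  unfolding sw2_def
  by (rule sum_list_lin_map[OF assms(4,3)]) (use comult_mem[OF assms(1,2)] assms(5) in auto)

lemma smul_lin: "vspace V \<Longrightarrow> lin_map V V (smul V c)"
  by (auto simp: lin_map_def vspaceD mult.commute)

text \<open>Linearity in the element, in contrast to linearity in a parameter of the summand as in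
  \<open>sw2_lin_param\<close>. Since \<open>comult\<close> respects sums and multiples only up to
  \<open>teq\<close>, the summand must be bilinear.\<close>

lemma sw2_lin:
  assumes C: "ccoalg C" and F: "bilin C C W F" and W: "vspace W"
  shows "lin_map C W (sw C F)"
  unfolding lin_map_def
proof (intro conjI ballI allI)
  fix x y assume xy: "x \<in> carr C" "y \<in> carr C"
  show "sw C F x \<in> carr W" by (rule sw2_carr[OF C xy(1) W bilinD(1)[OF F]])
  have "teq C C (comult C (x + y)) (comult C x @ comult C y)"
    using C xy unfolding ccoalg_def by blast
  from teq_bilin[OF this F W] show "sw C F (x + y) = sw C F x + sw C F y"
    by (simp add: sw2_def)
next
  fix c x assume x: "x \<in> carr C"
  have *: "teq C C (comult C (smul C c x)) (map (\<lambda>(a, b). (smul C c a, b)) (comult C x))"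
    using C x unfolding ccoalg_def by blast
  have "sw C F (smul C c x) = sw C (\<lambda>a b. F (smul C c a) b) x"
    using teq_bilin[OF * F W] by (simp add: sw2_def case_prod_beta' o_def)
  also have "\<dots> = sw C (\<lambda>a b. smul W c (F a b)) x"
    by (rule sw2_cong[OF C x]) (rule lin_mapD(3)[OF bilinD(3)[OF F]])
  also have "\<dots> = smul W c (sw C F x)"
    by (rule lin_sw2[OF smul_lin[OF W] W C x bilinD(1)[OF F], symmetric])
  finally show "sw C F (smul C c x) = smul W c (sw C F x)" .
qed

lemma sw2_flip:
  assumes C: "ccoalg C" and F: "bilin C C W F" and W: "vspace W" and x: "x \<in> carr C"
  shows "sw C F x = sw C (\<lambda>a b. F b a) x"
proof -
  have "teq C C (comult C x) (map (\<lambda>(a, b). (b, a)) (comult C x))"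
    using C x unfolding ccoalg_def cocomm_def by blast
  from teq_bilin[OF this F W] show ?thesis by (simp add: sw2_def case_prod_beta' o_def)
qed

lemma sw2_swap:
  "sw2 D (\<lambda>a b. sw2 D' (\<lambda>p q. F a b p q) y) x = sw2 D' (\<lambda>p q. sw2 D (\<lambda>a b. F a b p q) x) y"
proof -
  have "(\<Sum>i\<leftarrow>l. \<Sum>j\<leftarrow>l'. G i j) = (\<Sum>j\<leftarrow>l'. \<Sum>i\<leftarrow>l. G i j)" for l l' and G :: "_ \<Rightarrow> _ \<Rightarrow> 'z::comm_monoid_add"
    by (induction l) (auto simp: sum_list_addf)
  from this[of "\<lambda>i j. F (fst i) (snd i) (fst j) (snd j)" "D' y" "D x"] show ?thesis
    by (simp add: sw2_def case_prod_beta')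
qed

section \<open>Trilinear maps, coassociativity and the interchange of Sweedler factors\<close>

definition trilin :: "('k::field, 'u::ab_group_add) hopf_alg \<Rightarrow> ('k, 'v::ab_group_add) hopf_alg \<Rightarrow>
    ('k, 'w::ab_group_add) hopf_alg \<Rightarrow> ('k, 'z::ab_group_add) hopf_alg \<Rightarrow> ('u \<Rightarrow> 'v \<Rightarrow> 'w \<Rightarrow> 'z) \<Rightarrow> bool" where
  "trilin U V W Z F \<longleftrightarrow>
     (\<forall>u\<in>carr U. bilin V W Z (F u)) \<and> (\<forall>w\<in>carr W. bilin U V Z (\<lambda>u v. F u v w)) \<and> (\<forall>v\<in>carr V. bilin U W Z (\<lambda>u w. F u v w))"

lemma trilinI:
  assumes "\<And>v w. v \<in> carr V \<Longrightarrow> w \<in> carr W \<Longrightarrow> lin_map U Z (\<lambda>u. F u v w)"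
    "\<And>u w. u \<in> carr U \<Longrightarrow> w \<in> carr W \<Longrightarrow> lin_map V Z (\<lambda>v. F u v w)"
    "\<And>u v. u \<in> carr U \<Longrightarrow> v \<in> carr V \<Longrightarrow> lin_map W Z (\<lambda>w. F u v w)"
  shows "trilin U V W Z F"
  using assms by (simp add: trilin_def bilin_def)

lemma trilinD:
  assumes "trilin U V W Z F"
  shows "\<And>v w. v \<in> carr V \<Longrightarrow> w \<in> carr W \<Longrightarrow> lin_map U Z (\<lambda>u. F u v w)"
    "\<And>u w. u \<in> carr U \<Longrightarrow> w \<in> carr W \<Longrightarrow> lin_map V Z (\<lambda>v. F u v w)"
    "\<And>u v. u \<in> carr U \<Longrightarrow> v \<in> carr V \<Longrightarrow> lin_map W Z (\<lambda>w. F u v w)"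
    "\<And>u v w. u \<in> carr U \<Longrightarrow> v \<in> carr V \<Longrightarrow> w \<in> carr W \<Longrightarrow> F u v w \<in> carr Z"
    "\<And>u. u \<in> carr U \<Longrightarrow> bilin V W Z (F u)"
    "\<And>w. w \<in> carr W \<Longrightarrow> bilin U V Z (\<lambda>u v. F u v w)"
    "\<And>v. v \<in> carr V \<Longrightarrow> bilin U W Z (\<lambda>u w. F u v w)"
  using assms by (auto simp: trilin_def bilin_def lin_map_def)

lemma trilin_comp:
  assumes F: "trilin U V W Z F" and f: "lin_map U' U f" and g: "lin_map V' V g" and h: "lin_map W' W h"
  shows "trilin U' V' W' Z (\<lambda>x y z. F (f x) (g y) (h z))"
  by (rule trilinI)
    (rule lin_map_comp[OF trilinD(1)[OF F] f] lin_map_comp[OF trilinD(2)[OF F] g] lin_map_comp[OF trilinD(3)[OF F] h];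
     erule lin_mapD(1)[OF f] lin_mapD(1)[OF g] lin_mapD(1)[OF h])+

lemma trilin_bilin_left:
  assumes P: "bilin X W Z P" and Q: "bilin U V X Q"
  shows "trilin U V W Z (\<lambda>u v w. P (Q u v) w)"
proof (rule trilinI)
  fix v w assume "v \<in> carr V" "w \<in> carr W"
  then show "lin_map U Z (\<lambda>u. P (Q u v) w)" by (intro lin_map_comp[OF bilinD(3)[OF P] bilinD(3)[OF Q]])
next
  fix u w assume "u \<in> carr U" "w \<in> carr W"
  then show "lin_map V Z (\<lambda>v. P (Q u v) w)" by (intro lin_map_comp[OF bilinD(3)[OF P] bilinD(2)[OF Q]])
next
  fix u v assume "u \<in> carr U" "v \<in> carr V"
  then show "lin_map W Z (\<lambda>w. P (Q u v) w)" by (intro bilinD(2)[OF P] bilinD(1)[OF Q])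
qed

lemma trilin_lin_comp:
  assumes T: "lin_map Z Z' T" and F: "trilin U V W Z F"
  shows "trilin U V W Z' (\<lambda>u v w. T (F u v w))"
  by (rule trilinI)
    (erule (1) lin_map_comp[OF T trilinD(1)[OF F]] lin_map_comp[OF T trilinD(2)[OF F]] lin_map_comp[OF T trilinD(3)[OF F]])+

lemma sw2_sw2_carr:
  assumes C: "ccoalg C" and F: "trilin C C C W F" and W: "vspace W" and x: "x \<in> carr C"
  shows "sw C (\<lambda>u z. sw C (\<lambda>x y. F x y z) u) x \<in> carr W"
    "sw C (\<lambda>x u. sw C (\<lambda>y z. F x y z) u) x \<in> carr W"
proof -
  show "sw C (\<lambda>u z. sw C (\<lambda>x y. F x y z) u) x \<in> carr W"
    by (rule sw2_carr[OF C x W], erule sw2_carr[OF C _ W], erule (2) trilinD(4)[OF F])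
  show "sw C (\<lambda>x u. sw C (\<lambda>y z. F x y z) u) x \<in> carr W"
    by (rule sw2_carr[OF C x W], erule sw2_carr[OF C _ W], erule (2) trilinD(4)[OF F])
qed

text \<open>The axiom speaks of scalar trilinear forms; composing \<open>F\<close> with all linear
  forms on \<open>W\<close> lifts it to vector values.\<close>

lemma sw2_assoc:
  assumes C: "ccoalg C" and F: "trilin C C C W F" and W: "vspace W" and x: "x \<in> carr C"
  shows "sw C (\<lambda>u z. sw C (\<lambda>x y. F x y z) u) x =
    sw C (\<lambda>x u. sw C (\<lambda>y z. F x y z) u) x" (is "?l = ?r")
proof (rule vspace_eqI[OF W sw2_sw2_carr[OF C F W x]])
  fix f assume f: "lin_map W field_space f"
  have "trilin C C C field_space (\<lambda>x y z. f (F x y z))" by (rule trilin_lin_comp[OF f F])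
  then have "trilin_form C (\<lambda>x y z. f (F x y z))"
    by (simp add: trilin_form_def lin_form_iff trilin_def bilin_def)
  then have "sw C (\<lambda>u z. sw C (\<lambda>x y. f (F x y z)) u) x =
    sw C (\<lambda>x u. sw C (\<lambda>y z. f (F x y z)) u) x"
    using C x unfolding ccoalg_def sw2_def sw3_def by blast
  moreover have "f ?l = sw C (\<lambda>u z. sw C (\<lambda>x y. f (F x y z)) u) x"
    by (subst lin_sw2[OF f W C x]; (rule sw2_cong[OF C x] sw2_carr[OF C _ W])?;
        (rule lin_sw2[OF f W C])?; (rule trilinD(4)[OF F])?; assumption?)
  moreover have "f ?r = sw C (\<lambda>x u. sw C (\<lambda>y z. f (F x y z)) u) x"
    by (subst lin_sw2[OF f W C x]; (rule sw2_cong[OF C x] sw2_carr[OF C _ W])?;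
        (rule lin_sw2[OF f W C])?; (rule trilinD(4)[OF F])?; assumption?)
  ultimately show "f ?l = f ?r" by simp
qed

text \<open>In a fourfold coproduct the two middle factors may be exchanged: coassociativity is used
  to bracket them together, cocommutativity flips them, and coassociativity restores the bracketing.
  This is the form in which cocommutativity makes products of points into points.\<close>

lemma sw2_interchange:
  assumes C: "ccoalg C" and W: "vspace W" and x: "x \<in> carr C"
    and G1: "\<And>p q. p \<in> carr C \<Longrightarrow> q \<in> carr C \<Longrightarrow> bilin C C W (G p q)"
    and G2: "\<And>r s. r \<in> carr C \<Longrightarrow> s \<in> carr C \<Longrightarrow> bilin C C W (\<lambda>p q. G p q r s)"
  shows "sw C (\<lambda>u v. sw C (\<lambda>p q. sw C (\<lambda>r s. G p q r s) v) u) x =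
    sw C (\<lambda>u v. sw C (\<lambda>p q. sw C (\<lambda>r s. G p r q s) v) u) x"
proof -
  note V = ccoalg_vspace[OF C]
  have L: "lin_map C W (\<lambda>p. G p q r s)" "lin_map C W (\<lambda>q. G p q r s)" "lin_map C W (\<lambda>r. G p q r s)"
    "lin_map C W (\<lambda>s. G p q r s)" if "p \<in> carr C" "q \<in> carr C" "r \<in> carr C" "s \<in> carr C" for p q r s
    using that bilinD(2)[OF G2] bilinD(3)[OF G2] bilinD(2)[OF G1] bilinD(3)[OF G1] by auto
  have T1: "trilin C C C W (\<lambda>p q v. sw C (G p q) v)"
    by (auto intro!: trilinI sw2_lin_param[OF C _ V W] sw2_lin[OF C _ W] G1 L)
  have T2: "trilin C C C W (\<lambda>p q v. sw C (\<lambda>r s. G p r q s) v)"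
    by (auto intro!: trilinI bilinI sw2_lin_param[OF C _ V W] sw2_lin[OF C _ W] L)
  have T3: "trilin C C C W (\<lambda>q r s. G p q r s)" "trilin C C C W (\<lambda>q r s. G p r q s)" if p: "p \<in> carr C" for p
    using L[OF p] by (auto intro!: trilinI)
  have "sw C (\<lambda>u v. sw C (\<lambda>p q. sw C (\<lambda>r s. G p q r s) v) u) x =
    sw C (\<lambda>p u. sw C (\<lambda>q v. sw C (\<lambda>r s. G p q r s) v) u) x"
    by (rule sw2_assoc[OF C T1 W x])
  also have "\<dots> = sw C (\<lambda>p u. sw C (\<lambda>q v. sw C (\<lambda>r s. G p r q s) v) u) x"
  proof (rule sw2_cong[OF C x])
    fix p u assume pu: "p \<in> carr C" "u \<in> carr C"
    have "sw C (\<lambda>q v. sw C (\<lambda>r s. G p q r s) v) u =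
      sw C (\<lambda>v s. sw C (\<lambda>q r. G p q r s) v) u"
      by (rule sw2_assoc[OF C T3(1)[OF pu(1)] W pu(2), symmetric])
    also have "\<dots> = sw C (\<lambda>v s. sw C (\<lambda>q r. G p r q s) v) u"
      by (rule sw2_cong[OF C pu(2)])
        (rule sw2_flip[OF C bilinI W]; (rule L)?; (rule pu)?; assumption?)
    also have "\<dots> = sw C (\<lambda>q v. sw C (\<lambda>r s. G p r q s) v) u"
      by (rule sw2_assoc[OF C T3(2)[OF pu(1)] W pu(2)])
    finally show "sw C (\<lambda>q v. sw C (\<lambda>r s. G p q r s) v) u =
      sw C (\<lambda>q v. sw C (\<lambda>r s. G p r q s) v) u" .
  qed
  also have "\<dots> = sw C (\<lambda>u v. sw C (\<lambda>p q. sw C (\<lambda>r s. G p r q s) v) u) x"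
    by (rule sw2_assoc[OF C T2 W x, symmetric])
  finally show ?thesis .
qed

section \<open>Convolution and generalized points\<close>

text \<open>Convolution along an arbitrary pairing \<open>L\<close> instead of a fixed
  multiplication: products of points, both actions on points and the pairing of points into a tensor
  product are all instances, and share one set of laws.\<close>

definition conv :: "('k::field, 'c::ab_group_add) hopf_alg \<Rightarrow> ('u \<Rightarrow> 'v \<Rightarrow> 'w::ab_group_add) \<Rightarrow> ('c \<Rightarrow> 'u) \<Rightarrow> ('c \<Rightarrow> 'v) \<Rightarrow> 'c \<Rightarrow> 'w" where
  "conv C L f g = (\<lambda>c. if c \<in> carr C then sw C (\<lambda>x y. L (f x) (g y)) c else 0)"

definition ext0 :: "('k::field, 'c::ab_group_add) hopf_alg \<Rightarrow> ('c \<Rightarrow> 'w::ab_group_add) \<Rightarrow> bool" where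
  "ext0 C f \<longleftrightarrow> (\<forall>c. c \<notin> carr C \<longrightarrow> f c = 0)"

definition cmap :: "('k::field, 'c::ab_group_add) hopf_alg \<Rightarrow> ('k, 'x::ab_group_add) hopf_alg \<Rightarrow> ('c \<Rightarrow> 'x) \<Rightarrow> bool" where
  "cmap C X f \<longleftrightarrow> lin_map C X f \<and>
     (\<forall>c\<in>carr C. teq X X (comult X (f c)) (map (\<lambda>(a, b). (f a, f b)) (comult C c))) \<and>
     (\<forall>c\<in>carr C. counit X (f c) = counit C c)"

text \<open>The generalized points of \<^term>\<open>X\<close> over \<^term>\<open>C\<close>; vanishing off the carrier makes them comparable by HOL equality.\<close>

definition chom :: "('k::field, 'c::ab_group_add) hopf_alg \<Rightarrow> ('k, 'x::ab_group_add) hopf_alg \<Rightarrow> ('c \<Rightarrow> 'x) \<Rightarrow> bool" where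
  "chom C X f \<longleftrightarrow> cmap C X f \<and> ext0 C f"

text \<open>States that the linear map U \<otimes> V \<rightarrow> W induced by \<open>L\<close> is
  a coalgebra map, without mentioning the tensor product; \<open>cmap_ext\<close> makes this
  precise.\<close>

definition cbilin :: "('k::field, 'u::ab_group_add) hopf_alg \<Rightarrow> ('k, 'v::ab_group_add) hopf_alg \<Rightarrow>
    ('k, 'w::ab_group_add) hopf_alg \<Rightarrow> ('u \<Rightarrow> 'v \<Rightarrow> 'w) \<Rightarrow> bool" where
  "cbilin U V W L \<longleftrightarrow> bilin U V W L \<and>
     (\<forall>u\<in>carr U. \<forall>v\<in>carr V. \<forall>w. bilin W W field_space w \<longrightarrow>
        sw W w (L u v) = sw U (\<lambda>u1 u2. sw V (\<lambda>v1 v2. w (L u1 v1) (L u2 v2)) v) u) \<and>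
     (\<forall>u\<in>carr U. \<forall>v\<in>carr V. counit W (L u v) = counit U u * counit V v)"

text \<open>The constant point at \<open>w\<close>; for the unit of a Hopf algebra it is the neutral
  element under convolution.\<close>

definition cunit :: "('k::field, 'c::ab_group_add) hopf_alg \<Rightarrow> ('k, 'w::ab_group_add) hopf_alg \<Rightarrow> 'w \<Rightarrow> 'c \<Rightarrow> 'w" where
  "cunit C W w = (\<lambda>c. if c \<in> carr C then smul W (counit C c) w else 0)"

lemma coalg_map_iff: "coalg_map X B \<longleftrightarrow> cmap X X B"
  by (simp add: coalg_map_def cmap_def)

lemma cmap_lin: "cmap C X f \<Longrightarrow> lin_map C X f"
  by (simp add: cmap_def)

lemma chom_cmap: "chom C X f \<Longrightarrow> cmap C X f"
  by (simp add: chom_def)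

lemma chom_lin: "chom C X f \<Longrightarrow> lin_map C X f"
  by (simp add: chom_def cmap_def)

lemma cbilin_bilin: "cbilin U V W L \<Longrightarrow> bilin U V W L"
  by (simp add: cbilin_def)

lemma counit_lin: "ccoalg C \<Longrightarrow> lin_map C field_space (counit C)"
  by (simp add: ccoalg_def lin_form_iff)

lemma counit_left: "ccoalg C \<Longrightarrow> x \<in> carr C \<Longrightarrow> sw C (\<lambda>a b. smul C (counit C a) b) x = x"
  and counit_right: "ccoalg C \<Longrightarrow> x \<in> carr C \<Longrightarrow> sw C (\<lambda>a b. smul C (counit C b) a) x = x"
  by (simp_all add: ccoalg_def)

lemma cmap_sw2:
  assumes f: "cmap C X f" and L: "bilin X X W L" and W: "vspace W" and c: "c \<in> carr C"
  shows "sw X L (f c) = sw C (\<lambda>x y. L (f x) (f y)) c"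
proof -
  have "teq X X (comult X (f c)) (map (\<lambda>(a, b). (f a, f b)) (comult C c))"
    using f c by (simp add: cmap_def)
  from teq_bilin[OF this L W] show ?thesis by (simp add: sw2_def case_prod_beta' o_def)
qed

lemma cmapI:
  assumes C: "ccoalg C" and X: "ccoalg X" and f: "lin_map C X f"
    and "\<And>w c. bilin X X field_space w \<Longrightarrow> c \<in> carr C \<Longrightarrow>
      sw X w (f c) = sw C (\<lambda>x y. w (f x) (f y)) c"
    and "\<And>c. c \<in> carr C \<Longrightarrow> counit X (f c) = counit C c"
  shows "cmap C X f"
  unfolding cmap_def teq_def
proof (intro conjI ballI allI impI)
  fix c assume c: "c \<in> carr C"
  show "tens_list X X (comult X (f c))"
    using X lin_mapD(1)[OF f c] unfolding ccoalg_def by blast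
  show "tens_list X X (map (\<lambda>(a, b). (f a, f b)) (comult C c))"
    using comult_mem[OF C c] lin_mapD(1)[OF f] by (auto simp: tens_list_def)
  fix w assume "bilin_form X X w"
  then show "(\<Sum>(x, y)\<leftarrow>comult X (f c). w x y) = (\<Sum>(x, y)\<leftarrow>map (\<lambda>(a, b). (f a, f b)) (comult C c). w x y)"
    using assms(4)[of w c] c by (simp add: bilin_form_iff sw2_def case_prod_beta' o_def)
qed (use assms in auto)

lemma cmap_comp:
  assumes C: "ccoalg C" and X: "ccoalg X" and Y: "ccoalg Y" and f: "cmap C X f" and g: "cmap X Y g"
  shows "cmap C Y (\<lambda>c. g (f c))"
proof (rule cmapI[OF C Y lin_map_comp[OF cmap_lin[OF g] cmap_lin[OF f]]])
  fix w c assume w: "bilin Y Y field_space w" and c: "c \<in> carr C"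
  have "sw Y w (g (f c)) = sw X (\<lambda>x y. w (g x) (g y)) (f c)"
    by (rule cmap_sw2[OF g w vspace_field_space lin_mapD(1)[OF cmap_lin[OF f] c]])
  also have "\<dots> = sw C (\<lambda>x y. w (g (f x)) (g (f y))) c"
    by (rule cmap_sw2[OF f bilin_comp[OF w cmap_lin[OF g] cmap_lin[OF g]] vspace_field_space c])
  finally show "sw Y w (g (f c)) = sw C (\<lambda>x y. w (g (f x)) (g (f y))) c" .
next
  fix c assume "c \<in> carr C"
  then show "counit Y (g (f c)) = counit C c"
    using f g lin_mapD(1)[OF cmap_lin[OF f]] by (simp add: cmap_def)
qed

lemma cmap_cong:
  assumes C: "ccoalg C" and f: "cmap C X f" and eq: "\<And>x. x \<in> carr C \<Longrightarrow> g x = f x"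
  shows "cmap C X g"
  unfolding cmap_def
proof (intro conjI ballI)
  show "lin_map C X g" by (rule lin_map_cong[OF cmap_lin[OF f] ccoalg_vspace[OF C] eq])
  fix c assume c: "c \<in> carr C"
  have m: "map (\<lambda>(a, b). (g a, g b)) (comult C c) = map (\<lambda>(a, b). (f a, f b)) (comult C c)"
    using comult_mem[OF C c] eq by (intro map_cong) auto
  show "teq X X (comult X (g c)) (map (\<lambda>(a, b). (g a, g b)) (comult C c))"
    unfolding m eq[OF c] using f c by (simp add: cmap_def)
  show "counit X (g c) = counit C c"
    using f c by (simp add: cmap_def eq)
qed

lemma cmap_id: "ccoalg X \<Longrightarrow> cmap X X (\<lambda>x. x)"
  by (rule cmapI[OF _ _ lin_map_id]) simp_all

text \<open>The tautological point of \<open>X\<close>, from which every other point arises by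
  composition.\<close>

lemma chom_id: "ccoalg X \<Longrightarrow> chom X X (\<lambda>x. if x \<in> carr X then x else 0)"
  unfolding chom_def by (auto intro: cmap_cong[OF _ cmap_id] simp: ext0_def)

lemma ext0_comp: "ext0 C f \<Longrightarrow> lin_map X Y g \<Longrightarrow> vspace X \<Longrightarrow> ext0 C (\<lambda>c. g (f c))"
  by (simp add: ext0_def lin_map_0)

lemma chom_comp: "ccoalg C \<Longrightarrow> ccoalg X \<Longrightarrow> ccoalg Y \<Longrightarrow> chom C X f \<Longrightarrow> cmap X Y g \<Longrightarrow> chom C Y (\<lambda>c. g (f c))"
  unfolding chom_def using cmap_comp ext0_comp[OF _ cmap_lin ccoalg_vspace] by blast

lemma ext0_conv [simp]: "ext0 C (conv C L f g)"
  by (simp add: ext0_def conv_def)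

lemma conv_apply: "c \<in> carr C \<Longrightarrow> conv C L f g c = sw C (\<lambda>x y. L (f x) (g y)) c"
  by (simp add: conv_def)

lemma ext0_eqI: "ext0 C f \<Longrightarrow> ext0 C g \<Longrightarrow> (\<And>c. c \<in> carr C \<Longrightarrow> f c = g c) \<Longrightarrow> f = g"
  unfolding ext0_def by (metis ext)

lemma conv_cong:
  assumes "ccoalg C" "\<And>x. x \<in> carr C \<Longrightarrow> f x = f' x" "\<And>x. x \<in> carr C \<Longrightarrow> g x = g' x"
    "\<And>x y. x \<in> carr C \<Longrightarrow> y \<in> carr C \<Longrightarrow> L (f' x) (g' y) = L' (f' x) (g' y)"
  shows "conv C L f g = conv C L' f' g'"
  by (rule ext0_eqI[OF ext0_conv ext0_conv]) (auto simp: conv_apply assms intro!: sw2_cong[OF assms(1)])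

lemma conv_lin:
  assumes "ccoalg C" "bilin U V W L" "vspace W" "lin_map C U f" "lin_map C V g"
  shows "lin_map C W (conv C L f g)"
  by (rule lin_map_cong[OF sw2_lin[OF assms(1) bilin_comp[OF assms(2,4,5)] assms(3)]])
    (simp_all add: assms(1) conv_apply)

lemma conv_comp_lin:
  assumes C: "ccoalg C" and L: "bilin U V W L" and W: "vspace W" and f: "lin_map C U f" and g: "lin_map C V g"
    and T: "lin_map W X T"
  shows "(\<lambda>c. T (conv C L f g c)) = conv C (\<lambda>u v. T (L u v)) f g"
proof (rule ext0_eqI)
  show "ext0 C (\<lambda>c. T (conv C L f g c))" by (rule ext0_comp[OF ext0_conv T W])
  fix c assume c: "c \<in> carr C"
  show "T (conv C L f g c) = conv C (\<lambda>u v. T (L u v)) f g c"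
    unfolding conv_apply[OF c]
    by (rule lin_sw2[OF T W C c]) (rule bilinD(1)[OF L lin_mapD(1)[OF f] lin_mapD(1)[OF g]])
qed simp

text \<open>Change of base along a point \<open>F\<close>: a coalgebra map commutes with forming
  convolutions. An identity proved at the tautological or universal point is thereby carried to all
  points.\<close>

lemma conv_chom:
  assumes C: "ccoalg C" and X: "ccoalg X" and L: "bilin U V W L" and W: "vspace W"
    and u: "lin_map X U u" and v: "lin_map X V v" and F: "chom C X F"
  shows "(\<lambda>c. conv X L u v (F c)) = conv C L (\<lambda>c. u (F c)) (\<lambda>c. v (F c))"
proof (rule ext0_eqI)
  show "ext0 C (\<lambda>c. conv X L u v (F c))"
    by (rule ext0_comp[OF _ conv_lin[OF X L W u v] ccoalg_vspace[OF X]]) (use F in \<open>simp add: chom_def\<close>)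
  fix c assume c: "c \<in> carr C"
  show "conv X L u v (F c) = conv C L (\<lambda>c. u (F c)) (\<lambda>c. v (F c)) c"
    unfolding conv_apply[OF c] conv_apply[OF lin_mapD(1)[OF chom_lin[OF F] c]]
    by (rule cmap_sw2[OF chom_cmap[OF F] bilin_comp[OF L u v] W c])
qed simp

text \<open>By cocommutativity of \<open>C\<close> the order in which the points are listed is
  immaterial as long as each keeps its slot in \<open>L\<close>. This brings arguments into the
  order demanded by the other laws.\<close>

lemma conv_flip:
  assumes C: "ccoalg C" and L: "bilin U V W L" and W: "vspace W" and f: "lin_map C U f" and g: "lin_map C V g"
  shows "conv C L f g = conv C (\<lambda>v u. L u v) g f"
  by (rule ext0_eqI[OF ext0_conv ext0_conv]) (simp add: conv_apply, rule sw2_flip[OF C bilin_comp[OF L f g] W])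

text \<open>Four separate pairings are allowed, so that one statement covers associativity of a
  product, both module laws and the compatibility of the left with the right action.\<close>

lemma conv_assoc:
  assumes C: "ccoalg C" and W: "vspace W"
    and P: "bilin X Y W P" and Q: "bilin U V X Q" and P': "bilin U X' W P'" and Q': "bilin V Y X' Q'"
    and X: "vspace X" "vspace X'"
    and f: "lin_map C U f" and g: "lin_map C V g" and h: "lin_map C Y h"
    and eq: "\<And>u v y. u \<in> carr U \<Longrightarrow> v \<in> carr V \<Longrightarrow> y \<in> carr Y \<Longrightarrow> P (Q u v) y = P' u (Q' v y)"
  shows "conv C P (conv C Q f g) h = conv C P' f (conv C Q' g h)"
proof (rule ext0_eqI[OF ext0_conv ext0_conv])
  fix c assume c: "c \<in> carr C"
  note m = lin_mapD(1)[OF f] lin_mapD(1)[OF g] lin_mapD(1)[OF h]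
  note T = trilin_comp[OF trilin_bilin_left[OF P Q] f g h]
  have "conv C P (conv C Q f g) h c = sw C (\<lambda>u z. sw C (\<lambda>x y. P (Q (f x) (g y)) (h z)) u) c"
    unfolding conv_apply[OF c]
    by (rule sw2_cong[OF C c]) (simp add: conv_apply, rule lin_sw2[OF bilinD(3)[OF P m(3)] X(1) C _ bilinD(1)[OF Q m(1) m(2)]])
  also have "\<dots> = sw C (\<lambda>x u. sw C (\<lambda>y z. P (Q (f x) (g y)) (h z)) u) c"
    by (rule sw2_assoc[OF C T W c])
  also have "\<dots> = sw C (\<lambda>x u. sw C (\<lambda>y z. P' (f x) (Q' (g y) (h z))) u) c"
    by (intro sw2_cong[OF C] c eq m)
  also have "\<dots> = conv C P' f (conv C Q' g h) c"
    unfolding conv_apply[OF c]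
    by (rule sw2_cong[OF C c], simp add: conv_apply, rule lin_sw2[OF bilinD(2)[OF P' m(1)] X(2) C _ bilinD(1)[OF Q' m(2) m(3)], symmetric])
  finally show "conv C P (conv C Q f g) h c = conv C P' f (conv C Q' g h) c" .
qed

lemma conv_conv_apply:
  assumes C: "ccoalg C"
    and P: "bilin X Y W P" and Q: "bilin U1 V1 X Q" and R: "bilin U2 V2 Y R" and X: "vspace X" "vspace Y"
    and f: "lin_map C U1 f" and g: "lin_map C V1 g" and f': "lin_map C U2 f'" and g': "lin_map C V2 g'"
    and c: "c \<in> carr C"
  shows "conv C P (conv C Q f g) (conv C R f' g') c =
    sw C (\<lambda>u v. sw C (\<lambda>p q. sw C (\<lambda>r s. P (Q (f p) (g q)) (R (f' r) (g' s))) v) u) c"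
  unfolding conv_apply[OF c]
proof (rule sw2_cong[OF C c])
  note m = lin_mapD(1)[OF f] lin_mapD(1)[OF g] lin_mapD(1)[OF f'] lin_mapD(1)[OF g']
  fix u v assume uv: "u \<in> carr C" "v \<in> carr C"
  have v': "conv C R f' g' v \<in> carr Y" by (rule lin_mapD(1)[OF conv_lin[OF C R X(2) f' g'] uv(2)])
  have "P (conv C Q f g u) (conv C R f' g' v) = sw C (\<lambda>p q. P (Q (f p) (g q)) (conv C R f' g' v)) u"
    unfolding conv_apply[OF uv(1)]
    by (rule lin_sw2[OF bilinD(3)[OF P v'] X(1) C uv(1) bilinD(1)[OF Q m(1) m(2)]])
  also have "\<dots> = sw C (\<lambda>p q. sw C (\<lambda>r s. P (Q (f p) (g q)) (R (f' r) (g' s))) v) u"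
    unfolding conv_apply[OF uv(2)]
    by (rule sw2_cong[OF C uv(1)]) (rule lin_sw2[OF bilinD(2)[OF P bilinD(1)[OF Q m(1) m(2)]] X(2) C uv(2) bilinD(1)[OF R m(3) m(4)]])
  finally show "P (conv C Q f g u) (conv C R f' g' v) =
    sw C (\<lambda>p q. sw C (\<lambda>r s. P (Q (f p) (g q)) (R (f' r) (g' s))) v) u" .
qed

lemma sw2_interchange_bilin:
  assumes C: "ccoalg C" and W: "vspace W"
    and P: "bilin X Y W P" and Q: "bilin U1 V1 X Q" and R: "bilin U2 V2 Y R"
    and f: "lin_map C U1 f" and g: "lin_map C V1 g" and f': "lin_map C U2 f'" and g': "lin_map C V2 g'"
    and c: "c \<in> carr C"
  shows "sw C (\<lambda>u v. sw C (\<lambda>p q. sw C (\<lambda>r s. P (Q (f p) (g q)) (R (f' r) (g' s))) v) u) c =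
    sw C (\<lambda>u v. sw C (\<lambda>p q. sw C (\<lambda>r s. P (Q (f p) (g r)) (R (f' q) (g' s))) v) u) c"
proof (rule sw2_interchange[OF C W c, of "\<lambda>p q r s. P (Q (f p) (g q)) (R (f' r) (g' s))"])
  note m = lin_mapD(1)[OF f] lin_mapD(1)[OF g] lin_mapD(1)[OF f'] lin_mapD(1)[OF g']
  fix p q assume pq: "p \<in> carr C" "q \<in> carr C"
  show "bilin C C W (\<lambda>r s. P (Q (f p) (g q)) (R (f' r) (g' s)))"
    by (rule bilin_comp[OF bilin_lin_comp[OF bilinD(2)[OF P bilinD(1)[OF Q m(1)[OF pq(1)] m(2)[OF pq(2)]]] R] f' g'])
  show "bilin C C W (\<lambda>r s. P (Q (f r) (g s)) (R (f' p) (g' q)))"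
    by (rule bilin_comp[OF bilin_lin_comp[OF bilinD(3)[OF P bilinD(1)[OF R m(3)[OF pq(1)] m(4)[OF pq(2)]]] Q] f g])
qed

text \<open>The convolution form of \<open>sw2_interchange\<close>: points are regrouped from (f,
  g), (f', g') to (f, f'), (g, g') whenever the pairings admit the same regrouping on
  elements.\<close>

lemma conv_interchange:
  assumes C: "ccoalg C" and W: "vspace W"
    and P: "bilin X Y W P" and Q: "bilin U1 V1 X Q" and R: "bilin U2 V2 Y R"
    and P': "bilin X' Y' W P'" and Q': "bilin U1 U2 X' Q'" and R': "bilin V1 V2 Y' R'"
    and X: "vspace X" "vspace Y" "vspace X'" "vspace Y'"
    and f: "lin_map C U1 f" and g: "lin_map C V1 g" and f': "lin_map C U2 f'" and g': "lin_map C V2 g'"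
    and eq: "\<And>u v u' v'. u \<in> carr U1 \<Longrightarrow> v \<in> carr V1 \<Longrightarrow> u' \<in> carr U2 \<Longrightarrow> v' \<in> carr V2 \<Longrightarrow>
      P (Q u v) (R u' v') = P' (Q' u u') (R' v v')"
  shows "conv C P (conv C Q f g) (conv C R f' g') = conv C P' (conv C Q' f f') (conv C R' g g')"
proof (rule ext0_eqI[OF ext0_conv ext0_conv])
  fix c assume c: "c \<in> carr C"
  note m = lin_mapD(1)[OF f] lin_mapD(1)[OF g] lin_mapD(1)[OF f'] lin_mapD(1)[OF g']
  show "conv C P (conv C Q f g) (conv C R f' g') c = conv C P' (conv C Q' f f') (conv C R' g g') c"
    unfolding conv_conv_apply[OF C P Q R X(1,2) f g f' g' c] conv_conv_apply[OF C P' Q' R' X(3,4) f f' g g' c]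
      sw2_interchange_bilin[OF C W P Q R f g f' g' c]
    by (intro sw2_cong[OF C] c eq m)
qed

text \<open>Both arguments of \<open>T\<close> are split by coproducts in \<open>U\<close> and
  \<open>V\<close>. As \<open>f\<close> and \<open>g\<close> are coalgebra maps, these become
  coproducts in \<open>C\<close>, and the interchange collects the first and the second
  halves.\<close>

lemma conv_distrib:
  assumes C: "ccoalg C" and U: "ccoalg U" and V: "ccoalg V" and W: "vspace W"
    and P: "bilin X Y W P" and Q: "bilin U V X Q" and R: "bilin U V Y R" and X: "vspace X" "vspace Y"
    and f: "cmap C U f" and g: "cmap C V g"
    and eq: "\<And>u v. u \<in> carr U \<Longrightarrow> v \<in> carr V \<Longrightarrow>
      T u v = sw U (\<lambda>u1 u2. sw V (\<lambda>v1 v2. P (Q u1 v1) (R u2 v2)) v) u"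
  shows "conv C T f g = conv C P (conv C Q f g) (conv C R f g)"
proof (rule ext0_eqI[OF ext0_conv ext0_conv])
  fix c assume c: "c \<in> carr C"
  note fl = cmap_lin[OF f] and gl = cmap_lin[OF g]
  note m = lin_mapD(1)[OF fl] lin_mapD(1)[OF gl]
  have inner: "T (f x) (g y) = sw C (\<lambda>p q. sw C (\<lambda>r s. P (Q (f p) (g r)) (R (f q) (g s))) y) x"
    if x: "x \<in> carr C" and y: "y \<in> carr C" for x y
  proof -
    have PQ: "lin_map V W (\<lambda>v1. P (Q u1 v1) (R u2 v2))" "lin_map V W (\<lambda>v2. P (Q u1 v1) (R u2 v2))"
      "lin_map U W (\<lambda>u1. P (Q u1 v1) (R u2 v2))" "lin_map U W (\<lambda>u2. P (Q u1 v1) (R u2 v2))"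
      if "u1 \<in> carr U" "u2 \<in> carr U" "v1 \<in> carr V" "v2 \<in> carr V" for u1 u2 v1 v2
      using that by (auto intro!: lin_map_comp[OF bilinD(3)[OF P]] lin_map_comp[OF bilinD(2)[OF P]]
        bilinD[OF Q] bilinD[OF R])
    have b1: "bilin U U W (\<lambda>u1 u2. sw V (\<lambda>v1 v2. P (Q u1 v1) (R u2 v2)) v)" if "v \<in> carr V" for v
      using that U by (auto intro!: bilinI sw2_lin_param[OF V] W PQ)
    have b2: "bilin V V W (\<lambda>v1 v2. P (Q u1 v1) (R u2 v2))" if "u1 \<in> carr U" "u2 \<in> carr U" for u1 u2
      using that by (auto intro!: bilinI PQ)
    have "T (f x) (g y) = sw U (\<lambda>u1 u2. sw V (\<lambda>v1 v2. P (Q u1 v1) (R u2 v2)) (g y)) (f x)"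
      by (rule eq[OF m(1)[OF x] m(2)[OF y]])
    also have "\<dots> = sw C (\<lambda>p q. sw V (\<lambda>v1 v2. P (Q (f p) v1) (R (f q) v2)) (g y)) x"
      by (rule cmap_sw2[OF f b1[OF m(2)[OF y]] W x])
    also have "\<dots> = sw C (\<lambda>p q. sw C (\<lambda>r s. P (Q (f p) (g r)) (R (f q) (g s))) y) x"
      by (rule sw2_cong[OF C x]) (rule cmap_sw2[OF g b2[OF m(1) m(1)] W y])
    finally show ?thesis .
  qed
  have "conv C T f g c = sw C (\<lambda>x y. sw C (\<lambda>p q. sw C (\<lambda>r s. P (Q (f p) (g r)) (R (f q) (g s))) y) x) c"
    unfolding conv_apply[OF c] by (intro sw2_cong[OF C] c inner)
  then show "conv C T f g c = conv C P (conv C Q f g) (conv C R f g) c"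
    unfolding conv_conv_apply[OF C P Q R X fl gl fl gl c] sw2_interchange_bilin[OF C W P Q R fl gl fl gl c] .
qed

text \<open>Only the acting point \<open>h\<close> is split by a coproduct of its target, so only
  \<open>h\<close> has to be a coalgebra map; \<open>f\<close> and \<open>g\<close> are distributed
  by the coproduct of \<open>C\<close> itself. With an action for \<open>T\<close> this is the
  module algebra law at points.\<close>

lemma conv_distrib_left:
  assumes C: "ccoalg C" and H: "ccoalg H" and W: "vspace W" and A: "vspace A"
    and T: "bilin H A W T" and M: "bilin U V A M"
    and P: "bilin X Y W P" and Q: "bilin H U X Q" and R: "bilin H V Y R" and X: "vspace X" "vspace Y"
    and h: "cmap C H h" and f: "lin_map C U f" and g: "lin_map C V g"
    and eq: "\<And>h u v. h \<in> carr H \<Longrightarrow> u \<in> carr U \<Longrightarrow> v \<in> carr V \<Longrightarrow>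
      T h (M u v) = sw H (\<lambda>h1 h2. P (Q h1 u) (R h2 v)) h"
  shows "conv C T h (conv C M f g) = conv C P (conv C Q h f) (conv C R h g)"
proof (rule ext0_eqI[OF ext0_conv ext0_conv])
  fix c assume c: "c \<in> carr C"
  note hl = cmap_lin[OF h]
  note m = lin_mapD(1)[OF f] lin_mapD(1)[OF g] lin_mapD(1)[OF hl]
  have b: "bilin H H W (\<lambda>h1 h2. P (Q h1 u) (R h2 v))" if "u \<in> carr U" "v \<in> carr V" for u v
    by (rule bilin_comp[OF P bilinD(3)[OF Q that(1)] bilinD(3)[OF R that(2)]])
  have inner: "T (h x) (conv C M f g y) = sw C (\<lambda>p q. sw C (\<lambda>r s. P (Q (h p) (f r)) (R (h q) (g s))) y) x"
    if x: "x \<in> carr C" and y: "y \<in> carr C" for x y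
  proof -
    have "T (h x) (conv C M f g y) = sw C (\<lambda>r s. T (h x) (M (f r) (g s))) y"
      unfolding conv_apply[OF y]
      by (rule lin_sw2[OF bilinD(2)[OF T m(3)[OF x]] A C y bilinD(1)[OF M m(1) m(2)]])
    also have "\<dots> = sw C (\<lambda>r s. sw C (\<lambda>p q. P (Q (h p) (f r)) (R (h q) (g s))) x) y"
    proof (rule sw2_cong[OF C y])
      fix r s assume rs: "r \<in> carr C" "s \<in> carr C"
      show "T (h x) (M (f r) (g s)) = sw C (\<lambda>p q. P (Q (h p) (f r)) (R (h q) (g s))) x"
        unfolding eq[OF m(3)[OF x] m(1)[OF rs(1)] m(2)[OF rs(2)]]
        by (rule cmap_sw2[OF h b[OF m(1)[OF rs(1)] m(2)[OF rs(2)]] W x])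
    qed
    also have "\<dots> = sw C (\<lambda>p q. sw C (\<lambda>r s. P (Q (h p) (f r)) (R (h q) (g s))) y) x"
      by (rule sw2_swap)
    finally show ?thesis .
  qed
  have "conv C T h (conv C M f g) c = sw C (\<lambda>x y. sw C (\<lambda>p q. sw C (\<lambda>r s. P (Q (h p) (f r)) (R (h q) (g s))) y) x) c"
    unfolding conv_apply[OF c] by (intro sw2_cong[OF C] c inner)
  then show "conv C T h (conv C M f g) c = conv C P (conv C Q h f) (conv C R h g) c"
    unfolding conv_conv_apply[OF C P Q R X hl f hl g c] sw2_interchange_bilin[OF C W P Q R hl f hl g c] .
qed

lemma conv_counit_sum:
  assumes C: "ccoalg C" and c: "c \<in> carr C"
  shows "sw C (\<lambda>x y. counit C x * counit C y) c = counit C c"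
proof -
  have s: "smul C (counit C x) y \<in> carr C" if "y \<in> carr C" for x y
    using C that by (simp add: vspaceD)
  have "counit C c = counit C (sw C (\<lambda>a b. smul C (counit C a) b) c)"
    by (simp add: counit_left[OF C c])
  also have "\<dots> = sw C (\<lambda>a b. counit C (smul C (counit C a) b)) c"
    by (rule lin_sw2[OF counit_lin[OF C] ccoalg_vspace[OF C] C c s])
  also have "\<dots> = sw C (\<lambda>x y. counit C x * counit C y) c"
    by (rule sw2_cong[OF C c]) (simp add: lin_mapD(3)[OF counit_lin[OF C]])
  finally show ?thesis by simp
qed

lemma cbilin_flip: "cbilin U V W L \<Longrightarrow> cbilin V U W (\<lambda>v u. L u v)"
  unfolding cbilin_def
proof (elim conjE, intro conjI ballI allI impI)
  fix v u w assume "v \<in> carr V" "u \<in> carr U" "bilin W W field_space w"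
    and "\<forall>u\<in>carr U. \<forall>v\<in>carr V. \<forall>w. bilin W W field_space w \<longrightarrow>
      sw W w (L u v) = sw U (\<lambda>u1 u2. sw V (\<lambda>v1 v2. w (L u1 v1) (L u2 v2)) v) u"
  then have "sw W w (L u v) = sw U (\<lambda>u1 u2. sw V (\<lambda>v1 v2. w (L u1 v1) (L u2 v2)) v) u"
    by blast
  then show "sw W w (L u v) = sw V (\<lambda>v1 v2. sw U (\<lambda>u1 u2. w (L u1 v1) (L u2 v2)) u) v"
    by (rule trans) (rule sw2_swap)
qed (auto intro: bilin_flip simp: mult.commute)

lemma sw2_mult_right: "sw2 D (\<lambda>x y. f x y * k) c = sw2 D f c * (k :: 'z :: semiring_0)"
  by (simp add: sw2_def sum_list_mult_const case_prod_beta')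

text \<open>The map a \<otimes> h \<mapsto> \<epsilon>(h) a, that is, the first projection of a
  tensor product of coalgebras.\<close>

lemma smul_counit_bilin:
  assumes "vspace X" "ccoalg Y"
  shows "bilin X Y X (\<lambda>a h. smul X (counit Y h) a)"
  using counit_lin[OF assms(2)] assms(1) by (auto simp: bilin_def lin_map_def vspaceD mult.commute)

lemma smul_counit_cbilin:
  assumes X: "ccoalg X" and Y: "ccoalg Y"
  shows "cbilin X Y X (\<lambda>a h. smul X (counit Y h) a)"
  unfolding cbilin_def
proof (intro conjI ballI allI impI smul_counit_bilin ccoalg_vspace[OF X] Y)
  fix a h assume a: "a \<in> carr X" and h: "h \<in> carr Y"
  show "counit X (smul X (counit Y h) a) = counit X a * counit Y h"
    using lin_mapD(3)[OF counit_lin[OF X] a] by simp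
  fix w assume w: "bilin X X field_space w"
  have sm: "w (smul X c p) (smul X d q) = c * d * w p q" if "p \<in> carr X" "q \<in> carr X" for c d p q
    using lin_mapD(3)[OF bilinD(3)[OF w vspaceD(4)[OF ccoalg_vspace[OF X] that(2)]] that(1)]
      lin_mapD(3)[OF bilinD(2)[OF w that(1)] that(2)] by simp
  have "sw X (\<lambda>a1 a2. sw Y (\<lambda>h1 h2. w (smul X (counit Y h1) a1) (smul X (counit Y h2) a2)) h) a =
    sw X (\<lambda>a1 a2. sw Y (\<lambda>h1 h2. counit Y h1 * counit Y h2 * w a1 a2) h) a"
    by (intro sw2_cong[OF X] sw2_cong[OF Y] a h) (simp add: sm)
  also have "\<dots> = sw X w a * counit Y h"
    by (simp only: sw2_mult_right conv_counit_sum[OF Y h] mult.commute[of "counit Y h"])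
  finally show "sw X w (smul X (counit Y h) a) =
    sw X (\<lambda>a1 a2. sw Y (\<lambda>h1 h2. w (smul X (counit Y h1) a1) (smul X (counit Y h2) a2)) h) a"
    using lin_mapD(3)[OF sw2_lin[OF X w vspace_field_space] a] by simp
qed

text \<open>Points are closed under every pairing compatible with the coalgebra structures. The
  comultiplication is handled by \<open>conv_distrib\<close> with the test form \<open>w\<close> as
  outer pairing, so cocommutativity of \<open>C\<close> enters through the interchange.\<close>

lemma chom_conv:
  assumes C: "ccoalg C" and U: "ccoalg U" and V: "ccoalg V" and W: "ccoalg W"
    and L: "cbilin U V W L" and f: "cmap C U f" and g: "cmap C V g"
  shows "chom C W (conv C L f g)"
  unfolding chom_def
proof (intro conjI ext0_conv cmapI[OF C W])
  note fl = cmap_lin[OF f] and gl = cmap_lin[OF g] and Lb = cbilin_bilin[OF L] and Wv = ccoalg_vspace[OF W]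
  show lin: "lin_map C W (conv C L f g)" by (rule conv_lin[OF C Lb Wv fl gl])
  fix c assume c: "c \<in> carr C"
  {
    fix w assume w: "bilin W W field_space w"
    have "sw W w (conv C L f g c) = conv C (\<lambda>u v. sw W w (L u v)) f g c"
      using conv_comp_lin[OF C Lb Wv fl gl sw2_lin[OF W w vspace_field_space]] by (rule fun_cong)
    also have "conv C (\<lambda>u v. sw W w (L u v)) f g = conv C w (conv C L f g) (conv C L f g)"
      by (rule conv_distrib[OF C U V vspace_field_space w Lb Lb Wv Wv f g]) (use L w in \<open>simp add: cbilin_def\<close>)
    finally show "sw W w (conv C L f g c) = sw C (\<lambda>x y. w (conv C L f g x) (conv C L f g y)) c"
      by (simp add: conv_apply[OF c, of w])
  }
  have "counit W (conv C L f g c) = conv C (\<lambda>u v. counit W (L u v)) f g c"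
    using conv_comp_lin[OF C Lb Wv fl gl counit_lin[OF W]] by (rule fun_cong)
  also have "\<dots> = sw C (\<lambda>x y. counit C x * counit C y) c"
    unfolding conv_apply[OF c]
    by (rule sw2_cong[OF C c]) (use L f g lin_mapD(1)[OF fl] lin_mapD(1)[OF gl] in \<open>simp add: cbilin_def cmap_def\<close>)
  finally show "counit W (conv C L f g c) = counit C c" by (simp add: conv_counit_sum[OF C c])
qed

lemma smul_lin_left: "vspace V \<Longrightarrow> w \<in> carr V \<Longrightarrow> lin_map field_space V (\<lambda>k. smul V k w)"
  by (auto simp: lin_map_def vspaceD)

lemma cunit_lin:
  assumes C: "ccoalg C" and X: "vspace X" and w: "w \<in> carr X"
  shows "lin_map C X (cunit C X w)"
  by (rule lin_map_cong[OF lin_map_comp[OF smul_lin_left[OF X w] counit_lin[OF C]]])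
    (simp_all add: C cunit_def)

lemma ext0_cunit [simp]: "ext0 C (cunit C X w)"
  by (simp add: ext0_def cunit_def)

lemma conv_cunit_left:
  assumes C: "ccoalg C" and L: "bilin U V W L" and V: "vspace U" "vspace V" "vspace W" and u: "u \<in> carr U"
    and g: "lin_map C V g" "ext0 C g"
  shows "conv C L (cunit C U u) g = (\<lambda>c. L u (g c))"
proof (rule ext0_eqI[OF ext0_conv])
  show "ext0 C (\<lambda>c. L u (g c))" by (rule ext0_comp[OF g(2) bilinD(2)[OF L u] V(2)])
  fix c assume c: "c \<in> carr C"
  have s: "smul C (counit C x) y \<in> carr C" if "y \<in> carr C" for x y
    using C that by (simp add: vspaceD)
  note Lg = lin_map_comp[OF bilinD(2)[OF L u] g(1)]
  have "conv C L (cunit C U u) g c = sw C (\<lambda>x y. L u (g (smul C (counit C x) y))) c"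
    unfolding conv_apply[OF c]
  proof (rule sw2_cong[OF C c])
    fix x y assume xy: "x \<in> carr C" "y \<in> carr C"
    have "L (smul U (counit C x) u) (g y) = smul W (counit C x) (L u (g y))"
      by (rule lin_mapD(3)[OF bilinD(3)[OF L lin_mapD(1)[OF g(1) xy(2)]] u])
    then show "L (cunit C U u x) (g y) = L u (g (smul C (counit C x) y))"
      using xy by (simp add: cunit_def lin_mapD(3)[OF Lg])
  qed
  also have "\<dots> = L u (g c)"
    by (subst lin_sw2[OF Lg ccoalg_vspace[OF C] C c s, symmetric]) (simp_all add: counit_left[OF C c])
  finally show "conv C L (cunit C U u) g c = L u (g c)" .
qed

lemma conv_cunit_right:
  assumes C: "ccoalg C" and L: "bilin U V W L" and V: "vspace U" "vspace V" "vspace W" and v: "v \<in> carr V"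
    and f: "lin_map C U f" "ext0 C f"
  shows "conv C L f (cunit C V v) = (\<lambda>c. L (f c) v)"
  unfolding conv_flip[OF C L V(3) f(1) cunit_lin[OF C V(2) v]]
  by (rule conv_cunit_left[OF C bilin_flip[OF L] V(2,1,3) v f])

lemma comp_cunit:
  assumes "lin_map X Y T" "vspace X" "w \<in> carr X"
  shows "(\<lambda>c. T (cunit C X w c)) = cunit C Y (T w)"
  using lin_mapD(3)[OF assms(1,3)] lin_map_0[OF assms(1,2)] by (auto simp: cunit_def)

text \<open>The constant map is a point exactly because \<open>w\<close> is group-like of counit
  1.\<close>

lemma chom_cunit:
  assumes C: "ccoalg C" and X: "ccoalg X" and w: "w \<in> carr X"
    and gl: "teq X X (comult X w) [(w, w)]" "counit X w = 1"
  shows "chom C X (cunit C X w)"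
  unfolding chom_def
proof (intro conjI ext0_cunit cmapI[OF C X cunit_lin[OF C _ w]])
  show "vspace X" using X by simp
  fix c assume c: "c \<in> carr C"
  {
    fix b assume b: "bilin X X field_space b"
    have "sw X b w = b w w"
      using teq_bilin[OF gl(1) b] by (simp add: sw2_def)
    then have "sw X b (cunit C X w c) = counit C c * b w w"
      using c lin_mapD(3)[OF sw2_lin[OF X b vspace_field_space] w] by (simp add: cunit_def)
    also have "\<dots> = sw C (\<lambda>x y. counit C x * counit C y) c * b w w"
      by (simp add: conv_counit_sum[OF C c])
    also have "\<dots> = sw C (\<lambda>x y. counit C x * counit C y * b w w) c"
      by (simp add: sw2_def sum_list_mult_const case_prod_beta')
    also have "\<dots> = sw C (\<lambda>x y. b (cunit C X w x) (cunit C X w y)) c"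
    proof (rule sw2_cong[OF C c])
      fix x y assume xy: "x \<in> carr C" "y \<in> carr C"
      have "smul X (counit C y) w \<in> carr X" using X w by (simp add: vspaceD)
      then show "counit C x * counit C y * b w w = b (cunit C X w x) (cunit C X w y)"
        using xy lin_mapD(3)[OF bilinD(3)[OF b] w] lin_mapD(3)[OF bilinD(2)[OF b w] w] by (simp add: cunit_def)
    qed
    finally show "sw X b (cunit C X w c) = sw C (\<lambda>x y. b (cunit C X w x) (cunit C X w y)) c" .
  }
  show "counit X (cunit C X w c) = counit C c"
    using c lin_mapD(3)[OF counit_lin[OF X] w] gl(2) by (simp add: cunit_def)
qed

section \<open>Tensor products of coalgebras\<close>

text \<open>The linear map on U \<otimes> V induced by \<open>L\<close>, computed on the
  representative that \<open>srep\<close> chooses. All operations of \<open>smash\<close> other than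
  its counit can be written with it; for bilinear \<open>L\<close> the choice is irrelevant by
  \<open>ext_of_list\<close>.\<close>

definition ext :: "('k::field, 'u::ab_group_add) hopf_alg \<Rightarrow> ('k, 'v::ab_group_add) hopf_alg \<Rightarrow> ('u \<Rightarrow> 'v \<Rightarrow> 'w::comm_monoid_add) \<Rightarrow>
    ('k, 'u, 'v) tensor \<Rightarrow> 'w" where
  "ext U V L t = sum_list (map (\<lambda>(a, h). L a h) (srep U V t))"

lemma smash_simps [simp]:
  "carr (smash U V la ra) = tensor_carr U V"
  "smul (smash U V la ra) = (\<lambda>c t f. c * t f)"
  "counit (smash U V la ra) = (\<lambda>t. t (\<lambda>a h. counit U a * counit V h))"
  by (simp_all add: smash_def)

lemma tens_of_list_apply:
  "tens_of_list U V l f = (if bilin_form U V f then \<Sum>(a, h)\<leftarrow>l. f a h else 0)"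
  by (induction l) (auto simp: tens_of_list_def tens_def zero_fun_def plus_fun_def)

text \<open>Injectivity of the embedding of tensors into functions on forms: evaluating at each
  bilinear form gives \<open>teq\<close>.\<close>

lemma tens_of_list_eqD:
  "tens_of_list U V l = tens_of_list U V l' \<Longrightarrow> tens_list U V l \<Longrightarrow> tens_list U V l' \<Longrightarrow> teq U V l l'"
  unfolding teq_def using tens_of_list_apply[of U V l] tens_of_list_apply[of U V l'] by simp metis

lemma tens_of_list_append: "tens_of_list U V (l @ l') = tens_of_list U V l + tens_of_list U V l'"
  by (simp add: tens_of_list_def)

lemma srep:
  assumes "t \<in> tensor_carr U V"
  shows "tens_list U V (srep U V t)" "tens_of_list U V (srep U V t) = t"
proof -
  have "\<exists>l. tens_list U V l \<and> t = tens_of_list U V l"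
    using assms by (auto simp: tensor_carr_def)
  then have "tens_list U V (srep U V t) \<and> t = tens_of_list U V (srep U V t)"
    unfolding srep_def by (rule someI_ex)
  then show "tens_list U V (srep U V t)" "tens_of_list U V (srep U V t) = t" by simp_all
qed

lemma srep_mem: "t \<in> tensor_carr U V \<Longrightarrow> (a, h) \<in> set (srep U V t) \<Longrightarrow> a \<in> carr U \<and> h \<in> carr V"
  using srep(1)[of t U V] by (auto simp: tens_list_def)

lemma tens_of_list_mem: "tens_list U V l \<Longrightarrow> tens_of_list U V l \<in> tensor_carr U V"
  by (auto simp: tensor_carr_def)

lemma tens_single: "tens U V a h = tens_of_list U V [(a, h)]"
  by (simp add: tens_of_list_def)

lemma tens_mem: "a \<in> carr U \<Longrightarrow> h \<in> carr V \<Longrightarrow> tens U V a h \<in> tensor_carr U V"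
  unfolding tens_single by (rule tens_of_list_mem) (simp add: tens_list_def)

lemma smul_tens_of_list:
  assumes "vspace U" "tens_list U V l"
  shows "(\<lambda>f. c * tens_of_list U V l f) = tens_of_list U V (map (\<lambda>(a, h). (smul U c a, h)) l)"
proof
  fix f show "c * tens_of_list U V l f = tens_of_list U V (map (\<lambda>(a, h). (smul U c a, h)) l) f"
  proof (cases "bilin_form U V f")
    case True
    then have *: "f (smul U c a) h = c * f a h" if "(a, h) \<in> set l" for a h
      using assms(2) that unfolding bilin_form_def lin_form_def tens_list_def by blast
    have "(\<Sum>(a, h)\<leftarrow>map (\<lambda>(a, h). (smul U c a, h)) l. f a h) = (\<Sum>(a, h)\<leftarrow>l. c * f a h)"
      unfolding map_map by (intro arg_cong[where f = sum_list] map_cong) (auto simp: *)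
    then show ?thesis using True by (simp add: tens_of_list_apply sum_list_const_mult case_prod_beta')
  qed (simp add: tens_of_list_apply)
qed

lemma smul_tensor_mem:
  assumes "vspace U" "t \<in> tensor_carr U V"
  shows "(\<lambda>f. c * t f) \<in> tensor_carr U V"
proof -
  obtain l where l: "tens_list U V l" "t = tens_of_list U V l" using assms(2) by (auto simp: tensor_carr_def)
  have "tens_list U V (map (\<lambda>(a, h). (smul U c a, h)) l)"
    using l(1) vspaceD(4)[OF assms(1)] by (auto simp: tens_list_def)
  then show ?thesis unfolding l(2) smul_tens_of_list[OF assms(1) l(1)] by (rule tens_of_list_mem)
qed

lemma vspace_smash [simp]:
  assumes U: "vspace U"
  shows "vspace (smash U V la ra)"
proof -
  have m1: "(\<lambda>f. (- 1) * t f) = - t" for t :: "('a, 'b, 'd) tensor"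
    by (simp add: fun_eq_iff)
  show ?thesis
    unfolding vspace_def smash_simps
  proof (intro conjI ballI allI)
    show "0 \<in> tensor_carr U V" unfolding tensor_carr_def
      by (rule CollectI, rule exI[of _ "[]"]) (simp add: tens_of_list_def tens_list_def)
    fix x y assume x: "x \<in> tensor_carr U V" and y: "y \<in> tensor_carr U V"
    obtain l where l: "tens_list U V l" "x = tens_of_list U V l" using x by (auto simp: tensor_carr_def)
    obtain l' where l': "tens_list U V l'" "y = tens_of_list U V l'" using y by (auto simp: tensor_carr_def)
    show "x + y \<in> tensor_carr U V"
      unfolding l(2) l'(2) tens_of_list_append[symmetric]
      by (rule tens_of_list_mem) (use l(1) l'(1) in \<open>simp add: tens_list_def\<close>)
    show "- x \<in> tensor_carr U V" using smul_tensor_mem[OF U x, of "- 1"] unfolding m1 .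
    show "(\<lambda>f. c * x f) \<in> tensor_carr U V" for c by (rule smul_tensor_mem[OF U x])
  qed (simp_all add: fun_eq_iff algebra_simps)
qed

text \<open>The default value 0 on functions that are not bilinear forms is what makes
  \<open>tens\<close> bilinear as an element of the whole function space.\<close>

lemma tens_bilin:
  "vspace U \<Longrightarrow> vspace V \<Longrightarrow> bilin U V (smash U V la ra) (tens U V)"
  by (auto simp: bilin_def lin_map_def tens_mem; auto simp: tens_def fun_eq_iff bilin_form_def lin_form_def)

lemma ext_of_list:
  fixes W :: "('k::field, 'w::ab_group_add) hopf_alg"
  assumes L: "bilin U V W L" and W: "vspace W" and l: "tens_list U V l"
  shows "ext U V L (tens_of_list U V l) = (\<Sum>(a, h)\<leftarrow>l. L a h)"
  unfolding ext_def
  by (rule teq_bilin[OF _ L W]) (rule tens_of_list_eqD, simp_all add: srep tens_of_list_mem l)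

lemma ext_tens:
  fixes W :: "('k::field, 'w::ab_group_add) hopf_alg"
  assumes "bilin U V W L" "vspace W" "a \<in> carr U" "h \<in> carr V"
  shows "ext U V L (tens U V a h) = L a h"
  unfolding tens_single using assms by (subst ext_of_list) (auto simp: tens_list_def)

lemma ext_lin:
  fixes W :: "('k::field, 'w::ab_group_add) hopf_alg"
  assumes U: "vspace U" and L: "bilin U V W L" and W: "vspace W"
  shows "lin_map (smash U V la ra) W (ext U V L)"
  unfolding lin_map_def smash_simps
proof (intro conjI ballI allI)
  fix x y assume x: "x \<in> tensor_carr U V" and y: "y \<in> tensor_carr U V"
  obtain l where l: "tens_list U V l" "x = tens_of_list U V l" using x by (auto simp: tensor_carr_def)
  obtain l' where l': "tens_list U V l'" "y = tens_of_list U V l'" using y by (auto simp: tensor_carr_def)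
  have mem: "(case p of (a, h) \<Rightarrow> L a h) \<in> carr W" if "p \<in> set l" for p
    using l(1) that bilinD(1)[OF L] by (auto simp: tens_list_def)
  show "ext U V L x \<in> carr W"
    unfolding l(2) ext_of_list[OF L W l(1)] by (rule sum_list_carr[OF W mem])
  have "tens_list U V (l @ l')" using l(1) l'(1) by (simp add: tens_list_def)
  then show "ext U V L (x + y) = ext U V L x + ext U V L y"
    unfolding l(2) l'(2) tens_of_list_append[symmetric] ext_of_list[OF L W l(1)] ext_of_list[OF L W l'(1)]
    by (subst ext_of_list[OF L W]) simp_all
  fix c
  have tl: "tens_list U V (map (\<lambda>(a, h). (smul U c a, h)) l)"
    using l(1) vspaceD(4)[OF U] by (auto simp: tens_list_def)
  have "(\<Sum>(a, h)\<leftarrow>map (\<lambda>(a, h). (smul U c a, h)) l. L a h) = (\<Sum>p\<leftarrow>l. smul W c (case p of (a, h) \<Rightarrow> L a h))"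
    unfolding map_map using l(1) lin_mapD(3)[OF bilinD(3)[OF L]]
    by (intro arg_cong[where f = sum_list] map_cong) (auto simp: tens_list_def)
  also have "\<dots> = smul W c (\<Sum>(a, h)\<leftarrow>l. L a h)"
    by (rule lin_map_sum_list[OF smul_lin[OF W] W mem, symmetric])
  finally show "ext U V L (\<lambda>f. c * x f) = smul W c (ext U V L x)"
    unfolding l(2) smul_tens_of_list[OF U l(1)] ext_of_list[OF L W l(1)] ext_of_list[OF L W tl] .
qed

lemma ext_lin_param:
  assumes "t \<in> tensor_carr U V" "vspace Y" "vspace W"
    "\<And>a h. a \<in> carr U \<Longrightarrow> h \<in> carr V \<Longrightarrow> lin_map Y W (\<lambda>y. F y a h)"
  shows "lin_map Y W (\<lambda>y. ext U V (F y) t)"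
  unfolding ext_def
  by (rule sum_list_lin_map[OF assms(3,2)]) (use srep_mem[OF assms(1)] assms(4) in auto)

lemma ext_bilin:
  fixes W :: "('k::field, 'w::ab_group_add) hopf_alg"
  assumes U: "vspace U" and Y: "vspace Y" and W: "vspace W" and L: "trilin U V Y W L"
  shows "bilin (smash U V la ra) Y W (\<lambda>t y. ext U V (\<lambda>a h. L a h y) t)"
  by (rule bilinI) (auto intro!: ext_lin_param[OF _ Y W] ext_lin[OF U _ W] trilinD[OF L])

text \<open>The simple tensors span, so linear maps are compared on them.\<close>

lemma tensor_lin_eq:
  fixes U :: "('k::field, 'u::ab_group_add) hopf_alg"
  assumes U: "vspace U" and V: "vspace V" and t: "t \<in> tensor_carr U V"
    and f: "lin_map (smash U V la ra) W f" and g: "lin_map (smash U V la ra) W g"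
    and eq: "\<And>a h. a \<in> carr U \<Longrightarrow> h \<in> carr V \<Longrightarrow> f (tens U V a h) = g (tens U V a h)"
  shows "f t = g t"
proof -
  have mem: "(case p of (a, h) \<Rightarrow> tens U V a h) \<in> carr (smash U V la ra)" if "p \<in> set (srep U V t)" for p
    using srep_mem[OF t] that by (cases p) (auto intro!: tens_mem)
  have t': "t = (\<Sum>p\<leftarrow>srep U V t. case p of (a, h) \<Rightarrow> tens U V a h)"
    using srep(2)[OF t] by (simp add: tens_of_list_def)
  have "f t = (\<Sum>p\<leftarrow>srep U V t. f (case p of (a, h) \<Rightarrow> tens U V a h))"
    by (subst t') (rule lin_map_sum_list[OF f vspace_smash[OF U] mem])
  also have "\<dots> = (\<Sum>p\<leftarrow>srep U V t. g (case p of (a, h) \<Rightarrow> tens U V a h))"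
    using srep_mem[OF t] eq by (intro arg_cong[where f = sum_list] map_cong) auto
  also have "\<dots> = g t"
    by (subst (2) t') (rule lin_map_sum_list[OF g vspace_smash[OF U] mem, symmetric])
  finally show ?thesis .
qed

lemma sw2_smash:
  "sw2 (comult (smash U V la ra)) F t =
    ext U V (\<lambda>a h. sw U (\<lambda>a1 a2. sw V (\<lambda>h1 h2. F (tens U V a1 h1) (tens U V a2 h2)) h) a) t"
  by (simp add: sw2_def ext_def smash_def case_prod_beta' sum_list_map_concat o_def)

text \<open>The first projection, cut off to 0 outside the tensors so that it is a point in the
  sense of \<open>chom\<close>.\<close>

definition prL :: "('k::field, 'u::ab_group_add) hopf_alg \<Rightarrow> ('k, 'v::ab_group_add) hopf_alg \<Rightarrow> ('k, 'u, 'v) tensor \<Rightarrow> 'u" where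
  "prL U V t = (if t \<in> tensor_carr U V then ext U V (\<lambda>a h. smul U (counit V h) a) t else 0)"

definition prR :: "('k::field, 'u::ab_group_add) hopf_alg \<Rightarrow> ('k, 'v::ab_group_add) hopf_alg \<Rightarrow> ('k, 'u, 'v) tensor \<Rightarrow> 'v" where
  "prR U V t = (if t \<in> tensor_carr U V then ext U V (\<lambda>a h. smul V (counit U a) h) t else 0)"

section \<open>The tensor product of two cocommutative coalgebras and its universal property\<close>

context
  fixes U :: "('k::field, 'u::ab_group_add) hopf_alg" and V :: "('k, 'v::ab_group_add) hopf_alg"
    and E :: "('k, ('k, 'u, 'v) tensor) hopf_alg" and la ra
  assumes U: "ccoalg U" and V: "ccoalg V"
  defines E_def: "E \<equiv> smash U V la ra"
begin

private lemma Uv: "vspace U" and Vv: "vspace V" and Ev: "vspace E"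
  using U V by (simp_all add: E_def)

private lemma carrE: "carr E = tensor_carr U V"
  by (simp add: E_def)

private lemma tb: "bilin U V E (tens U V)"
  unfolding E_def by (rule tens_bilin[OF Uv Vv])

private lemma tens_pair_lin:
  assumes F: "bilin E E W F"
    and "a1 \<in> carr U" "a2 \<in> carr U" "h1 \<in> carr V" "h2 \<in> carr V"
  shows "lin_map U W (\<lambda>a1. F (tens U V a1 h1) (tens U V a2 h2))"
    "lin_map U W (\<lambda>a2. F (tens U V a1 h1) (tens U V a2 h2))"
    "lin_map V W (\<lambda>h1. F (tens U V a1 h1) (tens U V a2 h2))"
    "lin_map V W (\<lambda>h2. F (tens U V a1 h1) (tens U V a2 h2))"
  using assms(2-)
  by (auto intro!: lin_map_comp[OF bilinD(3)[OF F]] lin_map_comp[OF bilinD(2)[OF F]] bilinD[OF tb])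

private lemma tens_pair_bilin:
  assumes F: "bilin E E W F" and W: "vspace W"
  shows "bilin U V W (\<lambda>a h. sw U (\<lambda>a1 a2. sw V (\<lambda>h1 h2. F (tens U V a1 h1) (tens U V a2 h2)) h) a)"
  by (auto intro!: bilinI sw2_lin_param[OF U] sw2_lin_param[OF V] sw2_lin[OF U] sw2_lin[OF V] W Uv Vv tens_pair_lin[OF F])

private lemma sw2_E_lin:
  assumes F: "bilin E E W F" and W: "vspace W"
  shows "lin_map E W (sw E F)"
  unfolding E_def using ext_lin[OF Uv tens_pair_bilin[OF F W] W, of la ra]
  by (rule lin_map_cong) (simp_all add: Uv sw2_smash)

lemma sw2_smash_tens:
  assumes F: "bilin E E W F" and W: "vspace W" and a: "a \<in> carr U" and h: "h \<in> carr V"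
  shows "sw E F (tens U V a h) =
    sw U (\<lambda>a1 a2. sw V (\<lambda>h1 h2. F (tens U V a1 h1) (tens U V a2 h2)) h) a"
  unfolding E_def sw2_smash by (rule ext_tens[OF tens_pair_bilin[OF F W] W a h])

private lemma E_comult_mem:
  assumes t: "t \<in> carr E" and "(x, y) \<in> set (comult E t)"
  shows "x \<in> carr E \<and> y \<in> carr E"
proof -
  obtain a h a1 a2 h1 h2 where *: "(a, h) \<in> set (srep U V t)" "(a1, a2) \<in> set (comult U a)" "(h1, h2) \<in> set (comult V h)"
    "x = tens U V a1 h1" "y = tens U V a2 h2"
    using assms(2) unfolding E_def smash_def by auto
  then show ?thesis
    using srep_mem[OF t[unfolded carrE] *(1)] comult_mem[OF U _ *(2)] comult_mem[OF V _ *(3)]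
    by (auto simp: carrE intro!: tens_mem)
qed

private lemma E_lin_param:
  assumes "x \<in> carr E" "vspace Y" "vspace W" "\<And>a b. a \<in> carr E \<Longrightarrow> b \<in> carr E \<Longrightarrow> lin_map Y W (\<lambda>z. F z a b)"
  shows "lin_map Y W (\<lambda>z. sw E (F z) x)"
  unfolding sw2_def
  by (rule sum_list_lin_map[OF assms(3,2)]) (use E_comult_mem[OF assms(1)] assms(4) in auto)

private lemma E_teqI:
  assumes "t \<in> carr E" "tens_list E E l"
    "\<And>f. bilin E E field_space f \<Longrightarrow> sw E f t = (\<Sum>(x, y)\<leftarrow>l. f x y)"
  shows "teq E E (comult E t) l"
  unfolding teq_def using assms E_comult_mem[OF assms(1)]
  by (auto simp: tens_list_def bilin_form_iff sw2_def)

private lemma tens_eqI: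
  assumes "t \<in> carr E" "lin_map E W f" "lin_map E W g"
    "\<And>a h. a \<in> carr U \<Longrightarrow> h \<in> carr V \<Longrightarrow> f (tens U V a h) = g (tens U V a h)"
  shows "f t = g t"
  using tensor_lin_eq[OF Uv Vv assms(1)[unfolded carrE] assms(2,3)[unfolded E_def] assms(4)] .

private lemma counit_bilin: "bilin_form U V (\<lambda>a h. counit U a * counit V h)"
  using counit_lin[OF U] counit_lin[OF V]
  by (auto simp: bilin_form_iff bilin_def lin_map_def algebra_simps)

lemma counit_tens: "counit E (tens U V a h) = counit U a * counit V h"
  by (simp add: E_def tens_def counit_bilin)

private lemma E_counit_lin: "lin_map E field_space (counit E)"
  by (auto simp: E_def lin_map_def)

text \<open>On a simple tensor both sides are fourfold sums. Exchanging sums over U with sums over V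
  separates the factors, coassociativity is applied in V and then in U, and the sums are exchanged
  back.\<close>

private lemma E_assoc:
  assumes F: "trilin E E E field_space F" and x: "x \<in> carr E"
  shows "sw E (\<lambda>u z. sw E (\<lambda>x y. F x y z) u) x =
    sw E (\<lambda>x u. sw E (\<lambda>y z. F x y z) u) x"
proof (rule tens_eqI[OF x])
  note K = vspace_field_space
  have b1: "bilin E E field_space (\<lambda>u z. sw E (\<lambda>x y. F x y z) u)"
    by (auto intro!: bilinI sw2_E_lin E_lin_param K Ev trilinD[OF F])
  have b2: "bilin E E field_space (\<lambda>x u. sw E (\<lambda>y z. F x y z) u)"
    by (auto intro!: bilinI sw2_E_lin E_lin_param K Ev trilinD[OF F])
  show "lin_map E field_space (sw E (\<lambda>u z. sw E (\<lambda>x y. F x y z) u))"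
    by (rule sw2_E_lin[OF b1 K])
  show "lin_map E field_space (sw E (\<lambda>x u. sw E (\<lambda>y z. F x y z) u))"
    by (rule sw2_E_lin[OF b2 K])
  fix a h assume a: "a \<in> carr U" and h: "h \<in> carr V"
  let ?t = "tens U V"
  have tm: "?t a h \<in> carr E" if "a \<in> carr U" "h \<in> carr V" for a h using that bilinD(1)[OF tb] by blast
  have FL1: "lin_map U field_space (\<lambda>p. F (?t p h1) y z)" "lin_map V field_space (\<lambda>q. F (?t a1 q) y z)"
    if "a1 \<in> carr U" "h1 \<in> carr V" "y \<in> carr E" "z \<in> carr E" for a1 h1 y z
    using that by (auto intro!: lin_map_comp[OF trilinD(1)[OF F]] bilinD[OF tb])
  have FL2: "lin_map U field_space (\<lambda>p. F x (?t p h1) z)" "lin_map V field_space (\<lambda>q. F x (?t a1 q) z)"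
    if "a1 \<in> carr U" "h1 \<in> carr V" "x \<in> carr E" "z \<in> carr E" for a1 h1 x z
    using that by (auto intro!: lin_map_comp[OF trilinD(2)[OF F]] bilinD[OF tb])
  have FL3: "lin_map U field_space (\<lambda>p. F x y (?t p h1))" "lin_map V field_space (\<lambda>q. F x y (?t a1 q))"
    if "a1 \<in> carr U" "h1 \<in> carr V" "x \<in> carr E" "y \<in> carr E" for a1 h1 x y
    using that by (auto intro!: lin_map_comp[OF trilinD(3)[OF F]] bilinD[OF tb])
  have tri: "trilin V V V field_space (\<lambda>h1 h2 h3. F (?t a1 h1) (?t a2 h2) (?t a3 h3))"
    if "a1 \<in> carr U" "a2 \<in> carr U" "a3 \<in> carr U" for a1 a2 a3
    using that by (intro trilinI FL1(2) FL2(2) FL3(2) tm)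
  have tri': "trilin U U U field_space (\<lambda>a1 a2 a3. sw V (\<lambda>h1 v. sw V (\<lambda>h2 h3. F (?t a1 h1) (?t a2 h2) (?t a3 h3)) v) h)"
    by (intro trilinI sw2_lin_param[OF V] K Uv h FL1(1) FL2(1) FL3(1) tm)
  have "sw E (\<lambda>u z. sw E (\<lambda>x y. F x y z) u) (?t a h) =
    sw U (\<lambda>u a3. sw V (\<lambda>v h3. sw U (\<lambda>a1 a2. sw V (\<lambda>h1 h2.
      F (?t a1 h1) (?t a2 h2) (?t a3 h3)) v) u) h) a"
    unfolding sw2_smash_tens[OF b1 K a h]
    by (intro sw2_cong[OF U] sw2_cong[OF V] a h) (rule sw2_smash_tens[OF trilinD(6)[OF F] K]; simp add: tm)
  also have "\<dots> = sw U (\<lambda>u a3. sw U (\<lambda>a1 a2. sw V (\<lambda>v h3. sw V (\<lambda>h1 h2.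
      F (?t a1 h1) (?t a2 h2) (?t a3 h3)) v) h) u) a"
    by (intro sw2_cong[OF U] a sw2_swap)
  also have "\<dots> = sw U (\<lambda>u a3. sw U (\<lambda>a1 a2. sw V (\<lambda>h1 v. sw V (\<lambda>h2 h3.
      F (?t a1 h1) (?t a2 h2) (?t a3 h3)) v) h) u) a"
    by (intro sw2_cong[OF U] a sw2_assoc[OF V tri K h])
  also have "\<dots> = sw U (\<lambda>a1 u. sw U (\<lambda>a2 a3. sw V (\<lambda>h1 v. sw V (\<lambda>h2 h3.
      F (?t a1 h1) (?t a2 h2) (?t a3 h3)) v) h) u) a"
    by (rule sw2_assoc[OF U tri' K a])
  also have "\<dots> = sw U (\<lambda>a1 u. sw V (\<lambda>h1 v. sw U (\<lambda>a2 a3. sw V (\<lambda>h2 h3.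
      F (?t a1 h1) (?t a2 h2) (?t a3 h3)) v) u) h) a"
    by (intro sw2_cong[OF U] a sw2_swap)
  also have "\<dots> = sw E (\<lambda>x u. sw E (\<lambda>y z. F x y z) u) (?t a h)"
    unfolding sw2_smash_tens[OF b2 K a h]
    by (intro sw2_cong[OF U] sw2_cong[OF V] a h) (rule sw2_smash_tens[OF trilinD(5)[OF F] K, symmetric]; simp add: tm)
  finally show "sw E (\<lambda>u z. sw E (\<lambda>x y. F x y z) u) (?t a h) =
    sw E (\<lambda>x u. sw E (\<lambda>y z. F x y z) u) (?t a h)" .
qed

lemma sw2_bilin_split:
  assumes L: "bilin U V W L" and W: "vspace W" and a: "a \<in> carr U" and h: "h \<in> carr V"
    and f: "\<And>p q. p \<in> carr U \<Longrightarrow> q \<in> carr U \<Longrightarrow> f p q \<in> carr U"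
    and g: "\<And>p q. p \<in> carr V \<Longrightarrow> q \<in> carr V \<Longrightarrow> g p q \<in> carr V"
  shows "sw U (\<lambda>a1 a2. sw V (\<lambda>h1 h2. L (f a1 a2) (g h1 h2)) h) a =
    L (sw U f a) (sw V g h)"
proof -
  have s: "sw V g h \<in> carr V" by (rule sw2_carr[OF V h Vv g])
  have "sw U (\<lambda>a1 a2. sw V (\<lambda>h1 h2. L (f a1 a2) (g h1 h2)) h) a =
    sw U (\<lambda>a1 a2. L (f a1 a2) (sw V g h)) a"
    by (rule sw2_cong[OF U a]) (rule lin_sw2[OF bilinD(2)[OF L f] Vv V h g, symmetric])
  also have "\<dots> = L (sw U f a) (sw V g h)"
    by (rule lin_sw2[OF bilinD(3)[OF L s] Uv U a f, symmetric])
  finally show ?thesis .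
qed

private lemma E_counit:
  assumes x: "x \<in> carr E"
  shows "sw E (\<lambda>a b. smul E (counit E a) b) x = x" (is ?g1)
    and "sw E (\<lambda>a b. smul E (counit E b) a) x = x" (is ?g2)
proof -
  have b: "bilin E E E (\<lambda>a b. smul E (counit E a) b)"
    using E_counit_lin by (intro bilinI) (auto simp: lin_map_def vspaceD[OF Ev] mult.commute)
  have sm: "smul U c p \<in> carr U" if "p \<in> carr U" for c p by (rule vspaceD(4)[OF Uv that])
  have sm': "smul V c p \<in> carr V" if "p \<in> carr V" for c p by (rule vspaceD(4)[OF Vv that])
  have t: "smul E (c * d) (tens U V p q) = tens U V (smul U c p) (smul V d q)" if "p \<in> carr U" "q \<in> carr V" for c d p q
    using that bilinD(1)[OF tb that] lin_mapD(3)[OF bilinD(3)[OF tb]] lin_mapD(3)[OF bilinD(2)[OF tb]] sm'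
    by (simp add: vspaceD(7)[OF Ev])
  show ?g1
  proof (rule tens_eqI[OF x sw2_E_lin[OF b Ev] lin_map_id])
    fix a h assume a: "a \<in> carr U" and h: "h \<in> carr V"
    have "sw E (\<lambda>a b. smul E (counit E a) b) (tens U V a h) =
      sw U (\<lambda>a1 a2. sw V (\<lambda>h1 h2. tens U V (smul U (counit U a1) a2) (smul V (counit V h1) h2)) h) a"
      unfolding sw2_smash_tens[OF b Ev a h]
      by (intro sw2_cong[OF U] sw2_cong[OF V] a h) (simp add: counit_tens t)
    also have "\<dots> = tens U V a h"
      by (subst sw2_bilin_split[OF tb Ev a h]) (simp_all add: sm sm' counit_left[OF U a] counit_left[OF V h])
    finally show "sw E (\<lambda>a b. smul E (counit E a) b) (tens U V a h) = tens U V a h" .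
  qed
  show ?g2
  proof (rule tens_eqI[OF x sw2_E_lin[OF bilin_flip[OF b] Ev] lin_map_id])
    fix a h assume a: "a \<in> carr U" and h: "h \<in> carr V"
    have "sw E (\<lambda>a b. smul E (counit E b) a) (tens U V a h) =
      sw U (\<lambda>a1 a2. sw V (\<lambda>h1 h2. tens U V (smul U (counit U a2) a1) (smul V (counit V h2) h1)) h) a"
      unfolding sw2_smash_tens[OF bilin_flip[OF b] Ev a h]
      by (intro sw2_cong[OF U] sw2_cong[OF V] a h) (simp add: counit_tens t)
    also have "\<dots> = tens U V a h"
      by (subst sw2_bilin_split[OF tb Ev a h]) (simp_all add: sm sm' counit_right[OF U a] counit_right[OF V h])
    finally show "sw E (\<lambda>a b. smul E (counit E b) a) (tens U V a h) = tens U V a h" .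
  qed
qed

private lemma E_flip:
  assumes F: "bilin E E field_space F" and x: "x \<in> carr E"
  shows "sw E F x = sw E (\<lambda>a b. F b a) x"
proof (rule tens_eqI[OF x sw2_E_lin[OF F] sw2_E_lin[OF bilin_flip[OF F]]])
  note K = vspace_field_space
  fix a h assume a: "a \<in> carr U" and h: "h \<in> carr V"
  have "sw E F (tens U V a h) =
    sw U (\<lambda>a1 a2. sw V (\<lambda>h1 h2. F (tens U V a1 h1) (tens U V a2 h2)) h) a"
    by (rule sw2_smash_tens[OF F K a h])
  also have "\<dots> = sw U (\<lambda>a1 a2. sw V (\<lambda>h1 h2. F (tens U V a1 h2) (tens U V a2 h1)) h) a"
    by (rule sw2_cong[OF U a]) (rule sw2_flip[OF V bilinI K h]; rule tens_pair_lin[OF F]; assumption)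
  also have "\<dots> = sw U (\<lambda>a1 a2. sw V (\<lambda>h1 h2. F (tens U V a2 h2) (tens U V a1 h1)) h) a"
    by (rule sw2_flip[OF U bilinI K a]) (auto intro!: sw2_lin_param[OF V h] Uv tens_pair_lin[OF F])
  also have "\<dots> = sw E (\<lambda>a b. F b a) (tens U V a h)"
    by (rule sw2_smash_tens[OF bilin_flip[OF F] K a h, symmetric])
  finally show "sw E F (tens U V a h) = sw E (\<lambda>a b. F b a) (tens U V a h)" .
qed simp_all

text \<open>Holds for arbitrary \<open>la\<close> and \<open>ra\<close>, because the
  comultiplication and counit of \<open>smash\<close> do not involve them. Thus \<open>smash\<close>
  also supplies the plain tensor products that serve as bases of universal points.\<close>

lemma ccoalg_smash: "ccoalg E"
  unfolding ccoalg_def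
proof (intro conjI ballI allI impI)
  show "vspace E" by (rule Ev)
  show "lin_form E (counit E)" using E_counit_lin by (simp add: lin_form_iff)
next
  fix x assume "x \<in> carr E"
  from E_comult_mem[OF this] show "tens_list E E (comult E x)" by (auto simp: tens_list_def)
next
  fix x y assume xy: "x \<in> carr E" "y \<in> carr E"
  show "teq E E (comult E (x + y)) (comult E x @ comult E y)"
  proof (rule E_teqI)
    show "x + y \<in> carr E" by (rule vspaceD(2)[OF Ev xy])
    show "tens_list E E (comult E x @ comult E y)"
      using E_comult_mem[OF xy(1)] E_comult_mem[OF xy(2)] by (auto simp: tens_list_def)
    fix f assume "bilin E E field_space f"
    from lin_mapD(2)[OF sw2_E_lin[OF this vspace_field_space] xy]
    show "sw E f (x + y) = (\<Sum>(x, y)\<leftarrow>comult E x @ comult E y. f x y)" by (simp add: sw2_def)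
  qed
next
  fix c x assume x: "x \<in> carr E"
  have mem: "a \<in> carr E" "b \<in> carr E" if "(a, b) \<in> set (comult E x)" for a b using E_comult_mem[OF x that] by auto
  show "teq E E (comult E (smul E c x)) (map (\<lambda>(a, b). (smul E c a, b)) (comult E x))"
  proof (rule E_teqI)
    show "smul E c x \<in> carr E" by (rule vspaceD(4)[OF Ev x])
    show "tens_list E E (map (\<lambda>(a, b). (smul E c a, b)) (comult E x))"
      using mem vspaceD(4)[OF Ev] by (auto simp: tens_list_def)
    fix f assume f: "bilin E E field_space f"
    have "(\<Sum>(a, b)\<leftarrow>map (\<lambda>(a, b). (smul E c a, b)) (comult E x). f a b) = (\<Sum>p\<leftarrow>comult E x. c * (case p of (a, b) \<Rightarrow> f a b))"
      unfolding map_map by (intro arg_cong[where f = sum_list] map_cong) (auto simp: lin_mapD(3)[OF bilinD(3)[OF f]] mem)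
    also have "\<dots> = sw E f (smul E c x)"
      using lin_mapD(3)[OF sw2_E_lin[OF f vspace_field_space] x] by (simp add: sw2_def sum_list_const_mult)
    finally show "sw E f (smul E c x) = (\<Sum>(a, b)\<leftarrow>map (\<lambda>(a, b). (smul E c a, b)) (comult E x). f a b)" ..
  qed
next
  fix x f assume "x \<in> carr E" "trilin_form E f"
  then show "sw3 (comult E) f x = (\<Sum>(x1, u)\<leftarrow>comult E x. \<Sum>(x2, x3)\<leftarrow>comult E u. f x1 x2 x3)"
    using E_assoc[of f x] by (simp add: trilin_form_def trilin_def bilin_def lin_form_iff sw2_def sw3_def)
next
  fix x assume x: "x \<in> carr E"
  show "sw E (\<lambda>a b. smul E (counit E a) b) x = x" "sw E (\<lambda>a b. smul E (counit E b) a) x = x"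
    by (rule E_counit[OF x])+
next
  show "cocomm E" unfolding cocomm_def
  proof
    fix x assume x: "x \<in> carr E"
    show "teq E E (comult E x) (map (\<lambda>(a, b). (b, a)) (comult E x))"
    proof (rule E_teqI[OF x])
      show "tens_list E E (map (\<lambda>(a, b). (b, a)) (comult E x))"
        using E_comult_mem[OF x] by (auto simp: tens_list_def)
      fix f assume "bilin E E field_space f"
      from E_flip[OF this x] show "sw E f x = (\<Sum>(x, y)\<leftarrow>map (\<lambda>(a, b). (b, a)) (comult E x). f x y)"
        by (simp add: sw2_def case_prod_beta' o_def)
    qed
  qed
qed

lemma tens_cbilin: "cbilin U V E (tens U V)"
  unfolding cbilin_def using tb sw2_smash_tens[OF _ vspace_field_space] counit_tens by blast

text \<open>Justifies the definition of \<open>cbilin\<close>: its two clauses are the coalgebra map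
  conditions on simple tensors, and these determine the rest by linearity.\<close>

lemma cmap_ext:
  assumes W: "ccoalg W" and L: "cbilin U V W L"
  shows "cmap E W (ext U V L)"
proof -
  note Lb = cbilin_bilin[OF L] and Wv = ccoalg_vspace[OF W] and K = vspace_field_space
  have el: "lin_map E W (ext U V L)" unfolding E_def by (rule ext_lin[OF Uv Lb Wv])
  note et = ext_tens[OF Lb Wv]
  show ?thesis
  proof (rule cmapI[OF ccoalg_smash W el])
    fix w t assume w: "bilin W W field_space w" and t: "t \<in> carr E"
    have w': "bilin E E field_space (\<lambda>x y. w (ext U V L x) (ext U V L y))" by (rule bilin_comp[OF w el el])
    show "sw W w (ext U V L t) = sw E (\<lambda>x y. w (ext U V L x) (ext U V L y)) t"
    proof (rule tens_eqI[OF t lin_map_comp[OF sw2_lin[OF W w K] el] sw2_E_lin[OF w' K]])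
      fix a h assume a: "a \<in> carr U" and h: "h \<in> carr V"
      have "sw E (\<lambda>x y. w (ext U V L x) (ext U V L y)) (tens U V a h) =
        sw U (\<lambda>a1 a2. sw V (\<lambda>h1 h2. w (L a1 h1) (L a2 h2)) h) a"
        unfolding sw2_smash_tens[OF w' K a h]
        by (intro sw2_cong[OF U] sw2_cong[OF V] a h) (simp add: et)
      then show "sw W w (ext U V L (tens U V a h)) =
        sw E (\<lambda>x y. w (ext U V L x) (ext U V L y)) (tens U V a h)"
        using L a h w by (simp add: et cbilin_def)
    qed
  next
    fix t assume t: "t \<in> carr E"
    show "counit W (ext U V L t) = counit E t"
      by (rule tens_eqI[OF t lin_map_comp[OF counit_lin[OF W] el] E_counit_lin])
        (use L in \<open>simp add: et counit_tens cbilin_def\<close>)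
  qed
qed

lemma chom_prL: "chom E U (prL U V)" and chom_prR: "chom E V (prR U V)"
  unfolding chom_def
  by (intro conjI cmap_cong[OF ccoalg_smash cmap_ext[OF U smul_counit_cbilin[OF U V]]]
      cmap_cong[OF ccoalg_smash cmap_ext[OF V cbilin_flip[OF smul_counit_cbilin[OF V U]]]];
    simp add: prL_def prR_def ext0_def E_def)+

lemma prL_tens: "a \<in> carr U \<Longrightarrow> h \<in> carr V \<Longrightarrow> prL U V (tens U V a h) = smul U (counit V h) a"
  unfolding prL_def using ext_tens[OF smul_counit_bilin[OF Uv V] Uv] by (simp add: tens_mem)

lemma prR_tens: "a \<in> carr U \<Longrightarrow> h \<in> carr V \<Longrightarrow> prR U V (tens U V a h) = smul V (counit U a) h"
  unfolding prR_def using ext_tens[OF bilin_flip[OF smul_counit_bilin[OF Vv U]] Vv] by (simp add: tens_mem)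

lemmas prL_lin = chom_lin[OF chom_prL] and prR_lin = chom_lin[OF chom_prR]

text \<open>The two projections form a universal pair of points.\<close>

lemma conv_pr_tens:
  assumes L: "bilin U V W L" and W: "vspace W" and a: "a \<in> carr U" and h: "h \<in> carr V"
  shows "conv E L (prL U V) (prR U V) (tens U V a h) = L a h"
proof -
  have m: "tens U V a h \<in> carr E" using a h by (simp add: carrE tens_mem)
  have b: "bilin E E W (\<lambda>x y. L (prL U V x) (prR U V y))" by (rule bilin_comp[OF L prL_lin prR_lin])
  have s: "smul U c p \<in> carr U" if "p \<in> carr U" for c p by (rule vspaceD(4)[OF Uv that])
  have s': "smul V c p \<in> carr V" if "p \<in> carr V" for c p by (rule vspaceD(4)[OF Vv that])
  have sL: "L (smul U c p) (smul V d q) = smul W (c * d) (L p q)" if "p \<in> carr U" "q \<in> carr V" for c d p q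
    using lin_mapD(3)[OF bilinD(3)[OF L s'[OF that(2)]] that(1)] lin_mapD(3)[OF bilinD(2)[OF L that(1)] that(2)]
      bilinD(1)[OF L that] by (simp add: vspaceD(7)[OF W])
  have "conv E L (prL U V) (prR U V) (tens U V a h) =
    sw U (\<lambda>a1 a2. sw V (\<lambda>h1 h2. L (prL U V (tens U V a1 h1)) (prR U V (tens U V a2 h2))) h) a"
    unfolding conv_apply[OF m] by (rule sw2_smash_tens[OF b W a h])
  also have "\<dots> = sw U (\<lambda>a1 a2. sw V (\<lambda>h1 h2. L (smul U (counit U a2) a1) (smul V (counit V h1) h2)) h) a"
    by (intro sw2_cong[OF U] sw2_cong[OF V] a h) (simp add: prL_tens prR_tens sL mult.commute)
  also have "\<dots> = L (sw U (\<lambda>a1 a2. smul U (counit U a2) a1) a) (sw V (\<lambda>h1 h2. smul V (counit V h1) h2) h)"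
    by (rule sw2_bilin_split[OF L W a h]) (simp_all add: s s')
  finally show ?thesis by (simp add: counit_right[OF U a] counit_left[OF V h])
qed

text \<open>Tensor products are products in the category of cocommutative coalgebras: the
  projections paired give the identity of E, as seen on simple tensors, and composing with the
  coalgebra map \<open>F\<close> gives the claim for \<open>F\<close>.\<close>

lemma chom_pair_eta:
  assumes C: "ccoalg C" and F: "chom C E F"
  shows "conv C (tens U V) (\<lambda>c. prL U V (F c)) (\<lambda>c. prR U V (F c)) = F"
proof -
  have id: "conv E (tens U V) (prL U V) (prR U V) t = t" if "t \<in> carr E" for t
    by (rule tens_eqI[OF that conv_lin[OF ccoalg_smash tb Ev prL_lin prR_lin] lin_map_id]) (rule conv_pr_tens[OF tb Ev])
  have "(\<lambda>c. conv E (tens U V) (prL U V) (prR U V) (F c)) = F"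
  proof
    fix c show "conv E (tens U V) (prL U V) (prR U V) (F c) = F c"
    proof (cases "c \<in> carr C")
      case True then show ?thesis by (rule id[OF lin_mapD(1)[OF chom_lin[OF F]]])
    next
      case False then show ?thesis using F id[OF vspaceD(1)[OF Ev]] by (simp add: chom_def ext0_def)
    qed
  qed
  then show ?thesis using conv_chom[OF C ccoalg_smash tb Ev prL_lin prR_lin F] by simp
qed

end

lemma conv_smul_counit:
  assumes C: "ccoalg C" and f: "lin_map C X f" "ext0 C f" and g: "chom C Y g"
  shows "conv C (\<lambda>a h. smul X (counit Y h) a) f g = f"
proof (rule ext0_eqI[OF ext0_conv f(2)])
  fix c assume c: "c \<in> carr C"
  have s: "smul C (counit C y) x \<in> carr C" if "x \<in> carr C" for x y
    using C that by (simp add: vspaceD)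
  have "conv C (\<lambda>a h. smul X (counit Y h) a) f g c = sw C (\<lambda>x y. f (smul C (counit C y) x)) c"
    unfolding conv_apply[OF c]
    by (rule sw2_cong[OF C c]) (use g lin_mapD(3)[OF f(1)] in \<open>simp add: chom_def cmap_def\<close>)
  also have "\<dots> = f c"
    by (subst lin_sw2[OF f(1) ccoalg_vspace[OF C] C c s, symmetric]) (simp_all add: counit_right[OF C c])
  finally show "conv C (\<lambda>a h. smul X (counit Y h) a) f g c = f c" .
qed

text \<open>A pair of points determines its components. Here \<open>f\<close> is required to be
  linear only, which matters as long as \<open>R\<close> is not known to be a coalgebra map.\<close>

lemma prL_conv_tens:
  assumes C: "ccoalg C" and U: "ccoalg U" and V: "ccoalg V"
    and f: "lin_map C U f" "ext0 C f" and g: "chom C V g"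
  shows "(\<lambda>c. prL U V (conv C (tens U V) f g c)) = f"
proof -
  note v = ccoalg_vspace[OF U] ccoalg_vspace[OF V]
  note m = lin_mapD(1)[OF f(1)] lin_mapD(1)[OF chom_lin[OF g]]
  have "(\<lambda>c. prL U V (conv C (tens U V) f g c)) = conv C (\<lambda>a h. prL U V (tens U V a h)) f g"
    by (rule conv_comp_lin[OF C tens_bilin[OF v, of undefined undefined] _ f(1) chom_lin[OF g] prL_lin[OF U V]])
      (simp add: v)
  also have "\<dots> = conv C (\<lambda>a h. smul U (counit V h) a) f g"
    by (rule conv_cong[OF C refl refl]) (simp add: prL_tens[OF U V] m)
  finally show ?thesis by (simp add: conv_smul_counit[OF C f g])
qed

lemma prR_conv_tens:
  assumes C: "ccoalg C" and U: "ccoalg U" and V: "ccoalg V"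
    and f: "chom C U f" and g: "lin_map C V g" "ext0 C g"
  shows "(\<lambda>c. prR U V (conv C (tens U V) f g c)) = g"
proof -
  note v = ccoalg_vspace[OF U] ccoalg_vspace[OF V]
  note m = lin_mapD(1)[OF chom_lin[OF f]] lin_mapD(1)[OF g(1)]
  have "(\<lambda>c. prR U V (conv C (tens U V) f g c)) = conv C (\<lambda>a h. prR U V (tens U V a h)) f g"
    by (rule conv_comp_lin[OF C tens_bilin[OF v, of undefined undefined] _ chom_lin[OF f] g(1) prR_lin[OF U V]])
      (simp add: v)
  also have "\<dots> = conv C (\<lambda>a h. smul V (counit U a) h) f g"
    by (rule conv_cong[OF C refl refl]) (simp add: prR_tens[OF U V] m)
  also have "\<dots> = conv C (\<lambda>h a. smul V (counit U a) h) g f"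
    by (rule conv_flip[OF C bilin_flip[OF smul_counit_bilin[OF v(2) U]] v(2) chom_lin[OF f] g(1)])
  finally show ?thesis by (simp add: conv_smul_counit[OF C g f])
qed

section \<open>Componentwise bilinear operations on tensor products\<close>

definition tprod where
  "tprod U V U' V' W Z L M = (\<lambda>x y. ext U V (\<lambda>a h. ext U' V' (\<lambda>b g. tens W Z (L a b) (M h g)) y) x)"

context
  fixes U :: "('k::field, 'u::ab_group_add) hopf_alg" and V :: "('k, 'v::ab_group_add) hopf_alg"
    and U' :: "('k, 'u2::ab_group_add) hopf_alg" and V' :: "('k, 'v2::ab_group_add) hopf_alg"
    and W :: "('k, 'w::ab_group_add) hopf_alg" and Z :: "('k, 'z::ab_group_add) hopf_alg"
    and L M
  assumes vs: "vspace U" "vspace V" "vspace U'" "vspace V'" "vspace W" "vspace Z"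
    and L: "bilin U U' W L" and M: "bilin V V' Z M"
begin

private lemma tensWZ: "bilin W Z (smash W Z l3 r3) (tens W Z)"
  by (rule tens_bilin[OF vs(5,6)])

private lemma
  shows Lm1: "\<And>b h g. b \<in> carr U' \<Longrightarrow> h \<in> carr V \<Longrightarrow> g \<in> carr V' \<Longrightarrow> lin_map U (smash W Z l3 r3) (\<lambda>a. tens W Z (L a b) (M h g))"
    and Lm2: "\<And>a h g. a \<in> carr U \<Longrightarrow> h \<in> carr V \<Longrightarrow> g \<in> carr V' \<Longrightarrow> lin_map U' (smash W Z l3 r3) (\<lambda>b. tens W Z (L a b) (M h g))"
    and Lm3: "\<And>a b g. a \<in> carr U \<Longrightarrow> b \<in> carr U' \<Longrightarrow> g \<in> carr V' \<Longrightarrow> lin_map V (smash W Z l3 r3) (\<lambda>h. tens W Z (L a b) (M h g))"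
    and Lm4: "\<And>a b h. a \<in> carr U \<Longrightarrow> b \<in> carr U' \<Longrightarrow> h \<in> carr V \<Longrightarrow> lin_map V' (smash W Z l3 r3) (\<lambda>g. tens W Z (L a b) (M h g))"
  by (auto intro!: lin_map_comp[OF bilinD(3)[OF tensWZ]] lin_map_comp[OF bilinD(2)[OF tensWZ]] bilinD[OF L] bilinD[OF M])

private lemma inner_trilin:
  "trilin U V (smash U' V' l2 r2) (smash W Z l3 r3) (\<lambda>a h y. ext U' V' (\<lambda>b g. tens W Z (L a b) (M h g)) y)"
  by (auto intro!: trilinI ext_lin ext_lin_param bilinI Lm1 Lm2 Lm3 Lm4 simp: vs)

lemma tprod_bilin:
  "bilin (smash U V l1 r1) (smash U' V' l2 r2) (smash W Z l3 r3) (tprod U V U' V' W Z L M)"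
  unfolding tprod_def by (rule ext_bilin[OF vs(1) _ _ inner_trilin]) (simp_all add: vs)

lemma tprod_tens:
  assumes "a \<in> carr U" "h \<in> carr V" "b \<in> carr U'" "g \<in> carr V'"
  shows "tprod U V U' V' W Z L M (tens U V a h) (tens U' V' b g) = tens W Z (L a b) (M h g)"
proof -
  have vE: "vspace (smash W Z l3 r3)" by (simp add: vs)
  have t: "tens U' V' b g \<in> carr (smash U' V' l2 r2)" using assms by (simp add: tens_mem)
  show ?thesis
    unfolding tprod_def
    by (subst ext_tens[OF trilinD(6)[OF inner_trilin t] vE assms(1,2)], rule ext_tens[OF bilinI vE assms(3,4)])
      (auto intro!: Lm2 Lm4 assms)
qed

lemma conv_tprod:
  assumes C: "ccoalg C" and f: "lin_map C U f" "lin_map C V g" "lin_map C U' f'" "lin_map C V' g'"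
  shows "conv C (tprod U V U' V' W Z L M) (conv C (tens U V) f g) (conv C (tens U' V') f' g') =
    conv C (tens W Z) (conv C L f f') (conv C M g g')"
proof (rule conv_interchange[OF C _ tprod_bilin tens_bilin[OF vs(1,2)] tens_bilin[OF vs(3,4)] tensWZ L M])
  fix a h b g assume "a \<in> carr U" "h \<in> carr V" "b \<in> carr U'" "g \<in> carr V'"
  then show "tprod U V U' V' W Z L M (tens U V a h) (tens U' V' b g) = tens W Z (L a b) (M h g)" by (rule tprod_tens)
qed (simp_all add: vs f)

end

text \<open>Lifts the comultiplication clause of \<open>cbilin\<close> from scalar to vector-valued
  \<open>F\<close> by testing with linear forms.\<close>

lemma cbilin_sw2:
  assumes U: "ccoalg U" and V: "ccoalg V" and W: "ccoalg W" and L: "cbilin U V W L" and F: "bilin W W Z F" and Z: "vspace Z"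
    and u: "u \<in> carr U" and v: "v \<in> carr V"
  shows "sw W F (L u v) = sw U (\<lambda>u1 u2. sw V (\<lambda>v1 v2. F (L u1 v1) (L u2 v2)) v) u"
proof (rule vspace_eqI[OF Z])
  note Lm = bilinD(1)[OF cbilin_bilin[OF L]] and Fm = bilinD(1)[OF F]
  show "sw W F (L u v) \<in> carr Z" by (rule sw2_carr[OF W Lm[OF u v] Z Fm])
  show "sw U (\<lambda>u1 u2. sw V (\<lambda>v1 v2. F (L u1 v1) (L u2 v2)) v) u \<in> carr Z"
    by (intro sw2_carr[OF U u Z] sw2_carr[OF V v Z] Fm Lm)
  fix f assume f: "lin_map Z field_space f"
  have "f (sw W F (L u v)) = sw W (\<lambda>x y. f (F x y)) (L u v)"
    by (rule lin_sw2[OF f Z W Lm[OF u v] Fm])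
  also have "\<dots> = sw U (\<lambda>u1 u2. sw V (\<lambda>v1 v2. f (F (L u1 v1) (L u2 v2))) v) u"
    using L u v bilin_lin_comp[OF f F] unfolding cbilin_def by blast
  also have "\<dots> = sw U (\<lambda>u1 u2. f (sw V (\<lambda>v1 v2. F (L u1 v1) (L u2 v2)) v)) u"
    by (rule sw2_cong[OF U u]) (rule lin_sw2[OF f Z V v, symmetric], intro Fm Lm)
  also have "\<dots> = f (sw U (\<lambda>u1 u2. sw V (\<lambda>v1 v2. F (L u1 v1) (L u2 v2)) v) u)"
    by (rule lin_sw2[OF f Z U u, symmetric]) (intro sw2_carr[OF V v Z] Fm Lm)
  finally show "f (sw W F (L u v)) = f (sw U (\<lambda>u1 u2. sw V (\<lambda>v1 v2. F (L u1 v1) (L u2 v2)) v) u)" .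
qed

section \<open>Cocommutative Hopf algebras\<close>

locale cc_hopf =
  fixes X :: "('k::field, 'x::ab_group_add) hopf_alg"
  assumes hopf: "hopf_algebra X" and cocomm: "cocomm X"
begin

lemma cc [simp]: "ccoalg X"
  by (rule hopf_ccoalg[OF hopf cocomm])

lemma vs [simp]: "vspace X"
  by simp

lemma mult_bilin: "bilin X X X (mult X)"
  using hopf by (simp add: hopf_algebra_def bilin_def lin_map_def)

lemma mult_mem [simp]: "x \<in> carr X \<Longrightarrow> y \<in> carr X \<Longrightarrow> mult X x y \<in> carr X"
  by (rule bilinD(1)[OF mult_bilin])

lemma mult_assoc: "x \<in> carr X \<Longrightarrow> y \<in> carr X \<Longrightarrow> z \<in> carr X \<Longrightarrow> mult X (mult X x y) z = mult X x (mult X y z)"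
  using hopf unfolding hopf_algebra_def by blast

lemma one_mem [simp]: "one_h X \<in> carr X"
  and one_left [simp]: "x \<in> carr X \<Longrightarrow> mult X (one_h X) x = x"
  and one_right [simp]: "x \<in> carr X \<Longrightarrow> mult X x (one_h X) = x"
  using hopf unfolding hopf_algebra_def by blast+

lemma one_grouplike: "teq X X (comult X (one_h X)) [(one_h X, one_h X)]" "counit X (one_h X) = 1"
  using hopf unfolding hopf_algebra_def by blast+

lemma antipode_lin: "lin_map X X (antipode X)"
  using hopf unfolding hopf_algebra_def by blast

lemma antipode_left: "x \<in> carr X \<Longrightarrow> sw X (\<lambda>a b. mult X (antipode X a) b) x = smul X (counit X x) (one_h X)"
  and antipode_right: "x \<in> carr X \<Longrightarrow> sw X (\<lambda>a b. mult X a (antipode X b)) x = smul X (counit X x) (one_h X)"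
  using hopf unfolding hopf_algebra_def by blast+

lemma counit_mult: "x \<in> carr X \<Longrightarrow> y \<in> carr X \<Longrightarrow> counit X (mult X x y) = counit X x * counit X y"
  using hopf unfolding hopf_algebra_def by blast

lemma mult_cbilin: "cbilin X X X (mult X)"
  unfolding cbilin_def
proof (intro conjI ballI allI impI mult_bilin counit_mult)
  fix x y w assume x: "x \<in> carr X" and y: "y \<in> carr X" and w: "bilin X X field_space w"
  have t: "teq X X (comult X (mult X x y)) [(mult X a c, mult X b d). (a, b) \<leftarrow> comult X x, (c, d) \<leftarrow> comult X y]"
    using hopf x y unfolding hopf_algebra_def by blast
  show "sw X w (mult X x y) =
    sw X (\<lambda>u1 u2. sw X (\<lambda>v1 v2. w (mult X u1 v1) (mult X u2 v2)) y) x"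
    using teq_bilin[OF t w vspace_field_space] by (simp add: sw2_def case_prod_beta' sum_list_map_concat o_def)
qed

text \<open>In the convolution algebra of maps \<open>X \<rightarrow> X \<otimes> X\<close>, both \<open>\<Delta> \<circ> S\<close> and \<open>(S \<otimes> S) \<circ> \<Delta>\<close> are inverse to \<open>\<Delta>\<close>.\<close>

lemma antipode_cmap: "cmap X X (antipode X)"
proof -
  let ?S = "antipode X" and ?m = "mult X" and ?t = "tens X X" and ?u = "one_h X"
  define T where "T = smash X X undefined undefined"
  define M where "M = tprod X X X X X X ?m ?m"
  \<comment> \<open>\<open>D\<close> is the comultiplication as a map into X \<otimes> X,
    \<open>I\<close> the neutral element for convolution along \<open>M\<close>, and
    \<open>w\<close> the candidate (S \<otimes> S) \<circ> \<Delta>.\<close>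
  define D where "D = conv X ?t (\<lambda>x. x) (\<lambda>x. x)"
  define I where "I = cunit X T (?t ?u ?u)"
  define w where "w = conv X ?t ?S ?S"
  have Tv: "vspace T" and carrT: "carr T = tensor_carr X X" by (simp_all add: T_def)
  have tb: "bilin X X T ?t" unfolding T_def by (rule tens_bilin[OF vs vs])
  note tm = bilinD(1)[OF tb]
  have Mb: "bilin T T T M"
    unfolding T_def M_def by (rule tprod_bilin[OF vs vs vs vs vs vs mult_bilin mult_bilin])
  note Mm = bilinD(1)[OF Mb]
  have Mt: "M (?t a h) (?t b g) = ?t (?m a b) (?m h g)" if "a \<in> carr X" "h \<in> carr X" "b \<in> carr X" "g \<in> carr X" for a h b g
    unfolding M_def by (rule tprod_tens[OF vs vs vs vs vs vs mult_bilin mult_bilin that])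
  have Teq: "f t = g t" if "t \<in> carr T" "lin_map T T f" "lin_map T T g"
    "\<And>a h. a \<in> carr X \<Longrightarrow> h \<in> carr X \<Longrightarrow> f (?t a h) = g (?t a h)" for f g t
    using tensor_lin_eq[OF vs vs that(1)[unfolded carrT] that(2,3)[unfolded T_def] that(4)] .
  have u: "?t ?u ?u \<in> carr T" by (rule tm[OF one_mem one_mem])
  have Ml: "M (?t ?u ?u) t = t" if "t \<in> carr T" for t
    by (rule Teq[OF that bilinD(2)[OF Mb u] lin_map_id]) (simp add: Mt)
  have Mr: "M t (?t ?u ?u) = t" if "t \<in> carr T" for t
    by (rule Teq[OF that bilinD(3)[OF Mb u] lin_map_id]) (simp add: Mt)
  have Ma: "M (M x y) z = M x (M y z)" if x: "x \<in> carr T" and y: "y \<in> carr T" and z: "z \<in> carr T" for x y z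
  proof (rule Teq[OF x lin_map_comp[OF bilinD(3)[OF Mb z] bilinD(3)[OF Mb y]] bilinD(3)[OF Mb Mm[OF y z]]])
    fix a h assume a: "a \<in> carr X" "h \<in> carr X"
    show "M (M (?t a h) y) z = M (?t a h) (M y z)"
    proof (rule Teq[OF y lin_map_comp[OF bilinD(3)[OF Mb z] bilinD(2)[OF Mb tm[OF a]]]
          lin_map_comp[OF bilinD(2)[OF Mb tm[OF a]] bilinD(3)[OF Mb z]]])
      fix b g assume b: "b \<in> carr X" "g \<in> carr X"
      show "M (M (?t a h) (?t b g)) z = M (?t a h) (M (?t b g) z)"
        by (rule Teq[OF z bilinD(2)[OF Mb Mm[OF tm[OF a] tm[OF b]]] lin_map_comp[OF bilinD(2)[OF Mb tm[OF a]] bilinD(2)[OF Mb tm[OF b]]]])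
          (use a b in \<open>simp add: Mt mult_assoc\<close>)
    qed
  qed
  have Dl: "lin_map X T D" unfolding D_def by (rule conv_lin[OF cc tb Tv lin_map_id lin_map_id])
  have wl: "lin_map X T w" unfolding w_def by (rule conv_lin[OF cc tb Tv antipode_lin antipode_lin])
  note DS = lin_map_comp[OF Dl antipode_lin]
  have we: "ext0 X w" by (simp add: w_def)
  have DSe: "ext0 X (\<lambda>x. if x \<in> carr X then D (?S x) else 0)" by (simp add: ext0_def)
  have DSl: "lin_map X T (\<lambda>x. if x \<in> carr X then D (?S x) else 0)"
    by (rule lin_map_cong[OF DS]) simp_all
  define v where "v = (\<lambda>x. if x \<in> carr X then D (?S x) else 0)"
  note vl = DSl[folded v_def] and ve = DSe[folded v_def]
  have inv: "conv X ?m (\<lambda>x. x) ?S = cunit X X ?u"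
    by (rule ext0_eqI[OF ext0_conv ext0_cunit]) (simp add: conv_apply cunit_def antipode_right)
  \<comment> \<open>The interchange turns the product into the pair of two copies of id * S, each of
    which is trivial. An antipode reverses coproducts in general; cocommutativity lets the
    unreversed \<open>w\<close> be the inverse.\<close>
  have Dw: "conv X M D w = I"
    unfolding D_def w_def M_def
      conv_tprod[OF vs vs vs vs vs vs mult_bilin mult_bilin cc lin_map_id lin_map_id antipode_lin antipode_lin] inv
      conv_cunit_left[OF cc tb vs vs Tv one_mem cunit_lin[OF cc vs one_mem] ext0_cunit]
    unfolding I_def
    by (rule comp_cunit[OF bilinD(2)[OF tb one_mem] vs one_mem])
  have Dmult: "D (?m a b) = M (D a) (D b)" if a: "a \<in> carr X" and b: "b \<in> carr X" for a b
  proof -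
    have "D (?m a b) = sw X ?t (?m a b)" unfolding D_def by (rule conv_apply) (simp add: a b)
    also have "\<dots> = sw X (\<lambda>a1 a2. sw X (\<lambda>b1 b2. ?t (?m a1 b1) (?m a2 b2)) b) a"
      by (rule cbilin_sw2[OF cc cc cc mult_cbilin tb Tv a b])
    also have "\<dots> = sw X (\<lambda>a1 a2. sw X (\<lambda>b1 b2. M (?t a1 a2) (?t b1 b2)) b) a"
      by (intro sw2_cong[OF cc] a b) (simp add: Mt)
    also have "\<dots> = sw X (\<lambda>a1 a2. M (?t a1 a2) (sw X ?t b)) a"
      by (rule sw2_cong[OF cc a]) (rule lin_sw2[OF bilinD(2)[OF Mb tm] Tv cc b tm, symmetric])
    also have "\<dots> = M (sw X ?t a) (sw X ?t b)"
      by (rule lin_sw2[OF bilinD(3)[OF Mb sw2_carr[OF cc b Tv tm]] Tv cc a tm, symmetric])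
    also have "\<dots> = M (D a) (D b)" by (simp add: D_def conv_apply a b)
    finally show ?thesis .
  qed
  have Du: "D ?u = ?t ?u ?u"
    unfolding D_def conv_apply[OF one_mem] using teq_bilin[OF one_grouplike(1) tb Tv] by (simp add: sw2_def)
  \<comment> \<open>As \<Delta> is multiplicative, \<Delta>(S(x1)) \<Delta>(x2) = \<Delta>(S(x1) x2)
    = \<epsilon>(x) 1 \<otimes> 1.\<close>
  have vD: "conv X M v D = I"
  proof (rule ext0_eqI[OF ext0_conv])
    show "ext0 X I" by (simp add: I_def)
    fix x assume x: "x \<in> carr X"
    note Sm = lin_mapD(1)[OF antipode_lin]
    have "conv X M v D x = sw X (\<lambda>a b. D (?m (?S a) b)) x"
      unfolding conv_apply[OF x] by (rule sw2_cong[OF cc x]) (simp add: v_def Dmult Sm)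
    also have "\<dots> = D (sw X (\<lambda>a b. ?m (?S a) b) x)"
      by (rule lin_sw2[OF Dl vs cc x, symmetric]) (simp add: Sm)
    also have "\<dots> = I x"
      using lin_mapD(3)[OF Dl one_mem] x by (simp add: antipode_left[OF x] Du I_def cunit_def)
    finally show "conv X M v D x = I x" .
  qed
  \<comment> \<open>Uniqueness of inverses: v = v * (D * w) = (v * D) * w = w.\<close>
  have "v = conv X M v I"
    unfolding I_def conv_cunit_right[OF cc Mb Tv Tv Tv u vl ve]
  proof
    fix x show "v x = M (v x) (?t ?u ?u)"
      using Mr[of "v x"] lin_mapD(1)[OF vl, of x] Mr[OF vspaceD(1)[OF Tv]] ve by (cases "x \<in> carr X") (auto simp: ext0_def)
  qed
  also have "\<dots> = conv X M (conv X M v D) w"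
    unfolding Dw[symmetric] by (rule conv_assoc[OF cc Tv Mb Mb Mb Mb Tv Tv vl Dl wl, symmetric]) (rule Ma)
  also have "\<dots> = w"
    unfolding vD I_def conv_cunit_left[OF cc Mb Tv Tv Tv u wl we]
  proof
    fix x show "M (?t ?u ?u) (w x) = w x"
      using Ml[of "w x"] lin_mapD(1)[OF wl, of x] Ml[OF vspaceD(1)[OF Tv]] we by (cases "x \<in> carr X") (auto simp: ext0_def)
  qed
  finally have vw: "v = w" .
  note Sm = lin_mapD(1)[OF antipode_lin]
  show ?thesis
  proof (rule cmapI[OF cc cc antipode_lin])
    fix b x assume b: "bilin X X field_space b" and x: "x \<in> carr X"
    \<comment> \<open>Applying the linear extension of the form \<open>b\<close> to the equality of
      tensors v = w gives the scalar test.\<close>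
    note el = ext_lin[OF vs b vspace_field_space, of undefined undefined, folded T_def]
    have "sw X ?t (?S x) = sw X (\<lambda>p q. ?t (?S p) (?S q)) x"
      using fun_cong[OF vw, of x] x by (simp add: v_def w_def D_def conv_apply Sm)
    then have "ext X X b (sw X ?t (?S x)) = ext X X b (sw X (\<lambda>p q. ?t (?S p) (?S q)) x)" by simp
    moreover have "ext X X b (sw X ?t (?S x)) = sw X (\<lambda>p q. ext X X b (?t p q)) (?S x)"
      by (rule lin_sw2[OF el Tv cc Sm[OF x]]) (rule tm)
    moreover have "\<dots> = sw X b (?S x)"
      by (rule sw2_cong[OF cc Sm[OF x]]) (rule ext_tens[OF b vspace_field_space])
    moreover have "ext X X b (sw X (\<lambda>p q. ?t (?S p) (?S q)) x) = sw X (\<lambda>p q. ext X X b (?t (?S p) (?S q))) x"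
      by (rule lin_sw2[OF el Tv cc x]) (intro tm Sm)
    moreover have "\<dots> = sw X (\<lambda>p q. b (?S p) (?S q)) x"
      by (rule sw2_cong[OF cc x]) (rule ext_tens[OF b vspace_field_space Sm Sm])
    ultimately show "sw X b (?S x) = sw X (\<lambda>p q. b (?S p) (?S q)) x" by simp
  next
    fix x assume x: "x \<in> carr X"
    have sm: "smul X (counit X q) p \<in> carr X" if "p \<in> carr X" for p q
      by (rule vspaceD(4)[OF vs that])
    \<comment> \<open>The computation is \<epsilon>(S(x)) = \<epsilon>(S(x1)) \<epsilon>(x2) =
      \<epsilon>(S(x1) x2) = \<epsilon>(x).\<close>
    have "counit X (?S x) = counit X (?S (sw X (\<lambda>p q. smul X (counit X q) p) x))"
      by (simp add: counit_right[OF cc x])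
    also have "\<dots> = sw X (\<lambda>p q. counit X (?S (smul X (counit X q) p))) x"
      by (rule lin_sw2[OF lin_map_comp[OF counit_lin[OF cc] antipode_lin] vs cc x sm])
    also have "\<dots> = sw X (\<lambda>p q. counit X (?m (?S p) q)) x"
      by (rule sw2_cong[OF cc x])
        (simp add: lin_mapD(3)[OF lin_map_comp[OF counit_lin[OF cc] antipode_lin]] counit_mult Sm mult.commute)
    also have "\<dots> = counit X (sw X (\<lambda>p q. ?m (?S p) q) x)"
      by (rule lin_sw2[OF counit_lin[OF cc] vs cc x, symmetric]) (simp add: Sm)
    also have "\<dots> = counit X x"
      using lin_mapD(3)[OF counit_lin[OF cc] one_mem] by (simp add: antipode_left[OF x] one_grouplike(2))
    finally show "counit X (?S x) = counit X x" .
  qed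
qed

context
  fixes C :: "('k, 'c::ab_group_add) hopf_alg"
  assumes C: "ccoalg C"
begin

lemma chom_mult: "chom C X f \<Longrightarrow> chom C X g \<Longrightarrow> chom C X (conv C (mult X) f g)"
  by (rule chom_conv[OF C cc cc cc mult_cbilin chom_cmap chom_cmap])

lemma chom_one: "chom C X (cunit C X (one_h X))"
  by (rule chom_cunit[OF C cc one_mem one_grouplike])

lemma chom_antipode: "chom C X f \<Longrightarrow> chom C X (\<lambda>c. antipode X (f c))"
  by (rule chom_comp[OF C cc cc _ antipode_cmap])

lemma conv_mult_assoc:
  "chom C X f \<Longrightarrow> chom C X g \<Longrightarrow> chom C X h \<Longrightarrow>
   conv C (mult X) (conv C (mult X) f g) h = conv C (mult X) f (conv C (mult X) g h)"
  by (rule conv_assoc[OF C vs mult_bilin mult_bilin mult_bilin mult_bilin vs vs])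
    (auto intro: chom_lin mult_assoc)

text \<open>Valid off the carrier of \<open>C\<close> as well, where the value is 0; laws of
  elements can therefore be used under a function abstraction without a case split.\<close>

lemma chom_mem: "chom C Y f \<Longrightarrow> vspace Y \<Longrightarrow> f c \<in> carr Y"
  by (cases "c \<in> carr C") (auto simp: chom_def cmap_def ext0_def vspaceD(1) dest: lin_mapD(1))

lemma chom_ext0: "chom C Y f \<Longrightarrow> ext0 C f"
  by (simp add: chom_def)

lemma conv_one_left: "chom C X f \<Longrightarrow> conv C (mult X) (cunit C X (one_h X)) f = f"
  by (subst conv_cunit_left[OF C mult_bilin vs vs vs one_mem]) (auto intro: chom_lin chom_ext0 simp: chom_mem)

lemma conv_one_right: "chom C X f \<Longrightarrow> conv C (mult X) f (cunit C X (one_h X)) = f"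
  by (subst conv_cunit_right[OF C mult_bilin vs vs vs one_mem]) (auto intro: chom_lin chom_ext0 simp: chom_mem)

lemma comp_cunit_chom:
  assumes f: "chom C X f" and w: "w \<in> carr X"
  shows "(\<lambda>c. cunit X X w (f c)) = cunit C X w"
proof
  fix c show "cunit X X w (f c) = cunit C X w c"
  proof (cases "c \<in> carr C")
    case True then show ?thesis using f chom_mem[OF f vs] by (simp add: cunit_def chom_def cmap_def)
  next
    case False
    then have "f c = 0" using f by (simp add: chom_def ext0_def)
    moreover have "counit X 0 = 0" by (rule lin_map_0[OF counit_lin[OF cc] vs])
    ultimately show ?thesis using False smul_0_left[OF vs w] by (simp add: cunit_def)
  qed
qed

text \<open>The antipode axiom is this equation at the tautological point; \<open>conv_chom\<close>
  transports it along \<open>f\<close>.\<close>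

lemma conv_inverse_left:
  assumes f: "chom C X f"
  shows "conv C (mult X) (\<lambda>c. antipode X (f c)) f = cunit C X (one_h X)"
proof -
  have "conv X (mult X) (antipode X) (\<lambda>x. x) = cunit X X (one_h X)"
    by (rule ext0_eqI[OF ext0_conv ext0_cunit]) (simp add: conv_apply cunit_def antipode_left)
  then show ?thesis
    using conv_chom[OF C cc mult_bilin vs antipode_lin lin_map_id f] comp_cunit_chom[OF f one_mem] by simp
qed

lemma conv_inverse_right:
  assumes f: "chom C X f"
  shows "conv C (mult X) f (\<lambda>c. antipode X (f c)) = cunit C X (one_h X)"
proof -
  have "conv X (mult X) (\<lambda>x. x) (antipode X) = cunit X X (one_h X)"
    by (rule ext0_eqI[OF ext0_conv ext0_cunit]) (simp add: conv_apply cunit_def antipode_right)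
  then show ?thesis
    using conv_chom[OF C cc mult_bilin vs lin_map_id antipode_lin f] comp_cunit_chom[OF f one_mem] by simp
qed

end

end

section \<open>Groups with a left and a right action\<close>

locale abs_group =
  fixes G :: "'a set" and m :: "'a \<Rightarrow> 'a \<Rightarrow> 'a" and e :: 'a and i :: "'a \<Rightarrow> 'a"
  assumes m_closed [simp]: "x \<in> G \<Longrightarrow> y \<in> G \<Longrightarrow> m x y \<in> G"
    and e_closed [simp]: "e \<in> G"
    and i_closed [simp]: "x \<in> G \<Longrightarrow> i x \<in> G"
    and assoc: "x \<in> G \<Longrightarrow> y \<in> G \<Longrightarrow> z \<in> G \<Longrightarrow> m (m x y) z = m x (m y z)"
    and e_left [simp]: "x \<in> G \<Longrightarrow> m e x = x"
    and e_right [simp]: "x \<in> G \<Longrightarrow> m x e = x"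
    and i_left [simp]: "x \<in> G \<Longrightarrow> m (i x) x = e"
    and i_right [simp]: "x \<in> G \<Longrightarrow> m x (i x) = e"
begin

lemma i_left2 [simp]: "x \<in> G \<Longrightarrow> y \<in> G \<Longrightarrow> m (i x) (m x y) = y"
  by (simp add: assoc[symmetric])

lemma i_right2 [simp]: "x \<in> G \<Longrightarrow> y \<in> G \<Longrightarrow> m x (m (i x) y) = y"
  by (simp add: assoc[symmetric])

lemma i_unique: "x \<in> G \<Longrightarrow> y \<in> G \<Longrightarrow> m x y = e \<Longrightarrow> y = i x"
  using i_left2[of x y] by simp

lemma i_m [simp]: "x \<in> G \<Longrightarrow> y \<in> G \<Longrightarrow> i (m x y) = m (i y) (i x)"
  by (rule i_unique[symmetric]) (simp_all add: assoc)

lemma i_e [simp]: "i e = e"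
  by (rule i_unique[symmetric]) simp_all

lemma idem_e: "x \<in> G \<Longrightarrow> m x x = x \<Longrightarrow> x = e"
  using i_left2[of x x] by simp

end

text \<open>The simplification rules bring every factor to the normal form h \<rhd> (a \<lhd> k),
  with one group element on either side. That the actions preserve inverses and neutral elements
  follows from multiplicativity.\<close>

locale bi_acted_group = A: abs_group GA mA eA iA + H: abs_group GH mH eH iH
  for GA :: "'a set" and mA (infixl "\<cdot>" 70) and eA iA and GH :: "'h set" and mH (infixl "\<star>" 70) and eH iH +
  fixes la :: "'h \<Rightarrow> 'a \<Rightarrow> 'a" (infixr "\<rhd>" 75) and ra :: "'a \<Rightarrow> 'h \<Rightarrow> 'a" (infixl "\<lhd>" 75)
  assumes la_closed [simp]: "h \<in> GH \<Longrightarrow> a \<in> GA \<Longrightarrow> h \<rhd> a \<in> GA"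
    and ra_closed [simp]: "h \<in> GH \<Longrightarrow> a \<in> GA \<Longrightarrow> a \<lhd> h \<in> GA"
    and la_la [simp]: "h \<in> GH \<Longrightarrow> k \<in> GH \<Longrightarrow> a \<in> GA \<Longrightarrow> h \<rhd> (k \<rhd> a) = (h \<star> k) \<rhd> a"
    and ra_ra [simp]: "h \<in> GH \<Longrightarrow> k \<in> GH \<Longrightarrow> a \<in> GA \<Longrightarrow> (a \<lhd> h) \<lhd> k = a \<lhd> (h \<star> k)"
    and la_e [simp]: "a \<in> GA \<Longrightarrow> eH \<rhd> a = a"
    and ra_e [simp]: "a \<in> GA \<Longrightarrow> a \<lhd> eH = a"
    and la_ra [simp]: "h \<in> GH \<Longrightarrow> k \<in> GH \<Longrightarrow> a \<in> GA \<Longrightarrow> (h \<rhd> a) \<lhd> k = h \<rhd> (a \<lhd> k)"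
    and la_m [simp]: "h \<in> GH \<Longrightarrow> a \<in> GA \<Longrightarrow> b \<in> GA \<Longrightarrow> h \<rhd> (a \<cdot> b) = (h \<rhd> a) \<cdot> (h \<rhd> b)"
    and ra_m [simp]: "h \<in> GH \<Longrightarrow> a \<in> GA \<Longrightarrow> b \<in> GA \<Longrightarrow> (a \<cdot> b) \<lhd> h = (a \<lhd> h) \<cdot> (b \<lhd> h)"
begin

lemma la_one [simp]: "h \<in> GH \<Longrightarrow> h \<rhd> eA = eA"
  using la_m[of h eA eA] by (intro A.idem_e) simp_all

lemma ra_one [simp]: "h \<in> GH \<Longrightarrow> eA \<lhd> h = eA"
  using ra_m[of h eA eA] by (intro A.idem_e) simp_all

lemma la_i: "h \<in> GH \<Longrightarrow> a \<in> GA \<Longrightarrow> iA (h \<rhd> a) = h \<rhd> iA a"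
  using la_m[of h a "iA a"] by (intro A.i_unique[symmetric]) simp_all

lemma ra_i: "h \<in> GH \<Longrightarrow> a \<in> GA \<Longrightarrow> iA (a \<lhd> h) = iA a \<lhd> h"
  using ra_m[of h a "iA a"] by (intro A.i_unique[symmetric]) simp_all

text \<open>The first component of \<open>B\<close>-bar at the pair (f, p). With the two inversions
  in place of \<open>R\<close> and \<open>B\<close> it is the first component of the inverse in the
  smash product, so \<open>rb_pair\<close> uses it in both roles.\<close>

definition twist :: "('a \<Rightarrow> 'a) \<Rightarrow> ('h \<Rightarrow> 'h) \<Rightarrow> 'a \<Rightarrow> 'h \<Rightarrow> 'a" where
  "twist R B f p = B p \<rhd> (R f \<lhd> B p)"

definition lr_mult :: "'a \<Rightarrow> 'h \<Rightarrow> 'a \<Rightarrow> 'h \<Rightarrow> 'a" where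
  "lr_mult a h b g = (a \<lhd> g) \<cdot> (h \<rhd> b)"

text \<open>The first component of the Rota-Baxter identity for \<open>B\<close>-bar at the points \<open>(f, p)\<close> and \<open>(g, q)\<close>;
  the second component is the Rota-Baxter identity of \<open>B\<close>.\<close>

definition rb_pair :: "('a \<Rightarrow> 'a) \<Rightarrow> ('h \<Rightarrow> 'h) \<Rightarrow> 'a \<Rightarrow> 'h \<Rightarrow> 'a \<Rightarrow> 'h \<Rightarrow> bool" where
  "rb_pair R B f p g q \<longleftrightarrow>
     lr_mult (twist R B f p) (B p) (twist R B g q) (B q) =
     twist R B (lr_mult (lr_mult (lr_mult f p (twist R B f p) (B p)) (p \<star> B p) g q) (p \<star> B p \<star> q)
                 (twist iA iH (twist R B f p) (B p)) (iH (B p)))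
       (p \<star> B p \<star> q \<star> iH (B p))"

section \<open>The Rota-Baxter identity for pairs, solved in the acted-on group\<close>

context
  fixes R B
  assumes R [simp]: "\<And>a. a \<in> GA \<Longrightarrow> R a \<in> GA" and B [simp]: "\<And>h. h \<in> GH \<Longrightarrow> B h \<in> GH"
    and rbB: "\<And>p q. p \<in> GH \<Longrightarrow> q \<in> GH \<Longrightarrow> B p \<star> B q = B (p \<star> B p \<star> q \<star> iH (B p))"
begin

text \<open>At p = q = 1 the conjugation cancels and the identity says that B(1) is
  idempotent.\<close>

lemma B_one [simp]: "B eH = eH"
  using rbB[of eH eH] by (intro H.idem_e) simp_all

text \<open>Both sides of \<open>rb_pair\<close> are of the form k \<rhd> x \<lhd> k with k = B p
  \<star> B q: on the left by pulling k out of both factors, on the right because \<open>rbB\<close>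
  evaluates \<open>B\<close> at the second component to k. Acting by k on both sides is
  injective.\<close>

lemma rb_pair_iff:
  assumes [simp]: "f \<in> GA" "g \<in> GA" "p \<in> GH" "q \<in> GH"
  shows "rb_pair R B f p g q \<longleftrightarrow>
    (iH (B q) \<rhd> R f) \<cdot> (R g \<lhd> iH (B p)) =
    R ((f \<lhd> (B p \<star> q \<star> iH (B p))) \<cdot> ((p \<star> B p) \<rhd> (R f \<lhd> (B p \<star> q \<star> iH (B p)))) \<cdot>
       ((p \<star> B p) \<rhd> (g \<lhd> iH (B p))) \<cdot> ((p \<star> B p \<star> q) \<rhd> iA (R f)))" (is "_ \<longleftrightarrow> ?l = R ?r")
proof -
  let ?k = "B p \<star> B q"
  have r [simp]: "?r \<in> GA" by simp
  have 1: "lr_mult (twist R B f p) (B p) (twist R B g q) (B q) = ?k \<rhd> (?l \<lhd> ?k)"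
    by (simp add: lr_mult_def twist_def H.assoc)
  have 2: "lr_mult (lr_mult (lr_mult f p (twist R B f p) (B p)) (p \<star> B p) g q) (p \<star> B p \<star> q)
                 (twist iA iH (twist R B f p) (B p)) (iH (B p)) = ?r"
    by (simp add: lr_mult_def twist_def la_i ra_i A.assoc H.assoc)
  have 3: "iH ?k \<rhd> ((?k \<rhd> (x \<lhd> ?k)) \<lhd> iH ?k) = x" if "x \<in> GA" for x
    using that by (simp add: H.assoc)
  have "rb_pair R B f p g q \<longleftrightarrow> ?k \<rhd> (?l \<lhd> ?k) = ?k \<rhd> (R ?r \<lhd> ?k)"
    unfolding rb_pair_def 1 2 by (simp only: twist_def rbB[symmetric] assms)
  also have "\<dots> \<longleftrightarrow> ?l = R ?r"
    using 3[of ?l] 3[of "R ?r"] R[OF r] by (metis A.m_closed H.i_closed R B assms la_closed ra_closed)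
  finally show ?thesis .
qed

lemma rb_pair_equiv:
  "(\<forall>f\<in>GA. \<forall>g\<in>GA. \<forall>p\<in>GH. \<forall>q\<in>GH. rb_pair R B f p g q) \<longleftrightarrow>
   (\<forall>f\<in>GA. \<forall>g\<in>GA. R f \<cdot> R g = R (f \<cdot> R f \<cdot> g \<cdot> iA (R f))) \<and>
   (\<forall>f\<in>GA. \<forall>g\<in>GA. \<forall>q\<in>GH. R (((f \<cdot> R f) \<lhd> q) \<cdot> g \<cdot> (q \<rhd> iA (R f))) = (iH (B q) \<rhd> R f) \<cdot> R g) \<and>
   (\<forall>g\<in>GA. \<forall>p\<in>GH. R (((p \<star> B p) \<rhd> g) \<lhd> iH (B p)) = R g \<lhd> iH (B p))"
  (is "?E \<longleftrightarrow> ?A \<and> ?C1 \<and> ?C2")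
proof
  assume E: ?E
  have A: ?A
  proof (intro ballI)
    fix f g assume [simp]: "f \<in> GA" "g \<in> GA"
    show "R f \<cdot> R g = R (f \<cdot> R f \<cdot> g \<cdot> iA (R f))"
      using E[rule_format, of f g eH eH] by (simp add: rb_pair_iff)
  qed
  moreover have ?C1
  proof (intro ballI)
    fix f g q assume [simp]: "f \<in> GA" "g \<in> GA" "q \<in> GH"
    show "R (((f \<cdot> R f) \<lhd> q) \<cdot> g \<cdot> (q \<rhd> iA (R f))) = (iH (B q) \<rhd> R f) \<cdot> R g"
      using E[rule_format, of f g eH q] by (simp add: rb_pair_iff)
  qed
  \<comment> \<open>R(1) is idempotent by the Rota-Baxter identity at (1, 1). At f = 1 this removes
    all factors R f from the pair identity and leaves the last condition.\<close>
  moreover have R1: "R eA = eA"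
    using A[rule_format, of eA eA] by (intro A.idem_e) simp_all
  have ?C2
  proof (intro ballI)
    fix g p assume [simp]: "g \<in> GA" "p \<in> GH"
    show "R (((p \<star> B p) \<rhd> g) \<lhd> iH (B p)) = R g \<lhd> iH (B p)"
      using E[rule_format, of eA g p eH] R1 by (simp add: rb_pair_iff)
  qed
  ultimately show "?A \<and> ?C1 \<and> ?C2" by blast
next
  assume "?A \<and> ?C1 \<and> ?C2"
  then have C1: ?C1 and C2: ?C2 by blast+
  show ?E
  proof (intro ballI)
    fix f g p q assume [simp]: "f \<in> GA" "g \<in> GA" "p \<in> GH" "q \<in> GH"
    define b where "b = B p"
    have [simp]: "b \<in> GH" by (simp add: b_def)
    define f' where "f' = (iH b \<star> iH p) \<rhd> (f \<lhd> b)"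
    have [simp]: "f' \<in> GA" by (simp add: f'_def)
    have f: "f = ((p \<star> b) \<rhd> f') \<lhd> iH b" by (simp add: f'_def H.assoc)
    have Rf: "R f = R f' \<lhd> iH b"
      using C2[rule_format, of f' p] f by (simp add: b_def)
    define c where "c = ((f' \<cdot> R f') \<lhd> q) \<cdot> g \<cdot> (q \<rhd> iA (R f'))"
    have [simp]: "c \<in> GA" by (simp add: c_def)
    \<comment> \<open>After substitution every factor carries p \<star> b on the left and the
      inverse of b on the right. In the first two factors the inverse of b that comes with f and R f
      cancels against the conjugate of q.\<close>
    have "(f \<lhd> (b \<star> q \<star> iH b)) \<cdot> ((p \<star> b) \<rhd> (R f \<lhd> (b \<star> q \<star> iH b))) \<cdot>
       ((p \<star> b) \<rhd> (g \<lhd> iH b)) \<cdot> ((p \<star> b \<star> q) \<rhd> iA (R f)) = ((p \<star> b) \<rhd> c) \<lhd> iH b"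
      unfolding Rf by (subst f) (simp add: c_def ra_i A.assoc H.assoc)
    then have "R ((f \<lhd> (b \<star> q \<star> iH b)) \<cdot> ((p \<star> b) \<rhd> (R f \<lhd> (b \<star> q \<star> iH b))) \<cdot>
       ((p \<star> b) \<rhd> (g \<lhd> iH b)) \<cdot> ((p \<star> b \<star> q) \<rhd> iA (R f))) = R c \<lhd> iH b"
      using C2[rule_format, of c p] by (simp add: b_def)
    also have "R c = (iH (B q) \<rhd> R f') \<cdot> R g" unfolding c_def using C1 by simp
    also have "\<dots> \<lhd> iH b = (iH (B q) \<rhd> R f) \<cdot> (R g \<lhd> iH b)" by (simp add: Rf)
    finally show "rb_pair R B f p g q" by (simp add: rb_pair_iff b_def)
  qed
qed

end

end

section \<open>The Rota-Baxter identity at generalized points\<close>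

lemma sw3_sw2: "sw3 D f x = sw2 D (\<lambda>u z. sw2 D (\<lambda>x y. f x y z) u) x"
  by (simp add: sw3_def sw2_def)

text \<open>One flip of the outer and one of the inner coproduct. It reconciles the antipode of the
  smash product, written with h3, h2, h1, with the order h1, h2, h3 in \<open>B\<close>-bar.\<close>

lemma sw3_reverse:
  assumes C: "ccoalg C" and F: "trilin C C C W F" and W: "vspace W" and x: "x \<in> carr C"
  shows "sw3 (comult C) (\<lambda>x y z. F z y x) x = sw3 (comult C) F x"
proof -
  have V: "vspace C" using C by simp
  have b: "bilin C C W (\<lambda>p u. sw C (F p) u)"
    by (auto intro!: bilinI sw2_lin[OF C] sw2_lin_param[OF C] W V trilinD[OF F])
  have "sw3 (comult C) F x = sw C (\<lambda>p u. sw C (\<lambda>q r. F p q r) u) x"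
    unfolding sw3_sw2 by (rule sw2_assoc[OF C F W x])
  also have "\<dots> = sw C (\<lambda>u p. sw C (\<lambda>q r. F p q r) u) x"
    by (rule sw2_flip[OF C b W x])
  also have "\<dots> = sw C (\<lambda>u p. sw C (\<lambda>r q. F p q r) u) x"
    by (rule sw2_cong[OF C x]) (rule sw2_flip[OF C trilinD(5)[OF F] W])
  finally show ?thesis by (simp add: sw3_sw2)
qed

text \<open>Translates a Sweedler formula in which h occurs twice into a nested convolution in which
  the point \<open>q\<close> occurs twice; this duplication is where \<open>q\<close> must be a
  coalgebra map.\<close>

lemma conv_split_right:
  assumes C: "ccoalg C" and H: "ccoalg H" and W: "vspace W" and X: "vspace X"
    and P: "bilin X H W P" and Q: "bilin A H X Q" and f: "lin_map C A f" and q: "chom C H q"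
    and eq: "\<And>a h. a \<in> carr A \<Longrightarrow> h \<in> carr H \<Longrightarrow> T a h = sw H (\<lambda>h1 h2. P (Q a h1) h2) h"
  shows "conv C T f q = conv C P (conv C Q f q) q"
proof (rule ext0_eqI[OF ext0_conv ext0_conv])
  fix c assume c: "c \<in> carr C"
  note ql = chom_lin[OF q]
  note m = lin_mapD(1)[OF f] lin_mapD(1)[OF ql]
  note T = trilin_comp[OF trilin_bilin_left[OF P Q] f ql ql]
  have "conv C P (conv C Q f q) q c = sw C (\<lambda>u z. sw C (\<lambda>x y. P (Q (f x) (q y)) (q z)) u) c"
    unfolding conv_apply[OF c]
    by (rule sw2_cong[OF C c]) (simp add: conv_apply, rule lin_sw2[OF bilinD(3)[OF P m(2)] X C _ bilinD(1)[OF Q m(1) m(2)]])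
  also have "\<dots> = sw C (\<lambda>x u. sw C (\<lambda>y z. P (Q (f x) (q y)) (q z)) u) c"
    by (rule sw2_assoc[OF C T W c])
  also have "\<dots> = conv C T f q c"
    unfolding conv_apply[OF c]
  proof (rule sw2_cong[OF C c])
    fix x y assume x: "x \<in> carr C" and y: "y \<in> carr C"
    have "bilin H H W (\<lambda>h1 h2. P (Q (f x) h1) h2)"
      by (rule bilin_comp[OF P bilinD(2)[OF Q m(1)[OF x]] lin_map_id])
    from cmap_sw2[OF chom_cmap[OF q] this W y]
    show "sw C (\<lambda>y z. P (Q (f x) (q y)) (q z)) y = T (f x) (q y)"
      by (simp add: eq[OF m(1)[OF x] m(2)[OF y]])
  qed
  finally show "conv C T f q c = conv C P (conv C Q f q) q c" ..
qed

text \<open>Evaluating the convolution of the two projections at a \<otimes> h returns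
  \<open>L a h\<close>, so equality at the universal pair is equality on all elements.\<close>

lemma bilin_eq_of_points:
  assumes U: "ccoalg U" and V: "ccoalg V" and W: "vspace W" and L: "bilin U V W L" and L': "bilin U V W L'"
    and eq: "conv (smash U V la ra) L (prL U V) (prR U V) = conv (smash U V la ra) L' (prL U V) (prR U V)"
    and a: "a \<in> carr U" and h: "h \<in> carr V"
  shows "L a h = L' a h"
  using conv_pr_tens[OF U V L W a h, of la ra] conv_pr_tens[OF U V L' W a h, of la ra] eq by simp

text \<open>The shape alpha(x1) y beta(x2) is common to the argument of the Rota-Baxter identity and
  to the arguments of \<open>R\<close> in both compatibility conditions.\<close>

lemma sandwich_bilin:
  assumes X: "ccoalg X" and Y: "vspace Y" and W: "vspace W"
    and P: "bilin Z V' W P" and Q: "bilin V Y Z Q" and alpha: "lin_map X V alpha" and beta: "lin_map X V' beta"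
  shows "bilin X Y W (\<lambda>x y. sw X (\<lambda>u z. P (Q (alpha u) y) (beta z)) x)"
proof (rule bilinI)
  have Xv: "vspace X" using X by simp
  have t: "bilin X X W (\<lambda>u z. P (Q (alpha u) y) (beta z))" if "y \<in> carr Y" for y
    by (rule bilin_comp[OF P lin_map_comp[OF bilinD(3)[OF Q that] alpha] beta])
  have t': "lin_map Y W (\<lambda>y. P (Q (alpha u) y) (beta z))" if "u \<in> carr X" "z \<in> carr X" for u z
    by (rule lin_map_comp[OF bilinD(3)[OF P lin_mapD(1)[OF beta that(2)]] bilinD(2)[OF Q lin_mapD(1)[OF alpha that(1)]]])
  show "lin_map Y W (\<lambda>y. sw X (\<lambda>u z. P (Q (alpha u) y) (beta z)) x)" if "x \<in> carr X" for x
    by (rule sw2_lin_param[OF X that Y W t'])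
  show "lin_map X W (\<lambda>x. sw X (\<lambda>u z. P (Q (alpha u) y) (beta z)) x)" if "y \<in> carr Y" for y
    by (rule sw2_lin[OF X t[OF that] W])
qed

text \<open>The repeated variable x stands first, while \<open>conv_split_right\<close> duplicates
  the second argument; hence one flip before and one after the splitting.\<close>

lemma conv_sandwich:
  assumes C: "ccoalg C" and X: "ccoalg X" and v: "vspace Y" "vspace Z" "vspace W"
    and P: "bilin Z V' W P" and Q: "bilin V Y Z Q" and alpha: "lin_map X V alpha" and beta: "lin_map X V' beta"
    and F: "chom C X F" and G: "lin_map C Y G"
    and T: "\<And>x y. x \<in> carr X \<Longrightarrow> y \<in> carr Y \<Longrightarrow> T x y = sw X (\<lambda>u z. P (Q (alpha u) y) (beta z)) x"
  shows "conv C T F G = conv C P (conv C Q (\<lambda>c. alpha (F c)) G) (\<lambda>c. beta (F c))"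
proof -
  let ?T = "\<lambda>x y. sw X (\<lambda>u z. P (Q (alpha u) y) (beta z)) x"
  note m = lin_mapD(1)[OF chom_lin[OF F]] lin_mapD(1)[OF G]
  have Q': "bilin Y X Z (\<lambda>y u. Q (alpha u) y)" by (rule bilin_flip[OF bilin_comp[OF Q alpha lin_map_id]])
  have "conv C T F G = conv C ?T F G"
    by (rule conv_cong[OF C refl refl]) (rule T[OF m])
  also have "\<dots> = conv C (\<lambda>y x. ?T x y) G F"
    by (rule conv_flip[OF C sandwich_bilin[OF X v(1,3) P Q alpha beta] v(3) chom_lin[OF F] G])
  also have "\<dots> = conv C (\<lambda>z w. P z (beta w)) (conv C (\<lambda>y u. Q (alpha u) y) G F) F"
    by (rule conv_split_right[OF C X v(3,2) bilin_comp[OF P lin_map_id beta] Q' G F]) (rule refl)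
  also have "conv C (\<lambda>y u. Q (alpha u) y) G F = conv C (\<lambda>u y. Q (alpha u) y) F G"
    by (rule conv_flip[OF C Q' v(2) G chom_lin[OF F]])
  finally show ?thesis by (simp add: conv_def)
qed

definition rb_arg :: "('k::field, 'x::ab_group_add) hopf_alg \<Rightarrow> ('x \<Rightarrow> 'x) \<Rightarrow> 'x \<Rightarrow> 'x \<Rightarrow> 'x" where
  "rb_arg X B x y = sw3 (comult X) (\<lambda>x1 x2 x3. mult X (mult X (mult X x1 (B x2)) y) (antipode X (B x3))) x"

definition rb_points :: "('k::field, 'c::ab_group_add) hopf_alg \<Rightarrow> ('k, 'x::ab_group_add) hopf_alg \<Rightarrow> ('x \<Rightarrow> 'x) \<Rightarrow> bool" where
  "rb_points C X B \<longleftrightarrow> (\<forall>F G. chom C X F \<longrightarrow> chom C X G \<longrightarrow>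
    conv C (mult X) (\<lambda>c. B (F c)) (\<lambda>c. B (G c)) =
    (\<lambda>c. B (conv C (mult X) (conv C (mult X) (conv C (mult X) F (\<lambda>c. B (F c))) G) (\<lambda>c. antipode X (B (F c))) c)))"

section \<open>The Rota-Baxter identity on elements and on points\<close>

context
  fixes X :: "('k::field, 'x::ab_group_add) hopf_alg" and B
  assumes X: "ccoalg X" and mX: "bilin X X X (mult X)" and SX: "lin_map X X (antipode X)" and B: "lin_map X X B"
begin

private lemma Xv: "vspace X" using X by simp

private lemma S_B: "lin_map X X (\<lambda>x. antipode X (B x))"
  by (rule lin_map_comp[OF SX B])

text \<open>The left half x1 B(x2) of the argument, which exhibits \<open>rb_arg\<close> as a
  sandwich.\<close>

private definition mu where "mu = conv X (mult X) (\<lambda>x. x) B"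

private lemma mu_lin: "lin_map X X mu"
  unfolding mu_def by (rule conv_lin[OF X mX Xv lin_map_id B])

private lemma rb_arg_mu:
  assumes x: "x \<in> carr X" and y: "y \<in> carr X"
  shows "rb_arg X B x y = sw X (\<lambda>u z. mult X (mult X (mu u) y) (antipode X (B z))) x"
  unfolding rb_arg_def sw3_sw2
proof (rule sw2_cong[OF X x])
  fix u z assume u: "u \<in> carr X" and z: "z \<in> carr X"
  have l: "lin_map X X (\<lambda>v. mult X (mult X v y) (antipode X (B z)))"
    by (rule lin_map_comp[OF bilinD(3)[OF mX lin_mapD(1)[OF S_B z]] bilinD(3)[OF mX y]])
  show "sw X (\<lambda>a b. mult X (mult X (mult X a (B b)) y) (antipode X (B z))) u =
    mult X (mult X (mu u) y) (antipode X (B z))"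
    unfolding mu_def conv_apply[OF u]
    by (rule lin_sw2[OF l Xv X u, symmetric]) (rule bilinD(1)[OF mX], assumption, rule lin_mapD(1)[OF B])
qed

lemma rb_arg_bilin: "bilin X X X (rb_arg X B)"
proof (rule bilinI)
  note b = sandwich_bilin[OF X Xv Xv mX mX mu_lin S_B]
  fix u assume u: "u \<in> carr X"
  show "lin_map X X (rb_arg X B u)"
    by (rule lin_map_cong[OF bilinD(2)[OF b u] Xv rb_arg_mu[OF u]])
  show "lin_map X X (\<lambda>x. rb_arg X B x u)"
    by (rule lin_map_cong[OF bilinD(3)[OF b u] Xv rb_arg_mu[OF _ u]])
qed

context
  fixes C :: "('k, 'c::ab_group_add) hopf_alg"
  assumes C: "ccoalg C"
begin

lemma conv_rb_arg:
  assumes F: "chom C X F" and G: "lin_map C X G"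
  shows "conv C (rb_arg X B) F G =
    conv C (mult X) (conv C (mult X) (conv C (mult X) F (\<lambda>c. B (F c))) G) (\<lambda>c. antipode X (B (F c)))"
proof -
  have "conv C (rb_arg X B) F G = conv C (mult X) (conv C (mult X) (\<lambda>c. mu (F c)) G) (\<lambda>c. antipode X (B (F c)))"
    by (rule conv_sandwich[OF C X Xv Xv Xv mX mX mu_lin S_B F G]) (rule rb_arg_mu)
  also have "(\<lambda>c. mu (F c)) = conv C (mult X) F (\<lambda>c. B (F c))"
    unfolding mu_def by (rule conv_chom[OF C X mX Xv lin_map_id B F])
  finally show ?thesis .
qed

lemma rb_points_of_elements:
  assumes "\<forall>x\<in>carr X. \<forall>y\<in>carr X. mult X (B x) (B y) = B (rb_arg X B x y)"
  shows "rb_points C X B"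
  unfolding rb_points_def
proof (intro allI impI)
  fix F G assume F: "chom C X F" and G: "chom C X G"
  note m = lin_mapD(1)[OF chom_lin[OF F]] lin_mapD(1)[OF chom_lin[OF G]]
  have "conv C (mult X) (\<lambda>c. B (F c)) (\<lambda>c. B (G c)) = conv C (\<lambda>x y. mult X (B x) (B y)) F G"
    by (simp add: conv_def)
  also have "\<dots> = conv C (\<lambda>x y. B (rb_arg X B x y)) F G"
    by (rule conv_cong[OF C refl refl]) (use assms m in blast)
  also have "\<dots> = (\<lambda>c. B (conv C (rb_arg X B) F G c))"
    by (rule conv_comp_lin[OF C rb_arg_bilin Xv chom_lin[OF F] chom_lin[OF G] B, symmetric])
  finally show "conv C (mult X) (\<lambda>c. B (F c)) (\<lambda>c. B (G c)) =
    (\<lambda>c. B (conv C (mult X) (conv C (mult X) (conv C (mult X) F (\<lambda>c. B (F c))) G) (\<lambda>c. antipode X (B (F c))) c))"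
    by (simp only: conv_rb_arg[OF F chom_lin[OF G]])
qed

end

text \<open>The universal pair over X \<otimes> X. Since the surrounding context assumes just a
  coalgebra with bilinear product and linear antipode, the result applies to the smash product
  without a proof of its Hopf algebra axioms.\<close>

lemma rb_elements_of_points:
  assumes p: "rb_points (smash X X la ra) X B" and x: "x \<in> carr X" and y: "y \<in> carr X"
  shows "mult X (B x) (B y) = B (rb_arg X B x y)"
proof -
  let ?C = "smash X X la ra"
  have C: "ccoalg ?C" by (rule ccoalg_smash[OF X X])
  note F = chom_prL[OF X X, of la ra] and G = chom_prR[OF X X, of la ra]
  show ?thesis
  proof (rule bilin_eq_of_points[OF X X Xv bilin_comp[OF mX B B] bilin_lin_comp[OF B rb_arg_bilin] _ x y])
    have "conv ?C (\<lambda>x y. B (rb_arg X B x y)) (prL X X) (prR X X) = (\<lambda>c. B (conv ?C (rb_arg X B) (prL X X) (prR X X) c))"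
      by (rule conv_comp_lin[OF C rb_arg_bilin Xv chom_lin[OF F] chom_lin[OF G] B, symmetric])
    also have "\<dots> = conv ?C (mult X) (\<lambda>c. B (prL X X c)) (\<lambda>c. B (prR X X c))"
      unfolding conv_rb_arg[OF C F chom_lin[OF G]] using p F G unfolding rb_points_def by simp
    finally show "conv ?C (\<lambda>x y. mult X (B x) (B y)) (prL X X) (prR X X) =
      conv ?C (\<lambda>x y. B (rb_arg X B x y)) (prL X X) (prR X X)"
      by (simp add: conv_def)
  qed
qed

end

lemma rb_op_iff:
  "rb_op X B \<longleftrightarrow> cmap X X B \<and> (\<forall>x\<in>carr X. \<forall>y\<in>carr X. mult X (B x) (B y) = B (rb_arg X B x y))"
  by (simp add: rb_op_def coalg_map_iff rb_arg_def)

section \<open>The L-R smash product\<close>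

locale lr_smash = A: cc_hopf A + H: cc_hopf H
  for A :: "('k::field, 'a::ab_group_add) hopf_alg" and H :: "('k, 'h::ab_group_add) hopf_alg" +
  fixes la :: "'h \<Rightarrow> 'a \<Rightarrow> 'a" and ra :: "'a \<Rightarrow> 'h \<Rightarrow> 'a"
  assumes bimod: "bimod_hopf A H la ra"
begin

lemma la_bilin: "bilin H A A la" and ra_bilin: "bilin A H A ra"
  using bimod by (simp_all add: bimod_hopf_def bilin_def lin_map_def)

lemma la_mem [simp]: "h \<in> carr H \<Longrightarrow> a \<in> carr A \<Longrightarrow> la h a \<in> carr A"
  and ra_mem [simp]: "h \<in> carr H \<Longrightarrow> a \<in> carr A \<Longrightarrow> ra a h \<in> carr A"
  using bimod by (simp_all add: bimod_hopf_def)

lemma la_mult_H: "h \<in> carr H \<Longrightarrow> g \<in> carr H \<Longrightarrow> a \<in> carr A \<Longrightarrow> la (mult H h g) a = la h (la g a)"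
  and ra_mult_H: "h \<in> carr H \<Longrightarrow> g \<in> carr H \<Longrightarrow> a \<in> carr A \<Longrightarrow> ra a (mult H h g) = ra (ra a h) g"
  and la_one: "a \<in> carr A \<Longrightarrow> la (one_h H) a = a"
  and ra_one: "a \<in> carr A \<Longrightarrow> ra a (one_h H) = a"
  and ra_la: "h \<in> carr H \<Longrightarrow> g \<in> carr H \<Longrightarrow> a \<in> carr A \<Longrightarrow> ra (la h a) g = la h (ra a g)"
  and la_mult: "h \<in> carr H \<Longrightarrow> a \<in> carr A \<Longrightarrow> b \<in> carr A \<Longrightarrow>
    la h (mult A a b) = sw H (\<lambda>h1 h2. mult A (la h1 a) (la h2 b)) h"
  and ra_mult: "h \<in> carr H \<Longrightarrow> a \<in> carr A \<Longrightarrow> b \<in> carr A \<Longrightarrow>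
    ra (mult A a b) h = sw H (\<lambda>h1 h2. mult A (ra a h1) (ra b h2)) h"
  using bimod unfolding bimod_hopf_def by blast+

lemma la_cbilin: "cbilin H A A la"
  unfolding cbilin_def
proof (intro conjI ballI allI impI la_bilin)
  fix h a assume h: "h \<in> carr H" and a: "a \<in> carr A"
  show "counit A (la h a) = counit H h * counit A a"
    using bimod h a by (simp add: bimod_hopf_def mult.commute)
  fix w assume w: "bilin A A field_space w"
  have t: "teq A A (comult A (la h a)) [(la h1 a1, la h2 a2). (h1, h2) \<leftarrow> comult H h, (a1, a2) \<leftarrow> comult A a]"
    using bimod h a unfolding bimod_hopf_def by blast
  show "sw A w (la h a) = sw H (\<lambda>u1 u2. sw A (\<lambda>v1 v2. w (la u1 v1) (la u2 v2)) a) h"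
    using teq_bilin[OF t w vspace_field_space] by (simp add: sw2_def case_prod_beta' sum_list_map_concat o_def)
qed

lemma ra_cbilin: "cbilin A H A ra"
  unfolding cbilin_def
proof (intro conjI ballI allI impI ra_bilin)
  fix h a assume h: "h \<in> carr H" and a: "a \<in> carr A"
  show "counit A (ra a h) = counit A a * counit H h"
    using bimod h a by (simp add: bimod_hopf_def)
  fix w assume w: "bilin A A field_space w"
  have t: "teq A A (comult A (ra a h)) [(ra a1 h1, ra a2 h2). (h1, h2) \<leftarrow> comult H h, (a1, a2) \<leftarrow> comult A a]"
    using bimod h a unfolding bimod_hopf_def by blast
  have "sw A w (ra a h) = sw H (\<lambda>v1 v2. sw A (\<lambda>u1 u2. w (ra u1 v1) (ra u2 v2)) a) h"
    using teq_bilin[OF t w vspace_field_space] by (simp add: sw2_def case_prod_beta' sum_list_map_concat o_def)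
  then show "sw A w (ra a h) = sw A (\<lambda>u1 u2. sw H (\<lambda>v1 v2. w (ra u1 v1) (ra u2 v2)) h) a"
    by (rule trans) (rule sw2_swap)
qed

text \<open>Module and bimodule laws are instances of \<open>conv_assoc\<close>, and
  multiplicativity of the actions is \<open>conv_distrib_left\<close>. The right action is first
  flipped so that the acting point comes first.\<close>

lemma points_bi_acted_group:
  assumes C: "ccoalg C"
  shows "bi_acted_group {f. chom C A f} (conv C (mult A)) (cunit C A (one_h A)) (\<lambda>f c. antipode A (f c))
    {p. chom C H p} (conv C (mult H)) (cunit C H (one_h H)) (\<lambda>p c. antipode H (p c)) (conv C la) (conv C ra)"
proof (unfold_locales; (unfold mem_Collect_eq)?)
  note [simp] = A.chom_mult[OF C] H.chom_mult[OF C] A.chom_one[OF C] H.chom_one[OF C] A.chom_antipode[OF C] H.chom_antipode[OF C]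
    A.conv_one_left[OF C] H.conv_one_left[OF C] A.conv_one_right[OF C] H.conv_one_right[OF C]
    A.conv_inverse_left[OF C] H.conv_inverse_left[OF C] A.conv_inverse_right[OF C] H.conv_inverse_right[OF C]
    A.conv_mult_assoc[OF C] H.conv_mult_assoc[OF C]
  {
    fix x y z
    show "chom C A x \<Longrightarrow> chom C A y \<Longrightarrow> chom C A (conv C (mult A) x y)"
      "chom C A (cunit C A (one_h A))"
      "chom C A x \<Longrightarrow> chom C A (\<lambda>c. antipode A (x c))"
      "chom C A x \<Longrightarrow> chom C A y \<Longrightarrow> chom C A z \<Longrightarrow>
        conv C (mult A) (conv C (mult A) x y) z = conv C (mult A) x (conv C (mult A) y z)"
      "chom C A x \<Longrightarrow> conv C (mult A) (cunit C A (one_h A)) x = x"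
      "chom C A x \<Longrightarrow> conv C (mult A) x (cunit C A (one_h A)) = x"
      "chom C A x \<Longrightarrow> conv C (mult A) (\<lambda>c. antipode A (x c)) x = cunit C A (one_h A)"
      "chom C A x \<Longrightarrow> conv C (mult A) x (\<lambda>c. antipode A (x c)) = cunit C A (one_h A)"
      by simp_all
  }
  {
    fix x y z
    show "chom C H x \<Longrightarrow> chom C H y \<Longrightarrow> chom C H (conv C (mult H) x y)"
      "chom C H (cunit C H (one_h H))"
      "chom C H x \<Longrightarrow> chom C H (\<lambda>c. antipode H (x c))"
      "chom C H x \<Longrightarrow> chom C H y \<Longrightarrow> chom C H z \<Longrightarrow>
        conv C (mult H) (conv C (mult H) x y) z = conv C (mult H) x (conv C (mult H) y z)"
      "chom C H x \<Longrightarrow> conv C (mult H) (cunit C H (one_h H)) x = x"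
      "chom C H x \<Longrightarrow> conv C (mult H) x (cunit C H (one_h H)) = x"
      "chom C H x \<Longrightarrow> conv C (mult H) (\<lambda>c. antipode H (x c)) x = cunit C H (one_h H)"
      "chom C H x \<Longrightarrow> conv C (mult H) x (\<lambda>c. antipode H (x c)) = cunit C H (one_h H)"
      by simp_all
  }
  fix h a assume h: "chom C H h" and a: "chom C A a"
  note al = chom_lin[OF a] and hl = chom_lin[OF h]
  show "chom C A (conv C la h a)" by (rule chom_conv[OF C H.cc A.cc A.cc la_cbilin chom_cmap[OF h] chom_cmap[OF a]])
  show "chom C A (conv C ra a h)" by (rule chom_conv[OF C A.cc H.cc A.cc ra_cbilin chom_cmap[OF a] chom_cmap[OF h]])
  {
    fix k assume k: "chom C H k"
    note kl = chom_lin[OF k]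
    show "conv C la h (conv C la k a) = conv C la (conv C (mult H) h k) a"
      by (rule conv_assoc[OF C A.vs la_bilin H.mult_bilin la_bilin la_bilin H.vs A.vs hl kl al, symmetric]) (rule la_mult_H)
    show "conv C ra (conv C ra a h) k = conv C ra a (conv C (mult H) h k)"
      by (rule conv_assoc[OF C A.vs ra_bilin ra_bilin ra_bilin H.mult_bilin A.vs H.vs al hl kl]) (simp add: ra_mult_H)
    show "conv C ra (conv C la h a) k = conv C la h (conv C ra a k)"
      by (rule conv_assoc[OF C A.vs ra_bilin la_bilin la_bilin ra_bilin A.vs A.vs hl al kl]) (simp add: ra_la)
  }
  {
    fix b assume b: "chom C A b"
    note bl = chom_lin[OF b]
    show "conv C la h (conv C (mult A) a b) = conv C (mult A) (conv C la h a) (conv C la h b)"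
      by (rule conv_distrib_left[OF C H.cc A.vs A.vs la_bilin A.mult_bilin A.mult_bilin la_bilin la_bilin A.vs A.vs chom_cmap[OF h] al bl])
        (rule la_mult)
    have "conv C ra (conv C (mult A) a b) h = conv C (\<lambda>h a. ra a h) h (conv C (mult A) a b)"
      by (rule conv_flip[OF C ra_bilin A.vs conv_lin[OF C A.mult_bilin A.vs al bl] hl])
    also have "\<dots> = conv C (mult A) (conv C (\<lambda>h a. ra a h) h a) (conv C (\<lambda>h a. ra a h) h b)"
      by (rule conv_distrib_left[OF C H.cc A.vs A.vs bilin_flip[OF ra_bilin] A.mult_bilin A.mult_bilin bilin_flip[OF ra_bilin]
          bilin_flip[OF ra_bilin] A.vs A.vs chom_cmap[OF h] al bl])
        (rule ra_mult)
    also have "\<dots> = conv C (mult A) (conv C ra a h) (conv C ra b h)"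
      by (simp only: conv_flip[OF C ra_bilin A.vs al hl] conv_flip[OF C ra_bilin A.vs bl hl])
    finally show "conv C ra (conv C (mult A) a b) h = conv C (mult A) (conv C ra a h) (conv C ra b h)" .
  }
next
  fix a assume a: "chom C A a"
  note al = chom_lin[OF a] and m = A.chom_mem[OF C a A.vs]
  show "conv C la (cunit C H (one_h H)) a = a"
    unfolding conv_cunit_left[OF C la_bilin H.vs A.vs A.vs H.one_mem al A.chom_ext0[OF C a]] by (simp add: la_one m)
  show "conv C ra a (cunit C H (one_h H)) = a"
    unfolding conv_cunit_right[OF C ra_bilin A.vs H.vs A.vs H.one_mem al A.chom_ext0[OF C a]] by (simp add: ra_one m)
qed

section \<open>The product, the antipode and maps of the shape of \<open>B\<close>-bar on the smash
  product\<close>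

abbreviation E where "E \<equiv> smash A H la ra"
abbreviation pair where "pair \<equiv> tens A H"

lemma E_cc: "ccoalg E"
  by (rule ccoalg_smash[OF A.cc H.cc])

lemma E_vs: "vspace E"
  by simp

lemma pair_bilin: "bilin A H E pair"
  by (rule tens_bilin[OF A.vs H.vs])

lemma pair_mem: "a \<in> carr A \<Longrightarrow> h \<in> carr H \<Longrightarrow> pair a h \<in> carr E"
  by (rule bilinD(1)[OF pair_bilin])

text \<open>The smash product factors through \<open>rho\<close>, which sees only a and g, and
  \<open>lam\<close>, which sees only h and b. In \<open>mE\<close> the second components are
  multiplied in reverse, because g comes with the first factor and h with the second, while the
  result contains h2 g1.\<close>

definition rho where "rho a g = sw H (\<lambda>g1 g2. pair (ra a g1) g2) g"
definition lam where "lam h b = sw H (\<lambda>h1 h2. pair (la h1 b) h2) h"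
definition mE where "mE = tprod A H A H A H (mult A) (\<lambda>x y. mult H y x)"

lemma rho_bilin: "bilin A H E rho" and lam_bilin: "bilin H A E lam"
proof -
  have 1: "bilin H H E (\<lambda>g1 g2. pair (ra a g1) g2)" if "a \<in> carr A" for a
    by (rule bilin_comp[OF pair_bilin bilinD(2)[OF ra_bilin that] lin_map_id])
  have 2: "bilin H H E (\<lambda>g1 g2. pair (la g1 a) g2)" if "a \<in> carr A" for a
    by (rule bilin_comp[OF pair_bilin bilinD(3)[OF la_bilin that] lin_map_id])
  have 3: "lin_map A E (\<lambda>a. pair (ra a g1) g2)" "lin_map A E (\<lambda>a. pair (la g1 a) g2)"
    if "g1 \<in> carr H" "g2 \<in> carr H" for g1 g2
    using that by (auto intro!: lin_map_comp[OF bilinD(3)[OF pair_bilin]] bilinD(3)[OF ra_bilin] bilinD(2)[OF la_bilin])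
  show "bilin A H E rho" unfolding rho_def[abs_def]
    by (rule bilinI) (auto intro!: sw2_lin[OF H.cc 1 E_vs] sw2_lin_param[OF H.cc _ A.vs E_vs] 3)
  show "bilin H A E lam" unfolding lam_def[abs_def]
    by (rule bilinI) (auto intro!: sw2_lin[OF H.cc 2 E_vs] sw2_lin_param[OF H.cc _ A.vs E_vs] 3)
qed

lemma mE_bilin: "bilin E E E mE"
  unfolding mE_def by (rule tprod_bilin[OF A.vs H.vs A.vs H.vs A.vs H.vs A.mult_bilin bilin_flip[OF H.mult_bilin]])

lemma mE_pair: "a \<in> carr A \<Longrightarrow> h \<in> carr H \<Longrightarrow> b \<in> carr A \<Longrightarrow> g \<in> carr H \<Longrightarrow>
    mE (pair a h) (pair b g) = pair (mult A a b) (mult H g h)"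
  unfolding mE_def by (rule tprod_tens[OF A.vs H.vs A.vs H.vs A.vs H.vs A.mult_bilin bilin_flip[OF H.mult_bilin]])

definition mult4 where
  "mult4 a h b g = sw H (\<lambda>h1 h2. sw H (\<lambda>g1 g2. pair (mult A (ra a g2) (la h1 b)) (mult H h2 g1)) g) h"

text \<open>Cocommutativity exchanges g1 and g2, after which the sum splits into a part over g and a
  part over h. Linearity in each argument and the formula for points are read off from this
  factorization.\<close>

lemma mult4_eq:
  assumes a: "a \<in> carr A" and h: "h \<in> carr H" and b: "b \<in> carr A" and g: "g \<in> carr H"
  shows "mult4 a h b g = mE (rho a g) (lam h b)"
proof -
  have p: "bilin H H E (\<lambda>g1 g2. pair (mult A (ra a g2) (la h1 b)) (mult H h2 g1))"
    if "h1 \<in> carr H" "h2 \<in> carr H" for h1 h2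
    using that a b
    by (intro bilinI lin_map_comp[OF bilinD(3)[OF pair_bilin]] lin_map_comp[OF bilinD(2)[OF pair_bilin]]
      lin_map_comp[OF bilinD(3)[OF A.mult_bilin]] bilinD(2)[OF ra_bilin] bilinD(2)[OF H.mult_bilin]) auto
  note pm = pair_mem and rm = bilinD(1)[OF rho_bilin a g]
  have "mult4 a h b g = sw H (\<lambda>h1 h2. sw H (\<lambda>g1 g2. pair (mult A (ra a g1) (la h1 b)) (mult H h2 g2)) g) h"
    unfolding mult4_def by (rule sw2_cong[OF H.cc h]) (rule sw2_flip[OF H.cc p E_vs g])
  also have "\<dots> = sw H (\<lambda>h1 h2. sw H (\<lambda>g1 g2. mE (pair (ra a g1) g2) (pair (la h1 b) h2)) g) h"
    by (intro sw2_cong[OF H.cc] h g) (simp add: mE_pair a b)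
  also have "\<dots> = sw H (\<lambda>h1 h2. mE (rho a g) (pair (la h1 b) h2)) h"
    unfolding rho_def
    by (rule sw2_cong[OF H.cc h], rule lin_sw2[OF bilinD(3)[OF mE_bilin] E_vs H.cc g, symmetric]) (simp_all add: pm a b tens_mem)
  also have "\<dots> = mE (rho a g) (lam h b)"
    unfolding lam_def
    by (rule lin_sw2[OF bilinD(2)[OF mE_bilin rm] E_vs H.cc h, symmetric]) (simp add: b tens_mem)
  finally show ?thesis .
qed

lemma mult_E: "mult E t s = ext A H (\<lambda>a h. ext A H (\<lambda>b g. mult4 a h b g) s) t"
  by (simp add: smash_def ext_def mult4_def)

lemma
  shows mult4_lin1: "\<And>h b g. h \<in> carr H \<Longrightarrow> b \<in> carr A \<Longrightarrow> g \<in> carr H \<Longrightarrow> lin_map A E (\<lambda>a. mult4 a h b g)"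
    and mult4_lin2: "\<And>a b g. a \<in> carr A \<Longrightarrow> b \<in> carr A \<Longrightarrow> g \<in> carr H \<Longrightarrow> lin_map H E (\<lambda>h. mult4 a h b g)"
    and mult4_lin3: "\<And>a h g. a \<in> carr A \<Longrightarrow> h \<in> carr H \<Longrightarrow> g \<in> carr H \<Longrightarrow> lin_map A E (\<lambda>b. mult4 a h b g)"
    and mult4_lin4: "\<And>a h b. a \<in> carr A \<Longrightarrow> h \<in> carr H \<Longrightarrow> b \<in> carr A \<Longrightarrow> lin_map H E (\<lambda>g. mult4 a h b g)"
proof -
  note l = lin_map_comp[OF bilinD(3)[OF mE_bilin]] lin_map_comp[OF bilinD(2)[OF mE_bilin]] bilinD[OF rho_bilin] bilinD[OF lam_bilin]
  show "lin_map A E (\<lambda>a. mult4 a h b g)" if "h \<in> carr H" "b \<in> carr A" "g \<in> carr H" for h b g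
    by (rule lin_map_cong[of A E "\<lambda>a. mE (rho a g) (lam h b)"]) (use that in \<open>auto intro!: l simp: mult4_eq\<close>)
  show "lin_map H E (\<lambda>h. mult4 a h b g)" if "a \<in> carr A" "b \<in> carr A" "g \<in> carr H" for a b g
    by (rule lin_map_cong[of H E "\<lambda>h. mE (rho a g) (lam h b)"]) (use that in \<open>auto intro!: l simp: mult4_eq\<close>)
  show "lin_map A E (\<lambda>b. mult4 a h b g)" if "a \<in> carr A" "h \<in> carr H" "g \<in> carr H" for a h g
    by (rule lin_map_cong[of A E "\<lambda>b. mE (rho a g) (lam h b)"]) (use that in \<open>auto intro!: l simp: mult4_eq\<close>)
  show "lin_map H E (\<lambda>g. mult4 a h b g)" if "a \<in> carr A" "h \<in> carr H" "b \<in> carr A" for a h b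
    by (rule lin_map_cong[of H E "\<lambda>g. mE (rho a g) (lam h b)"]) (use that in \<open>auto intro!: l simp: mult4_eq\<close>)
qed

lemma mult4_trilin: "trilin A H E E (\<lambda>a h s. ext A H (\<lambda>b g. mult4 a h b g) s)"
  by (auto intro!: trilinI ext_lin[OF A.vs bilinI E_vs] ext_lin_param[OF _ _ E_vs] mult4_lin1 mult4_lin2 mult4_lin3 mult4_lin4)

lemma mult_E_bilin: "bilin E E E (mult E)"
  using ext_bilin[OF A.vs E_vs E_vs mult4_trilin, of la ra] by (simp add: mult_E[abs_def])

lemma mult_E_pair:
  assumes "a \<in> carr A" "h \<in> carr H" "b \<in> carr A" "g \<in> carr H"
  shows "mult E (pair a h) (pair b g) = mult4 a h b g"
  unfolding mult_E
  by (subst ext_tens[OF trilinD(6)[OF mult4_trilin pair_mem] E_vs], (rule assms)+)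
    (rule ext_tens[OF bilinI E_vs], auto intro!: mult4_lin3 mult4_lin4 assms)

text \<open>The common shape of \<open>B\<close>-bar, for \<open>P\<close> = \<open>B\<close> and
  \<open>Q\<close> = \<open>R\<close>, and of the antipode, for the two antipodes; one computation
  at points then serves both.\<close>

definition theta where
  "theta P Q a h = sw3 (comult H) (\<lambda>h1 h2 h3. pair (la (P h1) (ra (Q a) (P h2))) (P h3)) h"

lemma Bbar_ext: "Bbar A H la ra Q P = ext A H (theta P Q)"
  by (rule HOL.ext) (simp add: Bbar_def ext_def theta_def)

end

context lr_smash
begin

context
  fixes P :: "'h \<Rightarrow> 'h" and Q :: "'a \<Rightarrow> 'a"
  assumes P: "lin_map H H P" and Q: "lin_map A A Q"
begin

text \<open>The A-component of \<open>theta\<close>, with the two copies of h exchanged so that the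
  inner action uses h1 and the outer one h2, as \<open>conv_split_right\<close> requires.\<close>

private definition kappa where
  "kappa a u = sw H (\<lambda>h1 h2. la (P h2) (ra (Q a) (P h1))) u"

private lemma raPQ: "bilin A H A (\<lambda>a h. ra (Q a) (P h))"
  by (rule bilin_comp[OF ra_bilin Q P])

private lemma laP: "bilin A H A (\<lambda>a h. la (P h) a)"
  by (rule bilin_flip[OF bilin_comp[OF la_bilin P lin_map_id]])

private lemma kappa_inner: "bilin H H A (\<lambda>h1 h2. la (P h2) (ra (Q a) (P h1)))" if "a \<in> carr A" for a
  by (rule bilin_comp[OF laP bilinD(2)[OF raPQ that] lin_map_id])

private lemma kappa_bilin: "bilin A H A kappa"
proof -
  have "lin_map A A (\<lambda>a. la (P h2) (ra (Q a) (P h1)))" if "h1 \<in> carr H" "h2 \<in> carr H" for h1 h2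
    by (rule lin_map_comp[OF bilinD(3)[OF laP that(2)] bilinD(3)[OF raPQ that(1)]])
  then show ?thesis unfolding kappa_def[abs_def]
    by (auto intro!: bilinI sw2_lin[OF H.cc kappa_inner A.vs] sw2_lin_param[OF H.cc _ A.vs A.vs])
qed

private lemma pairP: "bilin A H E (\<lambda>x y. pair x (P y))"
  by (rule bilin_comp[OF pair_bilin lin_map_id P])

private lemma theta_kappa:
  assumes a: "a \<in> carr A" and h: "h \<in> carr H"
  shows "theta P Q a h = sw H (\<lambda>u z. pair (kappa a u) (P z)) h"
  unfolding theta_def sw3_sw2
proof (rule sw2_cong[OF H.cc h])
  fix u z assume u: "u \<in> carr H" and z: "z \<in> carr H"
  have k: "kappa a u = sw H (\<lambda>h1 h2. la (P h1) (ra (Q a) (P h2))) u"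
    unfolding kappa_def by (rule sw2_flip[OF H.cc kappa_inner[OF a] A.vs u])
  show "sw H (\<lambda>h1 h2. pair (la (P h1) (ra (Q a) (P h2))) (P z)) u = pair (kappa a u) (P z)"
    unfolding k
    by (rule lin_sw2[OF bilinD(3)[OF pairP z] A.vs H.cc u, symmetric]) (rule bilinD(1)[OF kappa_inner[OF a]])
qed

lemma theta_bilin: "bilin A H E (theta P Q)"
proof (rule bilinI)
  have t: "bilin H H E (\<lambda>u z. pair (kappa a u) (P z))" if "a \<in> carr A" for a
    by (rule bilin_comp[OF pairP bilinD(2)[OF kappa_bilin that] lin_map_id])
  have t': "lin_map A E (\<lambda>a. pair (kappa a u) (P z))" if "u \<in> carr H" "z \<in> carr H" for u z
    by (rule lin_map_comp[OF bilinD(3)[OF pairP that(2)] bilinD(3)[OF kappa_bilin that(1)]])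
  show "lin_map H E (theta P Q a)" if "a \<in> carr A" for a
    by (rule lin_map_cong[OF sw2_lin[OF H.cc t[OF that] E_vs] H.vs theta_kappa[OF that]])
  show "lin_map A E (\<lambda>a. theta P Q a h)" if "h \<in> carr H" for h
    by (rule lin_map_cong[OF sw2_lin_param[OF H.cc that A.vs E_vs t'] A.vs theta_kappa[OF _ that]])
qed

lemma ext_theta_lin: "lin_map E E (ext A H (theta P Q))"
  by (rule ext_lin[OF A.vs theta_bilin E_vs])

text \<open>Splitting off the three copies of h one at a time makes \<open>p\<close> occur three
  times. Only linearity of \<open>Q\<close> and \<open>f\<close> is assumed, so the formula is
  available for \<open>R\<close> before it is a coalgebra map.\<close>

lemma ext_theta_pair:
  assumes C: "ccoalg C" and f: "lin_map C A f" and p: "chom C H p"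
  shows "(\<lambda>c. ext A H (theta P Q) (conv C pair f p c)) =
    conv C pair (conv C la (\<lambda>c. P (p c)) (conv C ra (\<lambda>c. Q (f c)) (\<lambda>c. P (p c)))) (\<lambda>c. P (p c))"
proof -
  note pl = chom_lin[OF p]
  have Pp: "lin_map C H (\<lambda>c. P (p c))" and Qf: "lin_map C A (\<lambda>c. Q (f c))"
    by (rule lin_map_comp[OF P pl] lin_map_comp[OF Q f])+
  note rl = conv_lin[OF C ra_bilin A.vs Qf Pp]
  have "(\<lambda>c. ext A H (theta P Q) (conv C pair f p c)) = conv C (\<lambda>a h. ext A H (theta P Q) (pair a h)) f p"
    by (rule conv_comp_lin[OF C pair_bilin E_vs f pl ext_theta_lin])
  also have "\<dots> = conv C (theta P Q) f p"
    by (rule conv_cong[OF C refl refl]) (rule ext_tens[OF theta_bilin E_vs lin_mapD(1)[OF f] lin_mapD(1)[OF pl]])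
  also have "\<dots> = conv C (\<lambda>x y. pair x (P y)) (conv C kappa f p) p"
    by (rule conv_split_right[OF C H.cc E_vs A.vs pairP kappa_bilin f p]) (rule theta_kappa)
  also have "conv C kappa f p = conv C (\<lambda>a h. la (P h) a) (conv C (\<lambda>a h. ra (Q a) (P h)) f p) p"
    by (rule conv_split_right[OF C H.cc A.vs A.vs laP raPQ f p]) (rule kappa_def)
  also have "conv C (\<lambda>a h. ra (Q a) (P h)) f p = conv C ra (\<lambda>c. Q (f c)) (\<lambda>c. P (p c))"
    by (simp add: conv_def)
  also have "conv C (\<lambda>a h. la (P h) a) (conv C ra (\<lambda>c. Q (f c)) (\<lambda>c. P (p c))) p =
      conv C (\<lambda>h a. la (P h) a) p (conv C ra (\<lambda>c. Q (f c)) (\<lambda>c. P (p c)))"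
    by (rule conv_flip[OF C laP A.vs rl pl])
  also have "\<dots> = conv C la (\<lambda>c. P (p c)) (conv C ra (\<lambda>c. Q (f c)) (\<lambda>c. P (p c)))"
    by (simp add: conv_def)
  finally show ?thesis by (simp add: conv_def)
qed

end

lemma antipode_E:
  assumes t: "t \<in> carr E"
  shows "antipode E t = ext A H (theta (antipode H) (antipode A)) t"
proof -
  have eq: "sw3 (comult H) (\<lambda>h1 h2 h3. pair (la (antipode H h3) (ra (antipode A a) (antipode H h2))) (antipode H h1)) h =
    theta (antipode H) (antipode A) a h" if a: "a \<in> carr A" and h: "h \<in> carr H" for a h
    unfolding theta_def
  proof (rule sw3_reverse[OF H.cc _ E_vs h])
    have "bilin H H A (\<lambda>x y. la (antipode H x) (ra (antipode A a) (antipode H y)))"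
      by (rule bilin_comp[OF la_bilin H.antipode_lin
        lin_map_comp[OF bilinD(2)[OF ra_bilin lin_mapD(1)[OF A.antipode_lin a]] H.antipode_lin]])
    from trilin_comp[OF trilin_bilin_left[OF pair_bilin this] lin_map_id lin_map_id H.antipode_lin]
    show "trilin H H H E (\<lambda>x y z. pair (la (antipode H x) (ra (antipode A a) (antipode H y))) (antipode H z))" .
  qed
  have "antipode E t = ext A H (\<lambda>a h. sw3 (comult H) (\<lambda>h1 h2 h3. pair (la (antipode H h3) (ra (antipode A a) (antipode H h2))) (antipode H h1)) h) t"
    by (simp add: smash_def ext_def)
  also have "\<dots> = ext A H (theta (antipode H) (antipode A)) t"
    unfolding ext_def using srep_mem[of t A H] t eq by (intro arg_cong[where f = sum_list] map_cong) auto
  finally show ?thesis .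
qed

lemma antipode_E_lin: "lin_map E E (antipode E)"
  by (rule lin_map_cong[OF ext_theta_lin[OF H.antipode_lin A.antipode_lin] E_vs antipode_E])

lemma antipode_E_pair:
  assumes C: "ccoalg C" and f: "chom C A f" and p: "chom C H p"
  shows "(\<lambda>c. antipode E (conv C pair f p c)) =
    conv C pair (conv C la (\<lambda>c. antipode H (p c)) (conv C ra (\<lambda>c. antipode A (f c)) (\<lambda>c. antipode H (p c)))) (\<lambda>c. antipode H (p c))"
proof -
  have F: "chom C E (conv C pair f p)"
    by (rule chom_conv[OF C A.cc H.cc E_cc tens_cbilin[OF A.cc H.cc] chom_cmap[OF f] chom_cmap[OF p]])
  have "(\<lambda>c. antipode E (conv C pair f p c)) = (\<lambda>c. ext A H (theta (antipode H) (antipode A)) (conv C pair f p c))"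
    by (rule HOL.ext) (rule antipode_E[OF A.chom_mem[OF C F E_vs]])
  then show ?thesis
    by (simp only: ext_theta_pair[OF H.antipode_lin A.antipode_lin C chom_lin[OF f] p])
qed

lemma chom_pair: "ccoalg C \<Longrightarrow> chom C A f \<Longrightarrow> chom C H p \<Longrightarrow> chom C E (conv C pair f p)"
  by (rule chom_conv[OF _ A.cc H.cc E_cc tens_cbilin[OF A.cc H.cc] chom_cmap chom_cmap])

text \<open>In the product a meets g and h meets b. Flipping the second pair and interchanging
  regroups the points as (f, q) and (p, g), where \<open>rho\<close> and \<open>lam\<close> can be
  split; \<open>conv_tprod\<close> then multiplies componentwise.\<close>

lemma mult_E_points:
  assumes C: "ccoalg C" and f: "chom C A f" and p: "chom C H p" and g: "chom C A g" and q: "chom C H q"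
  shows "conv C (mult E) (conv C pair f p) (conv C pair g q) =
    conv C pair (conv C (mult A) (conv C ra f q) (conv C la p g)) (conv C (mult H) p q)"
proof -
  note fl = chom_lin[OF f] and pl = chom_lin[OF p] and gl = chom_lin[OF g] and ql = chom_lin[OF q]
  have rl: "lin_map C A (conv C ra f q)" and ll: "lin_map C A (conv C la p g)"
    by (rule conv_lin[OF C ra_bilin A.vs fl ql], rule conv_lin[OF C la_bilin A.vs pl gl])
  have "conv C (mult E) (conv C pair f p) (conv C pair g q) =
    conv C (mult E) (conv C pair f p) (conv C (\<lambda>g b. pair b g) q g)"
    by (simp only: conv_flip[OF C pair_bilin E_vs gl ql])
  also have "\<dots> = conv C mE (conv C rho f q) (conv C lam p g)"
    by (rule conv_interchange[OF C E_vs mult_E_bilin pair_bilin bilin_flip[OF pair_bilin] mE_bilin rho_bilin lam_bilin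
      E_vs E_vs E_vs E_vs fl pl ql gl]) (simp add: mult_E_pair mult4_eq)
  also have "conv C rho f q = conv C pair (conv C ra f q) q"
    by (rule conv_split_right[OF C H.cc E_vs A.vs pair_bilin ra_bilin fl q]) (rule rho_def)
  also have "conv C lam p g = conv C (\<lambda>b h. lam h b) g p"
    by (rule conv_flip[OF C lam_bilin E_vs pl gl])
  also have "\<dots> = conv C pair (conv C (\<lambda>b h. la h b) g p) p"
    by (rule conv_split_right[OF C H.cc E_vs A.vs pair_bilin bilin_flip[OF la_bilin] gl p]) (rule lam_def)
  also have "conv C (\<lambda>b h. la h b) g p = conv C la p g"
    by (rule conv_flip[OF C la_bilin A.vs pl gl, symmetric])
  also have "conv C mE (conv C pair (conv C ra f q) q) (conv C pair (conv C la p g) p) =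
    conv C pair (conv C (mult A) (conv C ra f q) (conv C la p g)) (conv C (\<lambda>x y. mult H y x) q p)"
    unfolding mE_def
    by (rule conv_tprod[OF A.vs H.vs A.vs H.vs A.vs H.vs A.mult_bilin bilin_flip[OF H.mult_bilin] C rl ql ll pl])
  also have "conv C (\<lambda>x y. mult H y x) q p = conv C (mult H) p q"
    by (rule conv_flip[OF C H.mult_bilin H.vs pl ql, symmetric])
  finally show ?thesis .
qed

text \<open>Pairs suffice because every point of E is one, by \<open>chom_pair_eta\<close>; and
  since the second components coincide by the identity for \<open>B\<close>, applying
  \<open>prL\<close> reduces equality of pairs to equality of first components.\<close>

lemma rb_points_pair:
  assumes C: "ccoalg C" and R: "cmap A A R" and B: "cmap H H B" and rbB: "rb_points C H B"
  shows "rb_points C E (Bbar A H la ra R B) \<longleftrightarrow>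
    (\<forall>f g p q. chom C A f \<longrightarrow> chom C A g \<longrightarrow> chom C H p \<longrightarrow> chom C H q \<longrightarrow>
      bi_acted_group.rb_pair (conv C (mult A)) (\<lambda>f c. antipode A (f c)) (conv C (mult H)) (\<lambda>p c. antipode H (p c))
        (conv C la) (conv C ra) (\<lambda>f c. R (f c)) (\<lambda>p c. B (p c)) f p g q)"
proof -
  interpret G: bi_acted_group "{f. chom C A f}" "conv C (mult A)" "cunit C A (one_h A)" "\<lambda>f c. antipode A (f c)"
    "{p. chom C H p}" "conv C (mult H)" "cunit C H (one_h H)" "\<lambda>p c. antipode H (p c)" "conv C la" "conv C ra"
    by (rule points_bi_acted_group[OF C])
  let ?Bb = "Bbar A H la ra R B" and ?pr = "conv C pair"
  let ?R = "\<lambda>f c. R (f c)" and ?B = "\<lambda>p c. B (p c)"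
  let ?iA = "\<lambda>f c. antipode A (f c)" and ?iH = "\<lambda>p c. antipode H (p c)"
  have Rc: "chom C A (?R f)" if "chom C A f" for f by (rule chom_comp[OF C A.cc A.cc that R])
  have Bc: "chom C H (?B p)" if "chom C H p" for p by (rule chom_comp[OF C H.cc H.cc that B])
  note cl = G.A.m_closed[unfolded mem_Collect_eq] G.H.m_closed[unfolded mem_Collect_eq] G.A.i_closed[unfolded mem_Collect_eq]
    G.H.i_closed[unfolded mem_Collect_eq] G.la_closed[unfolded mem_Collect_eq] G.ra_closed[unfolded mem_Collect_eq] Rc Bc
  have tw: "chom C A (G.twist ?R ?B f p)" if "chom C A f" "chom C H p" for f p
    using that unfolding G.twist_def by (intro cl)
  have tw': "chom C A (G.twist ?iA ?iH f p)" if "chom C A f" "chom C H p" for f p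
    using that unfolding G.twist_def by (intro cl)
  have lm: "chom C A (G.lr_mult f p g q)" if "chom C A f" "chom C H p" "chom C A g" "chom C H q" for f p g q
    using that unfolding G.lr_mult_def by (intro cl)
  have Bb: "(\<lambda>c. ?Bb (?pr f p c)) = ?pr (G.twist ?R ?B f p) (?B p)" if "chom C A f" "chom C H p" for f p
    unfolding Bbar_ext G.twist_def by (rule ext_theta_pair[OF cmap_lin[OF B] cmap_lin[OF R] C chom_lin[OF that(1)] that(2)])
  have S: "(\<lambda>c. antipode E (?pr f p c)) = ?pr (G.twist ?iA ?iH f p) (?iH p)" if "chom C A f" "chom C H p" for f p
    unfolding G.twist_def by (rule antipode_E_pair[OF C that])
  have M: "conv C (mult E) (?pr f p) (?pr g q) = ?pr (G.lr_mult f p g q) (conv C (mult H) p q)"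
    if "chom C A f" "chom C H p" "chom C A g" "chom C H q" for f p g q
    unfolding G.lr_mult_def by (rule mult_E_points[OF C that])
  have eq: "conv C (mult E) (\<lambda>c. ?Bb (?pr f p c)) (\<lambda>c. ?Bb (?pr g q c)) =
      (\<lambda>c. ?Bb (conv C (mult E) (conv C (mult E) (conv C (mult E) (?pr f p) (\<lambda>c. ?Bb (?pr f p c))) (?pr g q)) (\<lambda>c. antipode E (?Bb (?pr f p c))) c))
    \<longleftrightarrow> G.rb_pair ?R ?B f p g q"
    if f: "chom C A f" and p: "chom C H p" and g: "chom C A g" and q: "chom C H q" for f p g q
  proof -
    define u where "u = G.twist ?R ?B f p"
    define b where "b = ?B p"
    define X where "X = G.lr_mult u b (G.twist ?R ?B g q) (?B q)"
    define Y1 where "Y1 = G.lr_mult f p u b"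
    define Y2 where "Y2 = G.lr_mult Y1 (conv C (mult H) p b) g q"
    define Y3 where "Y3 = G.lr_mult Y2 (conv C (mult H) (conv C (mult H) p b) q) (G.twist ?iA ?iH u b) (?iH b)"
    define z where "z = conv C (mult H) (conv C (mult H) (conv C (mult H) p b) q) (?iH b)"
    have c: "chom C A u" "chom C H b" "chom C H (?B q)" "chom C A (G.twist ?R ?B g q)"
      using f p g q by (auto simp: u_def b_def intro: tw Bc)
    have hp: "chom C H (conv C (mult H) p b)" "chom C H (conv C (mult H) (conv C (mult H) p b) q)" "chom C H (?iH b)" "chom C H z"
      using p q c by (auto simp: z_def intro!: cl)
    have Y: "chom C A Y1" "chom C A Y2" "chom C A Y3" "chom C A X"
      using f g p q c hp by (auto simp: Y1_def Y2_def Y3_def X_def intro!: lm tw')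
    have Bz: "conv C (mult H) b (?B q) = ?B z"
      using rbB p q unfolding rb_points_def b_def z_def by blast
    have L: "conv C (mult E) (\<lambda>c. ?Bb (?pr f p c)) (\<lambda>c. ?Bb (?pr g q c)) = ?pr X (?B z)"
      unfolding Bb[OF f p] Bb[OF g q] unfolding u_def[symmetric] b_def[symmetric] M[OF c(1,2,4,3)] Bz X_def ..
    have R: "(\<lambda>c. ?Bb (conv C (mult E) (conv C (mult E) (conv C (mult E) (?pr f p) (\<lambda>c. ?Bb (?pr f p c))) (?pr g q)) (\<lambda>c. antipode E (?Bb (?pr f p c))) c))
      = ?pr (G.twist ?R ?B Y3 z) (?B z)"
    proof -
      have 1: "(\<lambda>c. ?Bb (?pr f p c)) = ?pr u b" unfolding u_def b_def by (rule Bb[OF f p])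
      have 2: "(\<lambda>c. antipode E (?Bb (?pr f p c))) = ?pr (G.twist ?iA ?iH u b) (?iH b)"
        unfolding fun_cong[OF 1] by (rule S[OF c(1,2)])
      have 3: "conv C (mult E) (conv C (mult E) (conv C (mult E) (?pr f p) (?pr u b)) (?pr g q)) (?pr (G.twist ?iA ?iH u b) (?iH b)) = ?pr Y3 z"
        unfolding M[OF f p c(1,2)] Y1_def[symmetric] M[OF Y(1) hp(1) g q] Y2_def[symmetric]
          M[OF Y(2) hp(2) tw'[OF c(1,2)] hp(3)] Y3_def[symmetric] z_def[symmetric] ..
      show ?thesis unfolding 1 2 3 by (rule Bb[OF Y(3) hp(4)])
    qed
    have "?pr X (?B z) = ?pr (G.twist ?R ?B Y3 z) (?B z) \<longleftrightarrow> X = G.twist ?R ?B Y3 z"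
    proof
      assume e: "?pr X (?B z) = ?pr (G.twist ?R ?B Y3 z) (?B z)"
      have "X = (\<lambda>c. prL A H (?pr X (?B z) c))"
        by (rule prL_conv_tens[OF C A.cc H.cc chom_lin[OF Y(4)] A.chom_ext0[OF C Y(4)] Bc[OF hp(4)], symmetric])
      also have "\<dots> = G.twist ?R ?B Y3 z"
        unfolding e
        by (rule prL_conv_tens[OF C A.cc H.cc chom_lin[OF tw[OF Y(3) hp(4)]] A.chom_ext0[OF C tw[OF Y(3) hp(4)]] Bc[OF hp(4)]])
      finally show "X = G.twist ?R ?B Y3 z" .
    qed simp
    then show ?thesis
      unfolding L R G.rb_pair_def X_def Y3_def Y2_def Y1_def z_def u_def b_def .
  qed
  show ?thesis
  proof
    assume "rb_points C E ?Bb"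
    then show "\<forall>f g p q. chom C A f \<longrightarrow> chom C A g \<longrightarrow> chom C H p \<longrightarrow> chom C H q \<longrightarrow> G.rb_pair ?R ?B f p g q"
      unfolding rb_points_def using eq chom_pair[OF C] by blast
  next
    assume *: "\<forall>f g p q. chom C A f \<longrightarrow> chom C A g \<longrightarrow> chom C H p \<longrightarrow> chom C H q \<longrightarrow> G.rb_pair ?R ?B f p g q"
    show "rb_points C E ?Bb"
      unfolding rb_points_def
    proof (intro allI impI)
      fix F K assume F: "chom C E F" and K: "chom C E K"
      have l: "chom C A (\<lambda>c. prL A H (F' c))" "chom C H (\<lambda>c. prR A H (F' c))" if "chom C E F'" for F'
        by (rule chom_comp[OF C E_cc A.cc that chom_cmap[OF chom_prL[OF A.cc H.cc]]],
          rule chom_comp[OF C E_cc H.cc that chom_cmap[OF chom_prR[OF A.cc H.cc]]])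
      from eq[OF l[OF F] l[OF K]] * l[OF F] l[OF K]
      show "conv C (mult E) (\<lambda>c. ?Bb (F c)) (\<lambda>c. ?Bb (K c)) =
        (\<lambda>c. ?Bb (conv C (mult E) (conv C (mult E) (conv C (mult E) F (\<lambda>c. ?Bb (F c))) K) (\<lambda>c. antipode E (?Bb (F c))) c))"
        unfolding chom_pair_eta[OF A.cc H.cc C F] chom_pair_eta[OF A.cc H.cc C K] by blast
    qed
  qed
qed

end

section \<open>The two compatibility conditions\<close>

context lr_smash
begin

context
  fixes R :: "'a \<Rightarrow> 'a" and B :: "'h \<Rightarrow> 'h"
  assumes Rl: "lin_map A A R" and B: "cmap H H B"
begin

private lemma Bl: "lin_map H H B"
  by (rule cmap_lin[OF B])

private lemma SRl: "lin_map A A (\<lambda>a. antipode A (R a))"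
  by (rule lin_map_comp[OF A.antipode_lin Rl])

private lemma SBl: "lin_map H H (\<lambda>h. antipode H (B h))"
  by (rule lin_map_comp[OF H.antipode_lin Bl])

lemma Bbar_lin: "lin_map E E (Bbar A H la ra R B)"
  unfolding Bbar_ext by (rule ext_theta_lin[OF Bl Rl])

lemma rb_fixes_one:
  assumes C: "ccoalg C" and rb: "rb_points C H B"
  shows "(\<lambda>c. B (cunit C H (one_h H) c)) = cunit C H (one_h H)"
proof -
  interpret G: bi_acted_group "{f. chom C A f}" "conv C (mult A)" "cunit C A (one_h A)" "\<lambda>f c. antipode A (f c)"
    "{p. chom C H p}" "conv C (mult H)" "cunit C H (one_h H)" "\<lambda>p c. antipode H (p c)" "conv C la" "conv C ra"
    by (rule points_bi_acted_group[OF C])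
  \<comment> \<open>\<open>B_one\<close> is stated for a map on either group; the identity serves as
    the map on the points of \<open>A\<close>.\<close>
  show ?thesis
    by (rule G.B_one[of "\<lambda>f. f" "\<lambda>p c. B (p c)"])
      (use rb in \<open>auto simp: rb_points_def intro: chom_comp[OF C H.cc H.cc _ B]\<close>)
qed

text \<open>\<open>R\<close> is the composite of a \<mapsto> a \<otimes> 1, \<open>B\<close>-bar and
  the first projection, all of them coalgebra maps. Since \<open>B\<close> fixes 1,
  \<open>B\<close>-bar sends a \<otimes> 1 to R(a) \<otimes> 1; the actions of the unit
  disappear.\<close>

lemma cmap_of_Bbar:
  assumes rb: "rb_points A H B" and Bb: "cmap E E (Bbar A H la ra R B)"
  shows "cmap A A R"
proof -
  define I where "I = (\<lambda>a. if a \<in> carr A then a else 0)"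
  define e where "e = cunit A H (one_h H)"
  have I: "chom A A I" unfolding I_def by (rule chom_id[OF A.cc])
  have e: "chom A H e" unfolding e_def by (rule H.chom_one[OF A.cc])
  have Be: "(\<lambda>c. B (e c)) = e" unfolding e_def by (rule rb_fixes_one[OF A.cc rb])
  have RIl: "lin_map A A (\<lambda>a. R (I a))" by (rule lin_map_comp[OF Rl chom_lin[OF I]])
  have RIe: "ext0 A (\<lambda>a. R (I a))" by (rule ext0_comp[OF A.chom_ext0[OF A.cc I] Rl A.vs])
  have RIm: "R (I c) \<in> carr A" for c by (rule lin_mapD(1)[OF Rl A.chom_mem[OF A.cc I A.vs]])
  have r: "conv A ra (\<lambda>a. R (I a)) e = (\<lambda>a. R (I a))"
    unfolding e_def conv_cunit_right[OF A.cc ra_bilin A.vs H.vs A.vs H.one_mem RIl RIe] by (simp add: ra_one RIm)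
  have l: "conv A la e (\<lambda>a. R (I a)) = (\<lambda>a. R (I a))"
    unfolding e_def conv_cunit_left[OF A.cc la_bilin H.vs A.vs A.vs H.one_mem RIl RIe] by (simp add: la_one RIm)
  have "(\<lambda>c. Bbar A H la ra R B (conv A pair I e c)) = conv A pair (\<lambda>a. R (I a)) e"
    unfolding Bbar_ext ext_theta_pair[OF Bl Rl A.cc chom_lin[OF I] e] Be r l ..
  moreover have "chom A E (\<lambda>c. Bbar A H la ra R B (conv A pair I e c))"
    by (rule chom_comp[OF A.cc E_cc E_cc chom_pair[OF A.cc I e] Bb])
  ultimately have "chom A E (conv A pair (\<lambda>a. R (I a)) e)" by simp
  from chom_comp[OF A.cc E_cc A.cc this chom_cmap[OF chom_prL[OF A.cc H.cc]]]
  have "chom A A (\<lambda>a. R (I a))" by (simp only: prL_conv_tens[OF A.cc A.cc H.cc RIl RIe e])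
  from cmap_cong[OF A.cc chom_cmap[OF this]] show ?thesis by (simp add: I_def)
qed

text \<open>The tautological point of E is the pair of its projections. Its image under
  \<open>B\<close>-bar is built from points of \<open>A\<close> and \<open>H\<close> by actions and
  pairing, hence is again a point.\<close>

lemma cmap_Bbar:
  assumes R: "cmap A A R"
  shows "cmap E E (Bbar A H la ra R B)"
proof -
  interpret G: bi_acted_group "{f. chom E A f}" "conv E (mult A)" "cunit E A (one_h A)" "\<lambda>f c. antipode A (f c)"
    "{p. chom E H p}" "conv E (mult H)" "cunit E H (one_h H)" "\<lambda>p c. antipode H (p c)" "conv E la" "conv E ra"
    by (rule points_bi_acted_group[OF E_cc])
  define I where "I = (\<lambda>a. if a \<in> carr E then a else 0)"
  have I: "chom E E I" unfolding I_def by (rule chom_id[OF E_cc])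
  let ?f = "\<lambda>c. prL A H (I c)" and ?p = "\<lambda>c. prR A H (I c)"
  have f: "chom E A ?f" by (rule chom_comp[OF E_cc E_cc A.cc I chom_cmap[OF chom_prL[OF A.cc H.cc]]])
  have p: "chom E H ?p" by (rule chom_comp[OF E_cc E_cc H.cc I chom_cmap[OF chom_prR[OF A.cc H.cc]]])
  have Rf: "chom E A (\<lambda>c. R (?f c))" by (rule chom_comp[OF E_cc A.cc A.cc f R])
  have Bp: "chom E H (\<lambda>c. B (?p c))" by (rule chom_comp[OF E_cc H.cc H.cc p B])
  have eq: "(\<lambda>c. Bbar A H la ra R B (conv E pair ?f ?p c)) =
    conv E pair (conv E la (\<lambda>c. B (?p c)) (conv E ra (\<lambda>c. R (?f c)) (\<lambda>c. B (?p c)))) (\<lambda>c. B (?p c))"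
    unfolding Bbar_ext by (rule ext_theta_pair[OF Bl Rl E_cc chom_lin[OF f] p])
  have "chom E A (conv E la (\<lambda>c. B (?p c)) (conv E ra (\<lambda>c. R (?f c)) (\<lambda>c. B (?p c))))"
    by (rule G.la_closed[unfolded mem_Collect_eq, OF Bp G.ra_closed[unfolded mem_Collect_eq, OF Bp Rf]])
  from chom_pair[OF E_cc this Bp] have "chom E E (\<lambda>c. Bbar A H la ra R B (conv E pair ?f ?p c))"
    unfolding eq .
  then have "chom E E (\<lambda>c. Bbar A H la ra R B (I c))"
    unfolding chom_pair_eta[OF A.cc H.cc E_cc I] .
  from cmap_cong[OF E_cc chom_cmap[OF this]] show ?thesis by (simp add: I_def)
qed

definition cond1 where
  "cond1 a b h \<longleftrightarrow>
     R (sw3 (comult A) (\<lambda>a1 a2 a3. sw H (\<lambda>h1 h2.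
            mult A (mult A (ra (mult A a1 (R a2)) h1) b) (la h2 (antipode A (R a3)))) h) a)
       = mult A (la (antipode H (B h)) (R a)) (R b)"

definition cond2 where
  "cond2 b g \<longleftrightarrow> R (sw3 (comult H) (\<lambda>g1 g2 g3. ra (la (mult H g1 (B g2)) b) (antipode H (B g3))) g)
       = ra (R b) (antipode H (B g))"

definition cond1_points :: "('k, 'c::ab_group_add) hopf_alg \<Rightarrow> bool" where
  "cond1_points C \<longleftrightarrow> (\<forall>f g q. chom C A f \<longrightarrow> chom C A g \<longrightarrow> chom C H q \<longrightarrow>
    (\<lambda>c. R (conv C (mult A) (conv C (mult A) (conv C ra (conv C (mult A) f (\<lambda>c. R (f c))) q) g)
        (conv C la q (\<lambda>c. antipode A (R (f c)))) c)) =
    conv C (mult A) (conv C la (\<lambda>c. antipode H (B (q c))) (\<lambda>c. R (f c))) (\<lambda>c. R (g c)))"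

definition cond2_points :: "('k, 'c::ab_group_add) hopf_alg \<Rightarrow> bool" where
  "cond2_points C \<longleftrightarrow> (\<forall>g p. chom C A g \<longrightarrow> chom C H p \<longrightarrow>
    (\<lambda>c. R (conv C ra (conv C la (conv C (mult H) p (\<lambda>c. B (p c))) g) (\<lambda>c. antipode H (B (p c))) c)) =
    conv C ra (\<lambda>c. R (g c)) (\<lambda>c. antipode H (B (p c))))"

private definition mu where "mu = conv A (mult A) (\<lambda>x. x) R"
private definition nu where "nu = conv H (mult H) (\<lambda>x. x) B"
text \<open>The first condition has three variables. Joining a and h into one element x of E makes
  it bilinear in x and b, with sandwich alpha(x1) b beta(x2), because the coproduct of E splits a
  and h simultaneously. \<open>delta\<close> is the corresponding factor on the right-hand
  side.\<close>

private definition alpha where "alpha = conv E (\<lambda>a h. ra (mu a) h) (prL A H) (prR A H)"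
private definition beta where "beta = conv E (\<lambda>a h. la h (antipode A (R a))) (prL A H) (prR A H)"
private definition delta where "delta = conv E (\<lambda>a h. la (antipode H (B h)) (R a)) (prL A H) (prR A H)"
private definition arg1 where "arg1 x b = sw E (\<lambda>u z. mult A (mult A (alpha u) b) (beta z)) x"
private definition arg2 where "arg2 g b = sw H (\<lambda>u z. ra (la (nu u) b) (antipode H (B z))) g"

private lemma mu_lin: "lin_map A A mu" and nu_lin: "lin_map H H nu"
  unfolding mu_def nu_def by (rule conv_lin[OF A.cc A.mult_bilin A.vs lin_map_id Rl], rule conv_lin[OF H.cc H.mult_bilin H.vs lin_map_id Bl])

private lemma
  shows alpha_b: "bilin A H A (\<lambda>a h. ra (mu a) h)"
    and beta_b: "bilin A H A (\<lambda>a h. la h (antipode A (R a)))"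
    and delta_b: "bilin A H A (\<lambda>a h. la (antipode H (B h)) (R a))"
  by (rule bilin_comp[OF ra_bilin mu_lin lin_map_id], rule bilin_flip[OF bilin_comp[OF la_bilin lin_map_id SRl]],
    rule bilin_flip[OF bilin_comp[OF la_bilin SBl Rl]])

private lemmas pL = prL_lin[OF A.cc H.cc, of la ra] and pR = prR_lin[OF A.cc H.cc, of la ra]

private lemma alpha_lin: "lin_map E A alpha" and beta_lin: "lin_map E A beta" and delta_lin: "lin_map E A delta"
  unfolding alpha_def beta_def delta_def
  by (rule conv_lin[OF E_cc alpha_b A.vs pL pR], rule conv_lin[OF E_cc beta_b A.vs pL pR], rule conv_lin[OF E_cc delta_b A.vs pL pR])

private lemma
  assumes "a \<in> carr A" "h \<in> carr H"
  shows alpha_pair: "alpha (pair a h) = ra (mu a) h" and beta_pair: "beta (pair a h) = la h (antipode A (R a))"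
    and delta_pair: "delta (pair a h) = la (antipode H (B h)) (R a)"
  unfolding alpha_def beta_def delta_def
  by (rule conv_pr_tens[OF A.cc H.cc alpha_b A.vs assms] conv_pr_tens[OF A.cc H.cc beta_b A.vs assms]
    conv_pr_tens[OF A.cc H.cc delta_b A.vs assms])+

private lemma arg1_bilin: "bilin E A A arg1"
  unfolding arg1_def[abs_def] by (rule sandwich_bilin[OF E_cc A.vs A.vs A.mult_bilin A.mult_bilin alpha_lin beta_lin])

private lemma arg2_bilin: "bilin H A A arg2"
  unfolding arg2_def[abs_def] by (rule sandwich_bilin[OF H.cc A.vs A.vs ra_bilin la_bilin nu_lin SBl])

text \<open>Exchanging sums lets a1 and a2 collapse into \<open>mu\<close>; the remaining splittings
  of a and of h together form one coproduct of a \<otimes> h.\<close>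

private lemma arg1_pair:
  assumes a: "a \<in> carr A" and b: "b \<in> carr A" and h: "h \<in> carr H"
  shows "sw3 (comult A) (\<lambda>a1 a2 a3. sw H (\<lambda>h1 h2.
      mult A (mult A (ra (mult A a1 (R a2)) h1) b) (la h2 (antipode A (R a3)))) h) a = arg1 (pair a h) b"
proof -
  note SRm = lin_mapD(1)[OF SRl] and Rm = lin_mapD(1)[OF Rl]
  have "sw3 (comult A) (\<lambda>a1 a2 a3. sw H (\<lambda>h1 h2.
      mult A (mult A (ra (mult A a1 (R a2)) h1) b) (la h2 (antipode A (R a3)))) h) a =
    sw A (\<lambda>u a3. sw H (\<lambda>h1 h2. mult A (mult A (ra (mu u) h1) b) (la h2 (antipode A (R a3)))) h) a"
    unfolding sw3_sw2
  proof (rule sw2_cong[OF A.cc a])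
    fix u a3 assume u: "u \<in> carr A" and a3: "a3 \<in> carr A"
    have "sw A (\<lambda>a1 a2. sw H (\<lambda>h1 h2.
      mult A (mult A (ra (mult A a1 (R a2)) h1) b) (la h2 (antipode A (R a3)))) h) u =
      sw H (\<lambda>h1 h2. sw A (\<lambda>a1 a2.
      mult A (mult A (ra (mult A a1 (R a2)) h1) b) (la h2 (antipode A (R a3)))) u) h"
      by (rule sw2_swap)
    also have "\<dots> = sw H (\<lambda>h1 h2. mult A (mult A (ra (mu u) h1) b) (la h2 (antipode A (R a3)))) h"
    proof (rule sw2_cong[OF H.cc h])
      fix h1 h2 assume h12: "h1 \<in> carr H" "h2 \<in> carr H"
      have l: "lin_map A A (\<lambda>v. mult A (mult A (ra v h1) b) (la h2 (antipode A (R a3))))"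
        by (intro lin_map_comp[OF bilinD(3)[OF A.mult_bilin]] lin_map_comp[OF bilinD(3)[OF A.mult_bilin]] bilinD(3)[OF ra_bilin])
          (simp_all add: h12 b a3 SRm)
      show "sw A (\<lambda>a1 a2. mult A (mult A (ra (mult A a1 (R a2)) h1) b) (la h2 (antipode A (R a3)))) u =
        mult A (mult A (ra (mu u) h1) b) (la h2 (antipode A (R a3)))"
        unfolding mu_def conv_apply[OF u] by (rule lin_sw2[OF l A.vs A.cc u, symmetric]) (simp add: Rm)
    qed
    finally show "sw A (\<lambda>a1 a2. sw H (\<lambda>h1 h2.
      mult A (mult A (ra (mult A a1 (R a2)) h1) b) (la h2 (antipode A (R a3)))) h) u =
      sw H (\<lambda>h1 h2. mult A (mult A (ra (mu u) h1) b) (la h2 (antipode A (R a3)))) h" .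
  qed
  also have "\<dots> = sw A (\<lambda>u a3. sw H (\<lambda>h1 h2. mult A (mult A (alpha (pair u h1)) b) (beta (pair a3 h2))) h) a"
    by (intro sw2_cong[OF A.cc] sw2_cong[OF H.cc] a h) (simp add: alpha_pair beta_pair)
  also have "\<dots> = arg1 (pair a h) b"
  proof -
    have "bilin E E A (\<lambda>u z. mult A (mult A (alpha u) b) (beta z))"
      by (rule bilin_comp[OF A.mult_bilin lin_map_comp[OF bilinD(3)[OF A.mult_bilin b] alpha_lin] beta_lin])
    from sw2_smash_tens[OF A.cc H.cc this A.vs a h] show ?thesis by (simp add: arg1_def)
  qed
  finally show ?thesis .
qed

private lemma arg2_eq:
  assumes b: "b \<in> carr A" and g: "g \<in> carr H"
  shows "sw3 (comult H) (\<lambda>g1 g2 g3. ra (la (mult H g1 (B g2)) b) (antipode H (B g3))) g = arg2 g b"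
  unfolding sw3_sw2 arg2_def
proof (rule sw2_cong[OF H.cc g])
  fix u z assume u: "u \<in> carr H" and z: "z \<in> carr H"
  have l: "lin_map H A (\<lambda>v. ra (la v b) (antipode H (B z)))"
    by (rule lin_map_comp[OF bilinD(3)[OF ra_bilin lin_mapD(1)[OF SBl z]] bilinD(3)[OF la_bilin b]])
  show "sw H (\<lambda>g1 g2. ra (la (mult H g1 (B g2)) b) (antipode H (B z))) u = ra (la (nu u) b) (antipode H (B z))"
    unfolding nu_def conv_apply[OF u] by (rule lin_sw2[OF l H.vs H.cc u, symmetric]) (simp add: lin_mapD(1)[OF Bl])
qed

private lemma conv_arg1:
  assumes C: "ccoalg C" and F: "chom C E F" and g: "chom C A g"
  shows "(\<lambda>c. R (conv C (mult A) (conv C (mult A) (conv C ra (conv C (mult A) (\<lambda>c. prL A H (F c)) (\<lambda>c. R (prL A H (F c)))) (\<lambda>c. prR A H (F c))) g)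
        (conv C la (\<lambda>c. prR A H (F c)) (\<lambda>c. antipode A (R (prL A H (F c))))) c)) = conv C (\<lambda>x b. R (arg1 x b)) F g"
    and "conv C (mult A) (conv C la (\<lambda>c. antipode H (B (prR A H (F c)))) (\<lambda>c. R (prL A H (F c)))) (\<lambda>c. R (g c)) =
      conv C (\<lambda>x b. mult A (delta x) (R b)) F g"
proof -
  have f: "chom C A (\<lambda>c. prL A H (F c))" and p: "chom C H (\<lambda>c. prR A H (F c))"
    by (rule chom_comp[OF C E_cc A.cc F chom_cmap[OF chom_prL[OF A.cc H.cc]]],
      rule chom_comp[OF C E_cc H.cc F chom_cmap[OF chom_prR[OF A.cc H.cc]]])
  note fl = chom_lin[OF f] and pl = chom_lin[OF p]
  have 1: "(\<lambda>c. alpha (F c)) = conv C ra (conv C (mult A) (\<lambda>c. prL A H (F c)) (\<lambda>c. R (prL A H (F c)))) (\<lambda>c. prR A H (F c))"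
  proof -
    have "(\<lambda>c. alpha (F c)) = conv C (\<lambda>a h. ra (mu a) h) (\<lambda>c. prL A H (F c)) (\<lambda>c. prR A H (F c))"
      unfolding alpha_def by (rule conv_chom[OF C E_cc alpha_b A.vs pL pR F])
    also have "\<dots> = conv C ra (\<lambda>c. mu (prL A H (F c))) (\<lambda>c. prR A H (F c))" by (simp add: conv_def)
    also have "(\<lambda>c. mu (prL A H (F c))) = conv C (mult A) (\<lambda>c. prL A H (F c)) (\<lambda>c. R (prL A H (F c)))"
      unfolding mu_def by (rule conv_chom[OF C A.cc A.mult_bilin A.vs lin_map_id Rl f])
    finally show ?thesis .
  qed
  have 2: "(\<lambda>c. beta (F c)) = conv C la (\<lambda>c. prR A H (F c)) (\<lambda>c. antipode A (R (prL A H (F c))))"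
  proof -
    have "(\<lambda>c. beta (F c)) = conv C (\<lambda>a h. la h (antipode A (R a))) (\<lambda>c. prL A H (F c)) (\<lambda>c. prR A H (F c))"
      unfolding beta_def by (rule conv_chom[OF C E_cc beta_b A.vs pL pR F])
    also have "\<dots> = conv C (\<lambda>h a. la h (antipode A (R a))) (\<lambda>c. prR A H (F c)) (\<lambda>c. prL A H (F c))"
      by (rule conv_flip[OF C beta_b A.vs fl pl])
    finally show ?thesis by (simp add: conv_def)
  qed
  have 3: "(\<lambda>c. delta (F c)) = conv C la (\<lambda>c. antipode H (B (prR A H (F c)))) (\<lambda>c. R (prL A H (F c)))"
  proof -
    have "(\<lambda>c. delta (F c)) = conv C (\<lambda>a h. la (antipode H (B h)) (R a)) (\<lambda>c. prL A H (F c)) (\<lambda>c. prR A H (F c))"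
      unfolding delta_def by (rule conv_chom[OF C E_cc delta_b A.vs pL pR F])
    also have "\<dots> = conv C (\<lambda>h a. la (antipode H (B h)) (R a)) (\<lambda>c. prR A H (F c)) (\<lambda>c. prL A H (F c))"
      by (rule conv_flip[OF C delta_b A.vs fl pl])
    finally show ?thesis by (simp add: conv_def)
  qed
  have 4: "conv C arg1 F g = conv C (mult A) (conv C (mult A) (\<lambda>c. alpha (F c)) g) (\<lambda>c. beta (F c))"
    by (rule conv_sandwich[OF C E_cc A.vs A.vs A.vs A.mult_bilin A.mult_bilin alpha_lin beta_lin F chom_lin[OF g]]) (rule arg1_def)
  show "(\<lambda>c. R (conv C (mult A) (conv C (mult A) (conv C ra (conv C (mult A) (\<lambda>c. prL A H (F c)) (\<lambda>c. R (prL A H (F c)))) (\<lambda>c. prR A H (F c))) g)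
        (conv C la (\<lambda>c. prR A H (F c)) (\<lambda>c. antipode A (R (prL A H (F c))))) c)) = conv C (\<lambda>x b. R (arg1 x b)) F g"
    unfolding conv_comp_lin[OF C arg1_bilin A.vs chom_lin[OF F] chom_lin[OF g] Rl, symmetric] 4 1 2 ..
  show "conv C (mult A) (conv C la (\<lambda>c. antipode H (B (prR A H (F c)))) (\<lambda>c. R (prL A H (F c)))) (\<lambda>c. R (g c)) =
      conv C (\<lambda>x b. mult A (delta x) (R b)) F g"
    unfolding 3[symmetric] by (simp add: conv_def)
qed

private lemma conv_arg2:
  assumes C: "ccoalg C" and p: "chom C H p" and g: "chom C A g"
  shows "(\<lambda>c. R (conv C ra (conv C la (conv C (mult H) p (\<lambda>c. B (p c))) g) (\<lambda>c. antipode H (B (p c))) c)) =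
      conv C (\<lambda>h b. R (arg2 h b)) p g"
    and "conv C ra (\<lambda>c. R (g c)) (\<lambda>c. antipode H (B (p c))) = conv C (\<lambda>h b. ra (R b) (antipode H (B h))) p g"
proof -
  have 1: "conv C arg2 p g = conv C ra (conv C la (\<lambda>c. nu (p c)) g) (\<lambda>c. antipode H (B (p c)))"
    by (rule conv_sandwich[OF C H.cc A.vs A.vs A.vs ra_bilin la_bilin nu_lin SBl p chom_lin[OF g]]) (rule arg2_def)
  have 2: "(\<lambda>c. nu (p c)) = conv C (mult H) p (\<lambda>c. B (p c))"
    unfolding nu_def by (rule conv_chom[OF C H.cc H.mult_bilin H.vs lin_map_id Bl p])
  show "(\<lambda>c. R (conv C ra (conv C la (conv C (mult H) p (\<lambda>c. B (p c))) g) (\<lambda>c. antipode H (B (p c))) c)) =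
      conv C (\<lambda>h b. R (arg2 h b)) p g"
    unfolding conv_comp_lin[OF C arg2_bilin A.vs chom_lin[OF p] chom_lin[OF g] Rl, symmetric] 1 2 ..
  have "conv C ra (\<lambda>c. R (g c)) (\<lambda>c. antipode H (B (p c))) = conv C (\<lambda>b h. ra (R b) (antipode H (B h))) g p"
    by (simp add: conv_def)
  also have "\<dots> = conv C (\<lambda>h b. ra (R b) (antipode H (B h))) p g"
    by (rule conv_flip[OF C bilin_comp[OF ra_bilin Rl SBl] A.vs chom_lin[OF g] chom_lin[OF p]])
  finally show "conv C ra (\<lambda>c. R (g c)) (\<lambda>c. antipode H (B (p c))) = conv C (\<lambda>h b. ra (R b) (antipode H (B h))) p g" .
qed

private lemma rhs1_bilin: "bilin E A A (\<lambda>x b. mult A (delta x) (R b))"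
  by (rule bilin_comp[OF A.mult_bilin delta_lin Rl])

lemma cond1_points_of_elements:
  assumes C: "ccoalg C" and cond: "\<And>a b h. a \<in> carr A \<Longrightarrow> b \<in> carr A \<Longrightarrow> h \<in> carr H \<Longrightarrow> cond1 a b h"
  shows "cond1_points C"
  unfolding cond1_points_def
proof (intro allI impI)
  fix f g q assume f: "chom C A f" and g: "chom C A g" and q: "chom C H q"
  define F where "F = conv C pair f q"
  have F: "chom C E F" unfolding F_def by (rule chom_pair[OF C f q])
  have Ff: "(\<lambda>c. prL A H (F c)) = f" and Fq: "(\<lambda>c. prR A H (F c)) = q"
    unfolding F_def
    by (rule prL_conv_tens[OF C A.cc H.cc chom_lin[OF f] A.chom_ext0[OF C f] q],
      rule prR_conv_tens[OF C A.cc H.cc f chom_lin[OF q] H.chom_ext0[OF C q]])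
  \<comment> \<open>The hypothesis covers simple tensors; both sides are linear in x.\<close>
  have eq: "R (arg1 x b) = mult A (delta x) (R b)" if x: "x \<in> carr E" and b: "b \<in> carr A" for x b
  proof (rule tensor_lin_eq[OF A.vs H.vs x[simplified] lin_map_comp[OF Rl bilinD(3)[OF arg1_bilin b]] bilinD(3)[OF rhs1_bilin b]])
    fix a h assume a: "a \<in> carr A" and h: "h \<in> carr H"
    show "R (arg1 (pair a h) b) = mult A (delta (pair a h)) (R b)"
      using cond[OF a b h] unfolding cond1_def arg1_pair[OF a b h] delta_pair[OF a h] .
  qed
  have "conv C (\<lambda>x b. R (arg1 x b)) F g = conv C (\<lambda>x b. mult A (delta x) (R b)) F g"
    by (rule conv_cong[OF C refl refl]) (rule eq[OF lin_mapD(1)[OF chom_lin[OF F]] lin_mapD(1)[OF chom_lin[OF g]]])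
  with conv_arg1[OF C F g]
  show "(\<lambda>c. R (conv C (mult A) (conv C (mult A) (conv C ra (conv C (mult A) f (\<lambda>c. R (f c))) q) g)
        (conv C la q (\<lambda>c. antipode A (R (f c)))) c)) =
    conv C (mult A) (conv C la (\<lambda>c. antipode H (B (q c))) (\<lambda>c. R (f c))) (\<lambda>c. R (g c))"
    unfolding fun_cong[OF Ff] fun_cong[OF Fq] by simp
qed

text \<open>The universal base for three variables is E \<otimes> A: its first projection supplies
  the points for a and h together, its second the point for b.\<close>

lemma cond1_elements_of_points:
  assumes p: "cond1_points (smash E A l r)" and a: "a \<in> carr A" and b: "b \<in> carr A" and h: "h \<in> carr H"
  shows "cond1 a b h"
proof -
  let ?C = "smash E A l r"
  have C: "ccoalg ?C" by (rule ccoalg_smash[OF E_cc A.cc])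
  note F = chom_prL[OF E_cc A.cc, of l r] and g = chom_prR[OF E_cc A.cc, of l r]
  have fp: "chom ?C A (\<lambda>c. prL A H (prL E A c))" "chom ?C H (\<lambda>c. prR A H (prL E A c))"
    by (rule chom_comp[OF C E_cc A.cc F chom_cmap[OF chom_prL[OF A.cc H.cc]]],
      rule chom_comp[OF C E_cc H.cc F chom_cmap[OF chom_prR[OF A.cc H.cc]]])
  have "conv ?C (\<lambda>x b. R (arg1 x b)) (prL E A) (prR E A) = conv ?C (\<lambda>x b. mult A (delta x) (R b)) (prL E A) (prR E A)"
    unfolding conv_arg1[OF C F g, symmetric] using p fp g unfolding cond1_points_def by blast
  from bilin_eq_of_points[OF E_cc A.cc A.vs bilin_lin_comp[OF Rl arg1_bilin] rhs1_bilin this pair_mem[OF a h] b]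
  show ?thesis unfolding cond1_def arg1_pair[OF a b h] delta_pair[OF a h] .
qed

lemma cond2_points_of_elements:
  assumes C: "ccoalg C" and cond: "\<And>b g. b \<in> carr A \<Longrightarrow> g \<in> carr H \<Longrightarrow> cond2 b g"
  shows "cond2_points C"
  unfolding cond2_points_def
proof (intro allI impI)
  fix g p assume g: "chom C A g" and p: "chom C H p"
  note m = lin_mapD(1)[OF chom_lin[OF g]] lin_mapD(1)[OF chom_lin[OF p]]
  have "R (arg2 (p x) (g y)) = ra (R (g y)) (antipode H (B (p x)))" if "x \<in> carr C" "y \<in> carr C" for x y
    using cond[OF m(1)[OF that(2)] m(2)[OF that(1)]] unfolding cond2_def arg2_eq[OF m(1)[OF that(2)] m(2)[OF that(1)]] .
  then show "(\<lambda>c. R (conv C ra (conv C la (conv C (mult H) p (\<lambda>c. B (p c))) g) (\<lambda>c. antipode H (B (p c))) c)) =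
    conv C ra (\<lambda>c. R (g c)) (\<lambda>c. antipode H (B (p c)))"
    unfolding conv_arg2[OF C p g] by (intro conv_cong[OF C refl refl])
qed

lemma cond2_elements_of_points:
  assumes p: "cond2_points (smash H A l r)" and b: "b \<in> carr A" and g: "g \<in> carr H"
  shows "cond2 b g"
proof -
  let ?C = "smash H A l r"
  have C: "ccoalg ?C" by (rule ccoalg_smash[OF H.cc A.cc])
  note F = chom_prL[OF H.cc A.cc, of l r] and G = chom_prR[OF H.cc A.cc, of l r]
  have "conv ?C (\<lambda>h b. R (arg2 h b)) (prL H A) (prR H A) = conv ?C (\<lambda>h b. ra (R b) (antipode H (B h))) (prL H A) (prR H A)"
    unfolding conv_arg2[OF C F G, symmetric] using p F G unfolding cond2_points_def by blast
  from bilin_eq_of_points[OF H.cc A.cc A.vs bilin_lin_comp[OF Rl arg2_bilin] bilin_flip[OF bilin_comp[OF ra_bilin Rl SBl]] this g b]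
  show ?thesis unfolding cond2_def arg2_eq[OF b g] .
qed

text \<open>This is \<open>rb_pair_equiv\<close> in the groups of points over \<open>C\<close>;
  \<open>R\<close> and \<open>B\<close> act on these groups by composition because they are
  coalgebra maps.\<close>

lemma rb_points_equiv:
  assumes C: "ccoalg C" and R: "cmap A A R" and rbB: "rb_points C H B"
  shows "rb_points C E (Bbar A H la ra R B) \<longleftrightarrow> rb_points C A R \<and> cond1_points C \<and> cond2_points C"
proof -
  interpret G: bi_acted_group "{f. chom C A f}" "conv C (mult A)" "cunit C A (one_h A)" "\<lambda>f c. antipode A (f c)"
    "{p. chom C H p}" "conv C (mult H)" "cunit C H (one_h H)" "\<lambda>p c. antipode H (p c)" "conv C la" "conv C ra"
    by (rule points_bi_acted_group[OF C])
  have "rb_points C E (Bbar A H la ra R B) \<longleftrightarrow>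
    (\<forall>f\<in>{f. chom C A f}. \<forall>g\<in>{f. chom C A f}. \<forall>p\<in>{p. chom C H p}. \<forall>q\<in>{p. chom C H p}.
      G.rb_pair (\<lambda>f c. R (f c)) (\<lambda>p c. B (p c)) f p g q)"
    unfolding rb_points_pair[OF C R B rbB] by blast
  also have "\<dots> \<longleftrightarrow> rb_points C A R \<and> cond1_points C \<and> cond2_points C"
    unfolding rb_points_def cond1_points_def cond2_points_def
    by (subst G.rb_pair_equiv)
      (use rbB in \<open>auto simp: rb_points_def intro: chom_comp[OF C H.cc H.cc _ B] chom_comp[OF C A.cc A.cc _ R]\<close>)
  finally show ?thesis .
qed

end

end

theorem theorem2p2:
  fixes A :: "('k::field, 'a::ab_group_add) hopf_alg"
    and H :: "('k, 'h::ab_group_add) hopf_alg"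
    and la :: "'h \<Rightarrow> 'a \<Rightarrow> 'a" and ra :: "'a \<Rightarrow> 'h \<Rightarrow> 'a"
    and R :: "'a \<Rightarrow> 'a" and B :: "'h \<Rightarrow> 'h"
  assumes "hopf_algebra A" and "hopf_algebra H"
    and "cocomm A" and "cocomm H"
    and "bimod_hopf A H la ra"
    and "lin_map A A R"
    and "rb_op H B"
  shows "rb_op (smash A H la ra) (Bbar A H la ra R B) \<longleftrightarrow>
    rb_op A R \<and>
    (\<forall>a\<in>carr A. \<forall>b\<in>carr A. \<forall>h\<in>carr H.
       R (sw3 (comult A) (\<lambda>a1 a2 a3. sw2 (comult H) (\<lambda>h1 h2.
            mult A (mult A (ra (mult A a1 (R a2)) h1) b) (la h2 (antipode A (R a3)))) h) a)
       = mult A (la (antipode H (B h)) (R a)) (R b)) \<and>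
    (\<forall>b\<in>carr A. \<forall>g\<in>carr H.
       R (sw3 (comult H) (\<lambda>g1 g2 g3. ra (la (mult H g1 (B g2)) b) (antipode H (B g3))) g)
       = ra (R b) (antipode H (B g)))"
proof -
  interpret lr_smash A H la ra
    by unfold_locales (use assms in auto)
  note Rl = assms(6)
  have B: "cmap H H B" and rbB: "\<forall>x\<in>carr H. \<forall>y\<in>carr H. mult H (B x) (B y) = B (rb_arg H B x y)"
    using assms(7) by (simp_all add: rb_op_iff)
  let ?Bb = "Bbar A H la ra R B"
  note Bbl = Bbar_lin[OF Rl B]
  \<comment> \<open>Generic in the type of the base, since the bases used below live in different
    types.\<close>
  have pB: "rb_points C H B" if "ccoalg C" for C :: "('k, 'c::ab_group_add) hopf_alg"
    by (rule rb_points_of_elements[OF H.cc H.mult_bilin H.antipode_lin cmap_lin[OF B] that rbB])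
  note c1 = cond1_def[OF Rl B] and c2 = cond2_def[OF Rl B]
  have "rb_op E ?Bb \<longleftrightarrow> rb_op A R \<and> (\<forall>a\<in>carr A. \<forall>b\<in>carr A. \<forall>h\<in>carr H. cond1 R B a b h) \<and>
    (\<forall>b\<in>carr A. \<forall>g\<in>carr H. cond2 R B b g)" (is "_ \<longleftrightarrow> ?rhs")
  proof
    assume "rb_op E ?Bb"
    then have Bb: "cmap E E ?Bb" and rbE: "\<forall>x\<in>carr E. \<forall>y\<in>carr E. mult E (?Bb x) (?Bb y) = ?Bb (rb_arg E ?Bb x y)"
      unfolding rb_op_iff by blast+
    \<comment> \<open>This must come first: the group argument applies \<open>R\<close> to
      points.\<close>
    have R: "cmap A A R" by (rule cmap_of_Bbar[OF Rl B pB[OF A.cc] Bb])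
    \<comment> \<open>Each of the three conditions is brought back to elements over its own
      universal base: A \<otimes> A, E \<otimes> A and H \<otimes> A.\<close>
    have pt: "rb_points C A R" "cond1_points R B C" "cond2_points R B C"
      if C: "ccoalg C" for C :: "('k, 'c::ab_group_add) hopf_alg"
      using rb_points_of_elements[OF E_cc mult_E_bilin antipode_E_lin Bbl C rbE] rb_points_equiv[OF Rl B C R pB[OF C]] by blast+
    show ?rhs
      unfolding rb_op_iff
      using R rb_elements_of_points[OF A.cc A.mult_bilin A.antipode_lin Rl pt(1)[OF ccoalg_smash[OF A.cc A.cc]]]
        cond1_elements_of_points[OF Rl B pt(2)[OF ccoalg_smash[OF E_cc A.cc]]]
        cond2_elements_of_points[OF Rl B pt(3)[OF ccoalg_smash[OF H.cc A.cc]]]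
      by blast
  next
    assume rhs: ?rhs
    then have R: "cmap A A R" and rbA: "\<forall>x\<in>carr A. \<forall>y\<in>carr A. mult A (R x) (R y) = R (rb_arg A R x y)"
      unfolding rb_op_iff by blast+
    \<comment> \<open>The base E \<otimes> E carries the universal pair of points of E, so the
      identity for \<open>B\<close>-bar is checked there alone.\<close>
    let ?C = "smash E E undefined undefined"
    have C: "ccoalg ?C" by (rule ccoalg_smash[OF E_cc E_cc])
    have "rb_points ?C E ?Bb"
      unfolding rb_points_equiv[OF Rl B C R pB[OF C]]
      using rb_points_of_elements[OF A.cc A.mult_bilin A.antipode_lin Rl C rbA]
        cond1_points_of_elements[OF Rl B C] cond2_points_of_elements[OF Rl B C] rhs by blast
    then show "rb_op E ?Bb"
      unfolding rb_op_iff
      using cmap_Bbar[OF Rl B R] rb_elements_of_points[OF E_cc mult_E_bilin antipode_E_lin Bbl] by blast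
  qed
  then show ?thesis by (simp only: c1 c2)
qed

end
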